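(* Let $d=3$ and $\sigma\in(3/2,2)$. Then, for all $\hbar\in(0,1]$ and all trace class operators $\gamma^\hbar_0$ on $L^2(\mathbb{R}^3)$, $$\|\rho^\hbar(\mathcal{U}^\hbar(t)\gamma^\hbar_0\,\mathcal{U}^\hbar(t)^* )\|_{\mathcal{F}L^1}\lesssim\frac{1}{\hbar^{3/2}}\|\langle\hbar\nabla\rangle^\sigma\gamma^\hbar_0\langle\hbar\nabla\rangle^\sigma\|_{\mathfrak{S}^2_\hbar},$$ $$\|\rho^\hbar(\mathcal{U}^\hbar(t)\gamma^\hbar_0\,\mathcal{U}^\hbar(t)^* )\|_{\mathcal{F}L^1}\lesssim\frac{1}{\hbar^{3/2}|t|^3}\|\langle x\rangle^\sigma\gamma^\hbar_0\langle x\rangle^\sigma\|_{\mathfrak{S}^2_\hbar}$$ (the second for $t\ne0$), where the implicit constants are independent of $\hbar$ (and $t$).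
   Context: $\langle y\rangle=(1+|y|^2)^{1/2}$; $\mathcal{U}^\hbar(t)=e^{it\hbar\Delta/2}$ on $L^2(\mathbb{R}^3)$; $\langle\hbar\nabla\rangle^\sigma$ is the Fourier multiplier with symbol $\langle\hbar\xi\rangle^\sigma$. $\|A\|_{\mathfrak{S}^2_\hbar}:=(2\pi\hbar)^{3/2}\|A\|_{\mathfrak{S}^2}$ (Hilbert–Schmidt norm). $\|f\|_{\mathcal{F}L^1}=\|\widehat f\|_{L^1}$ with $\widehat f(\xi)=(2\pi)^{-3/2}\int e^{-ix\xi}f(x)dx$. For trace class $A=\sum_na_n|u_n\rangle\langle v_n|$ (singular value decomposition), $\rho^\hbar(A)(x):=(2\pi\hbar)^3\sum_na_nu_n(x)\overline{v_n(x)}$. The right-hand sides may be $+\infty$. *)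

theory Defs
  imports "HOL-Analysis.Analysis"
begin

section \<open>The space of square integrable functions\<close>

text \<open>
  Elements of the Hilbert space are represented by Borel measurable, square integrable
  functions; equality in the Hilbert space is equality almost everywhere. Operators are
  functions on representatives, and all notions below are invariant under changing
  representatives on null sets.
\<close>

type_synonym R3 = "real^3"
type_synonym wave = "R3 \<Rightarrow> complex"
type_synonym wave_op = "wave \<Rightarrow> wave"

definition ennsqrt :: "ennreal \<Rightarrow> ennreal" where
  "ennsqrt x = (if x = top then top else ennreal (sqrt (enn2real x)))"

definition l2norm :: "wave \<Rightarrow> ennreal" where
  "l2norm f = ennsqrt (\<integral>\<^sup>+x. ennreal ((norm (f x))\<^sup>2) \<partial>lborel)"

definition L2 :: "wave set" where
  "L2 = {f \<in> borel_measurable lborel. l2norm f < top}"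

definition ae_eq :: "wave \<Rightarrow> wave \<Rightarrow> bool" where
  "ae_eq f g \<longleftrightarrow> (AE x in lborel. f x = g x)"

definition l2inner :: "wave \<Rightarrow> wave \<Rightarrow> complex" where
  "l2inner f g = (LINT x|lborel. cnj (f x) * g x)"

definition orthonormal :: "(nat \<Rightarrow> wave) \<Rightarrow> bool" where
  "orthonormal e \<longleftrightarrow> (\<forall>n. e n \<in> L2) \<and> (\<forall>m n. l2inner (e m) (e n) = (if m = n then 1 else 0))"

definition orthonormal_basis :: "(nat \<Rightarrow> wave) \<Rightarrow> bool" where
  "orthonormal_basis e \<longleftrightarrow> orthonormal e \<and>
     (\<forall>f\<in>L2. (\<lambda>N. l2norm (\<lambda>x. f x - (\<Sum>n<N. l2inner (e n) f * e n x))) \<longlonglongrightarrow> 0)"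


section \<open>Bounded, trace class and Hilbert--Schmidt operators\<close>

definition bounded_op :: "wave_op \<Rightarrow> bool" where
  "bounded_op A \<longleftrightarrow>
     (\<forall>f\<in>L2. A f \<in> L2) \<and>
     (\<forall>f\<in>L2. \<forall>g\<in>L2. ae_eq (A (\<lambda>x. f x + g x)) (\<lambda>x. A f x + A g x)) \<and>
     (\<forall>f\<in>L2. \<forall>c. ae_eq (A (\<lambda>x. c * f x)) (\<lambda>x. c * A f x)) \<and>
     (\<exists>C::real. \<forall>f\<in>L2. l2norm (A f) \<le> ennreal C * l2norm f)"

definition adj_op :: "wave_op \<Rightarrow> wave_op" where
  "adj_op A g = (SOME h. h \<in> L2 \<and> (\<forall>f\<in>L2. l2inner h f = l2inner g (A f)))"

text \<open>
  Singular value decomposition, the series converging strongly. As the Hilbert space is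
  infinite-dimensional, an operator of finite rank is covered by padding with vanishing singular
  values.
\<close>

definition svd :: "wave_op \<Rightarrow> (nat \<Rightarrow> real) \<Rightarrow> (nat \<Rightarrow> wave) \<Rightarrow> (nat \<Rightarrow> wave) \<Rightarrow> bool" where
  "svd A a u v \<longleftrightarrow> (\<forall>n. 0 \<le> a n) \<and> orthonormal u \<and> orthonormal v \<and>
     (\<forall>f\<in>L2. (\<lambda>N. l2norm (\<lambda>x. A f x - (\<Sum>n<N. of_real (a n) * l2inner (v n) f * u n x)))
                \<longlonglongrightarrow> 0)"

definition trace_class :: "wave_op \<Rightarrow> bool" where
  "trace_class A \<longleftrightarrow> bounded_op A \<and> (\<exists>a u v. svd A a u v \<and> summable a)"

text \<open>
  The density does not depend, up to null sets, on the chosen decomposition; the series converges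
  absolutely almost everywhere, and the density is integrable.
\<close>

definition rho_h :: "real \<Rightarrow> wave_op \<Rightarrow> wave" where
  "rho_h h A = (case (SOME (a, u, v). svd A a u v \<and> summable a) of (a, u, v) \<Rightarrow>
     (\<lambda>x. of_real ((2 * pi * h) ^ 3) * (\<Sum>n. of_real (a n) * u n x * cnj (v n x))))"

text \<open>
  For a bounded operator the sum below is the same for every orthonormal basis, so the infimum
  merely avoids choosing one.
\<close>

definition hs_norm :: "wave_op \<Rightarrow> ennreal" where
  "hs_norm B = (INF e\<in>{e. orthonormal_basis e}. ennsqrt (\<Sum>n. (l2norm (B (e n)))\<^sup>2))"

definition hs_norm_h :: "real \<Rightarrow> wave_op \<Rightarrow> ennreal" where
  "hs_norm_h h B = ennreal ((2 * pi * h) powr (3/2)) * hs_norm B"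

text \<open>
  The norm of \<open>S A S\<close> for an unbounded, densely defined self-adjoint \<open>S\<close> with domain \<open>D\<close>. It is
  the norm of the bounded extension \<open>B\<close> of \<open>S A S\<close> (unique, as \<open>D\<close> is dense), and \<open>\<infinity>\<close> (the
  infimum of the empty set) if \<open>S A S\<close> is not defined on all of \<open>D\<close> or has no bounded extension.
  Requiring \<open>B\<close> to extend \<open>S A S\<close> only on its natural domain would be wrong: for
  \<open>A f = <v, f> u\<close> with \<open>u\<close> and \<open>v\<close> outside \<open>D\<close>, that domain is dense but \<open>S A S\<close> vanishes on it.
\<close>

definition sandwich_hs_norm_h ::
    "real \<Rightarrow> wave set \<Rightarrow> wave_op \<Rightarrow> wave_op \<Rightarrow> ennreal" where
  "sandwich_hs_norm_h h D S A =
     (INF B\<in>{B. bounded_op B \<and> (\<forall>f\<in>D. A (S f) \<in> D \<and> ae_eq (B f) (S (A (S f))))}.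
        hs_norm_h h B)"


section \<open>Fourier transform and the operators of the statement\<close>

definition fourier :: "wave \<Rightarrow> wave" where
  "fourier f \<xi> = of_real ((2 * pi) powr (-3/2)) * (LINT x|lborel. cis (- (x \<bullet> \<xi>)) * f x)"

definition FL1_norm :: "wave \<Rightarrow> ennreal" where
  "FL1_norm f = (\<integral>\<^sup>+\<xi>. ennreal (norm (fourier f \<xi>)) \<partial>lborel)"

text \<open>The Fourier--Plancherel transform, as a limit of truncated Fourier integrals.\<close>

definition l2_fourier :: wave_op where
  "l2_fourier f = (SOME g. g \<in> L2 \<and>
     ((\<lambda>R::real. l2norm (\<lambda>\<xi>. g \<xi> - fourier (\<lambda>x. indicator (cball 0 R) x * f x) \<xi>)) \<longlongrightarrow> 0) at_top)"

definition fmult_dom :: "wave \<Rightarrow> wave set" where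
  "fmult_dom m = {f \<in> L2. (\<lambda>\<xi>. m \<xi> * l2_fourier f \<xi>) \<in> L2}"

definition fmult :: "wave \<Rightarrow> wave_op" where
  "fmult m f = (SOME g. g \<in> L2 \<and> ae_eq (l2_fourier g) (\<lambda>\<xi>. m \<xi> * l2_fourier f \<xi>))"

definition mult_dom :: "wave \<Rightarrow> wave set" where
  "mult_dom w = {f \<in> L2. (\<lambda>x. w x * f x) \<in> L2}"

definition mult_op :: "wave \<Rightarrow> wave_op" where
  "mult_op w f = (\<lambda>x. w x * f x)"

definition bracket :: "R3 \<Rightarrow> real" where
  "bracket y = (1 + (norm y)\<^sup>2) powr (1/2)"

text \<open>\<open>exp (i t h \<Delta> / 2)\<close>, where \<open>\<Delta>\<close> has Fourier symbol \<open>- |\<xi>|\<^sup>2\<close>\<close>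

definition propagator :: "real \<Rightarrow> real \<Rightarrow> wave_op" where
  "propagator h t = fmult (\<lambda>\<xi>. cis (- (t * h * (norm \<xi>)\<^sup>2 / 2)))"

definition evolved :: "real \<Rightarrow> real \<Rightarrow> wave_op \<Rightarrow> wave_op" where
  "evolved h t A = propagator h t \<circ> A \<circ> adj_op (propagator h t)"

definition momentum_weight :: "real \<Rightarrow> real \<Rightarrow> wave" where
  "momentum_weight h \<sigma> \<xi> = of_real (bracket (h *\<^sub>R \<xi>) powr \<sigma>)"

definition position_weight :: "real \<Rightarrow> wave" where
  "position_weight \<sigma> x = of_real (bracket x powr \<sigma>)"

definition momentum_weighted_norm :: "real \<Rightarrow> real \<Rightarrow> wave_op \<Rightarrow> ennreal" where
  "momentum_weighted_norm h \<sigma> A =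
     sandwich_hs_norm_h h (fmult_dom (momentum_weight h \<sigma>)) (fmult (momentum_weight h \<sigma>)) A"

definition position_weighted_norm :: "real \<Rightarrow> real \<Rightarrow> wave_op \<Rightarrow> ennreal" where
  "position_weighted_norm h \<sigma> A =
     sandwich_hs_norm_h h (mult_dom (position_weight \<sigma>)) (mult_op (position_weight \<sigma>)) A"

end

theory Submission
  imports Defs "HOL-Probability.Probability"
begin

text \<open>
  Let \<open>U\<close> be the propagator and \<open>\<gamma> = \<Sum>n. a n |p n><q n|\<close>, with integral kernel \<open>K\<close>. Up to constants, the
  Fourier transform of the density at \<open>\<xi>\<close> is the trace of \<open>e\<^sup>-\<^sup>i\<^sup>x\<^sup>\<xi> U \<gamma> U*\<close>. On the Fourier side \<open>U\<close> is a
  unimodular multiplication and \<open>e\<^sup>-\<^sup>i\<^sup>x\<^sup>\<xi>\<close> a shift by \<open>\<xi>\<close>, so this trace is at most the integral of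
  \<open>|K^(\<eta>, \<eta> - \<xi>)|\<close> over \<open>\<eta>\<close>. On the position side \<open>U* e\<^sup>-\<^sup>i\<^sup>x\<^sup>\<xi> U\<close> is a modulation composed with the
  translation by \<open>t h \<xi>\<close>, so it is at most the integral of \<open>|K(x - t h \<xi>, x)|\<close> over \<open>x\<close>. Integrating in
  \<open>\<xi>\<close> turns both into \<open>L\<^sup>1\<close> norms of kernels, the second with the Jacobian \<open>(|t| h)\<^sup>-\<^sup>3\<close>. With the
  weight \<open>w = <.>\<^sup>\<sigma>\<close>, whose inverse is square integrable because \<open>\<sigma> > 3/2\<close>, Cauchy--Schwarz bounds the
  \<open>L\<^sup>1\<close> norm of \<open>K(x, y)\<close> by the \<open>L\<^sup>2\<close> norm of \<open>w(x) K(x, y) w(y)\<close>, a Hilbert--Schmidt norm.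
\<close>

section \<open>Square integrable functions\<close>

text \<open>The factor \<open>(2 * pi * h) ^ 3\<close> of the density and the normalisation in
  \<open>hs_norm_h\<close> leave \<open>h powr (3/2)\<close>. The remaining factor
  \<open>1 / h ^ 3\<close> is the integral of the inverse squared weight at
  \<open>h *\<^sub>R \<xi>\<close> in the momentum estimate, and part of the Jacobian in the
  position estimate. The phases produced by the propagator do not depend on \<open>n\<close>, so
  they leave the singular value series before the modulus is taken. The modulus has to stay outside
  that series: a termwise bound would lose the orthogonality behind the Hilbert--Schmidt norm. The
  weighted operator is known only as some bounded extension \<open>B\<close>. Its kernel is
  therefore built from the values of \<open>B\<close> on an orthonormal basis, and compared with the
  kernel of \<gamma> through sesquilinear forms, tested on functions multiplied by the inverse
  weight so that they lie in the domain. Transform, propagator, adjoint and density are all chosen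
  by \<open>SOME\<close> on representatives. Hence operator identities hold only almost everywhere,
  and unitarity is recorded through inner products.\<close>

definition sq_int :: "'a measure \<Rightarrow> ('a \<Rightarrow> complex) \<Rightarrow> bool" where
  "sq_int M f \<longleftrightarrow> f \<in> borel_measurable M \<and> integrable M (\<lambda>x. (norm (f x))\<^sup>2)"

text \<open>Real-valued and over an arbitrary measure, so that the same lemmas serve functions on
  \<open>R3\<close> and kernels on \<open>lborel2\<close>. Outside \<open>sq_int\<close> the
  integral may default to 0; \<open>l2norm_eq\<close> gives the link with the extended-valued
  \<open>l2norm\<close>.\<close>

definition norm2 :: "'a measure \<Rightarrow> ('a \<Rightarrow> complex) \<Rightarrow> real" where
  "norm2 M f = sqrt (\<integral>x. (norm (f x))\<^sup>2 \<partial>M)"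

definition inner2 :: "'a measure \<Rightarrow> ('a \<Rightarrow> complex) \<Rightarrow> ('a \<Rightarrow> complex) \<Rightarrow> complex" where
  "inner2 M f g = (\<integral>x. cnj (f x) * g x \<partial>M)"

lemma measurable_cnj [measurable (raw)]:
  "f \<in> borel_measurable M \<Longrightarrow> (\<lambda>x. cnj (f x)) \<in> borel_measurable M"
  by (rule borel_measurable_continuous_on[where f = cnj]) (intro continuous_intros)

lemma sq_int_measurable: "sq_int M f \<Longrightarrow> f \<in> borel_measurable M"
  by (simp add: sq_int_def)

lemma norm2_nonneg [simp]: "0 \<le> norm2 M f"
  by (simp add: norm2_def)

lemma norm2_power2: "(norm2 M f)\<^sup>2 = (\<integral>x. (norm (f x))\<^sup>2 \<partial>M)"
  by (simp add: norm2_def)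

lemma nn_integral_norm_sq:
  assumes "sq_int M f"
  shows "(\<integral>\<^sup>+x. ennreal ((norm (f x))\<^sup>2) \<partial>M) = ennreal ((norm2 M f)\<^sup>2)"
  unfolding norm2_power2 using assms by (intro nn_integral_eq_integral) (auto simp: sq_int_def)

lemma sq_intI:
  assumes "g \<in> borel_measurable M" "integrable M h" "\<And>x. (norm (g x))\<^sup>2 \<le> h x"
  shows "sq_int M g"
  unfolding sq_int_def
proof (intro conjI assms(1) Bochner_Integration.integrable_bound[OF assms(2)] AE_I2)
  show "norm ((norm (g x))\<^sup>2) \<le> norm (h x)" for x
    using assms(3)[of x] order_trans[OF zero_le_power2 assms(3)[of x]] by (simp del: norm_power)
  show "(\<lambda>x. (norm (g x))\<^sup>2) \<in> borel_measurable M"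
    using assms(1) by measurable
qed

lemma sq_int_mono:
  assumes "sq_int M f" "g \<in> borel_measurable M" "\<And>x. norm (g x) \<le> c * norm (f x)"
  shows "sq_int M g"
proof (rule sq_intI)
  show "integrable M (\<lambda>x. c\<^sup>2 * (norm (f x))\<^sup>2)"
    using assms(1) by (simp add: sq_int_def)
  show "(norm (g x))\<^sup>2 \<le> c\<^sup>2 * (norm (f x))\<^sup>2" for x
    using power_mono[OF assms(3)[of x], of 2] by (simp add: power_mult_distrib)
qed fact

lemma sq_int_zero [simp]: "sq_int M (\<lambda>x. 0)"
  by (simp add: sq_int_def)

lemma sq_int_add:
  assumes "sq_int M f" "sq_int M g"
  shows "sq_int M (\<lambda>x. f x + g x)"
proof (rule sq_intI)
  show "(norm (f x + g x))\<^sup>2 \<le> 2 * (norm (f x))\<^sup>2 + 2 * (norm (g x))\<^sup>2" for x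
  proof -
    have "(norm (f x + g x))\<^sup>2 \<le> (norm (f x) + norm (g x))\<^sup>2"
      by (intro power_mono norm_triangle_ineq) auto
    also have "\<dots> \<le> 2 * (norm (f x))\<^sup>2 + 2 * (norm (g x))\<^sup>2"
      using sum_squares_bound[of "norm (f x)" "norm (g x)"] by (simp add: power2_sum)
    finally show ?thesis .
  qed
qed (use assms in \<open>auto simp: sq_int_def\<close>)

lemma sq_int_bounded_mult:
  assumes "sq_int M f" "g \<in> borel_measurable M" "\<And>x. norm (g x) \<le> c"
  shows "sq_int M (\<lambda>x. g x * f x)"
  by (rule sq_int_mono[OF assms(1), of _ c])
     (use assms in \<open>auto simp: norm_mult mult_right_mono sq_int_def\<close>)

lemma sq_int_cmult: "sq_int M f \<Longrightarrow> sq_int M (\<lambda>x. c * f x)"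
  by (rule sq_int_bounded_mult[of M f _ "norm c"]) auto

lemma sq_int_diff:
  "sq_int M f \<Longrightarrow> sq_int M g \<Longrightarrow> sq_int M (\<lambda>x. f x - g x)"
  using sq_int_add[of M f "\<lambda>x. - 1 * g x"] sq_int_cmult[of M g "-1"] by simp

lemma sq_int_cnj: "sq_int M f \<Longrightarrow> sq_int M (\<lambda>x. cnj (f x))"
  by (rule sq_int_mono[of M f _ 1])
     (auto simp: sq_int_def)

lemma sq_int_sum:
  "(\<And>i. i \<in> I \<Longrightarrow> sq_int M (f i)) \<Longrightarrow> sq_int M (\<lambda>x. \<Sum>i\<in>I. f i x)"
  by (induction I rule: infinite_finite_induct) (auto intro: sq_int_add)

lemma integrable_norm_mult:
  assumes "sq_int M f" "sq_int M g"
  shows "integrable M (\<lambda>x. norm (f x) * norm (g x))"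
proof (rule Bochner_Integration.integrable_bound)
  show "integrable M (\<lambda>x. (norm (f x))\<^sup>2 + (norm (g x))\<^sup>2)"
    using assms by (auto simp: sq_int_def)
  show "AE x in M. norm (norm (f x) * norm (g x)) \<le> norm ((norm (f x))\<^sup>2 + (norm (g x))\<^sup>2)"
  proof (rule AE_I2)
    fix x
    have "2 * (norm (f x) * norm (g x)) \<le> (norm (f x))\<^sup>2 + (norm (g x))\<^sup>2"
      using sum_squares_bound[of "norm (f x)" "norm (g x)"] by (simp add: mult.assoc)
    moreover have "0 \<le> norm (f x) * norm (g x)" by simp
    ultimately show "norm (norm (f x) * norm (g x)) \<le> norm ((norm (f x))\<^sup>2 + (norm (g x))\<^sup>2)"
      unfolding real_norm_def by linarith
  qed
  show "(\<lambda>x. norm (f x) * norm (g x)) \<in> borel_measurable M"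
    using assms by (intro borel_measurable_times borel_measurable_norm) (auto simp: sq_int_def)
qed

lemma integrable_mult_sq:
  assumes "sq_int M f" "sq_int M g"
  shows "integrable M (\<lambda>x. f x * g x)"
  using integrable_norm_mult[OF assms]
  by (rule Bochner_Integration.integrable_bound)
     (use assms in \<open>auto simp: norm_mult sq_int_def\<close>)

lemma integrable_inner2:
  assumes "sq_int M f" "sq_int M g"
  shows "integrable M (\<lambda>x. cnj (f x) * g x)"
  by (intro integrable_mult_sq sq_int_cnj assms)

lemma Cauchy_Schwarz_norm2:
  assumes "sq_int M f" "sq_int M g"
  shows "(\<integral>x. norm (f x) * norm (g x) \<partial>M) \<le> norm2 M f * norm2 M g"
proof (rule power2_le_imp_le)
  have [measurable]: "f \<in> borel_measurable M" "g \<in> borel_measurable M"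
    using assms by (auto simp: sq_int_def)
  have "ennreal ((\<integral>x. norm (f x) * norm (g x) \<partial>M)\<^sup>2) =
      (\<integral>\<^sup>+x. ennreal (norm (f x)) * ennreal (norm (g x)) \<partial>M)\<^sup>2"
    using nn_integral_eq_integral[OF integrable_norm_mult[OF assms]]
    by (simp add: ennreal_power ennreal_mult)
  also have "\<dots> \<le> (\<integral>\<^sup>+x. (ennreal (norm (f x)))\<^sup>2 \<partial>M) * (\<integral>\<^sup>+x. (ennreal (norm (g x)))\<^sup>2 \<partial>M)"
    by (rule Cauchy_Schwarz_nn_integral) auto
  also have "\<dots> = ennreal ((norm2 M f * norm2 M g)\<^sup>2)"
    using assms by (simp add: ennreal_power nn_integral_norm_sq power_mult_distrib ennreal_mult)
  finally show "(\<integral>x. norm (f x) * norm (g x) \<partial>M)\<^sup>2 \<le> (norm2 M f * norm2 M g)\<^sup>2"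
    by simp
qed simp

lemma norm_inner2_le:
  assumes "sq_int M f" "sq_int M g"
  shows "norm (inner2 M f g) \<le> norm2 M f * norm2 M g"
proof -
  have "norm (inner2 M f g) \<le> (\<integral>x. norm (cnj (f x) * g x) \<partial>M)"
    unfolding inner2_def by (rule integral_norm_bound)
  also have "\<dots> \<le> norm2 M f * norm2 M g"
    using Cauchy_Schwarz_norm2[OF assms] by (simp add: norm_mult)
  finally show ?thesis .
qed

lemma inner2_diff_right:
  "sq_int M f \<Longrightarrow> sq_int M g \<Longrightarrow> sq_int M h \<Longrightarrow>
    inner2 M f (\<lambda>x. g x - h x) = inner2 M f g - inner2 M f h"
  by (simp add: inner2_def right_diff_distrib integrable_inner2)

lemma inner2_cmult_right: "inner2 M f (\<lambda>x. c * g x) = c * inner2 M f g"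
  by (simp add: inner2_def mult.left_commute)

lemma inner2_cmult_left: "inner2 M (\<lambda>x. c * f x) g = cnj c * inner2 M f g"
  by (simp add: inner2_def mult.assoc)

lemma inner2_commute: "inner2 M g f = cnj (inner2 M f g)"
  unfolding inner2_def by (subst Bochner_Integration.integral_cnj[symmetric]) (simp add: mult.commute)

lemma inner2_sum_right:
  "sq_int M f \<Longrightarrow> (\<And>i. i \<in> I \<Longrightarrow> sq_int M (g i)) \<Longrightarrow>
    inner2 M f (\<lambda>x. \<Sum>i\<in>I. g i x) = (\<Sum>i\<in>I. inner2 M f (g i))"
  by (simp add: inner2_def sum_distrib_left integrable_inner2)

lemma inner2_self: "inner2 M f f = of_real ((norm2 M f)\<^sup>2)"
proof -
  have "cnj z * z = of_real ((norm z)\<^sup>2)" for z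
    by (metis complex_norm_square mult.commute)
  then show ?thesis
    unfolding inner2_def norm2_power2 integral_complex_of_real[symmetric] by simp
qed

lemma norm2_cong_AE:
  assumes "AE x in M. f x = g x" "f \<in> borel_measurable M" "g \<in> borel_measurable M"
  shows "norm2 M f = norm2 M g"
  unfolding norm2_def using assms by (intro arg_cong[of _ _ sqrt] integral_cong_AE) auto

lemma inner2_cong_AE:
  assumes "AE x in M. f x = f' x" "AE x in M. g x = g' x"
    and "sq_int M f" "sq_int M f'" "sq_int M g" "sq_int M g'"
  shows "inner2 M f g = inner2 M f' g'"
  unfolding inner2_def using assms by (intro integral_cong_AE) (auto simp: sq_int_def)

lemma norm2_cmult: "norm2 M (\<lambda>x. c * f x) = norm c * norm2 M f"
  by (simp add: norm2_def norm_mult power_mult_distrib real_sqrt_mult)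

lemma norm2_minus_commute: "norm2 M (\<lambda>x. f x - g x) = norm2 M (\<lambda>x. g x - f x)"
  by (simp add: norm2_def norm_minus_commute)

lemma norm2_add_sq:
  assumes "sq_int M f" "sq_int M g"
  shows "(norm2 M (\<lambda>x. f x + g x))\<^sup>2 = (norm2 M f)\<^sup>2 + (norm2 M g)\<^sup>2 + 2 * Re (inner2 M f g)"
proof -
  have "(norm (z + w))\<^sup>2 = (norm z)\<^sup>2 + (norm w)\<^sup>2 + 2 * Re (cnj z * w)" for z w :: complex
    by (simp add: cmod_power2 power2_sum algebra_simps)
  then have "(norm2 M (\<lambda>x. f x + g x))\<^sup>2 =
      (\<integral>x. (norm (f x))\<^sup>2 + (norm (g x))\<^sup>2 + 2 * Re (cnj (f x) * g x) \<partial>M)"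
    by (simp add: norm2_power2)
  also have "\<dots> = (norm2 M f)\<^sup>2 + (norm2 M g)\<^sup>2 + 2 * (\<integral>x. Re (cnj (f x) * g x) \<partial>M)"
    using assms integrable_Re[OF integrable_inner2[OF assms]]
    unfolding norm2_power2 sq_int_def
    by (subst Bochner_Integration.integral_add) (auto simp del: times_complex.sel)
  also have "(\<integral>x. Re (cnj (f x) * g x) \<partial>M) = Re (inner2 M f g)"
    unfolding inner2_def by (rule integral_Re[OF integrable_inner2[OF assms]])
  finally show ?thesis .
qed

lemma norm2_triangle:
  assumes "sq_int M f" "sq_int M g"
  shows "norm2 M (\<lambda>x. f x + g x) \<le> norm2 M f + norm2 M g"
proof (rule power2_le_imp_le)
  have "Re (inner2 M f g) \<le> norm2 M f * norm2 M g"
    using complex_Re_le_cmod[of "inner2 M f g"] norm_inner2_le[OF assms] by linarith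
  then show "(norm2 M (\<lambda>x. f x + g x))\<^sup>2 \<le> (norm2 M f + norm2 M g)\<^sup>2"
    by (simp add: norm2_add_sq[OF assms] power2_sum)
qed simp

lemma norm2_triangle_diff:
  assumes "sq_int M f" "sq_int M g" "sq_int M h"
  shows "norm2 M (\<lambda>x. f x - h x) \<le> norm2 M (\<lambda>x. f x - g x) + norm2 M (\<lambda>x. g x - h x)"
  using norm2_triangle[of M "\<lambda>x. f x - g x" "\<lambda>x. g x - h x"] assms
  by (simp add: sq_int_diff)

lemma norm2_triangle_ineq2:
  assumes "sq_int M f" "sq_int M g"
  shows "\<bar>norm2 M f - norm2 M g\<bar> \<le> norm2 M (\<lambda>x. f x - g x)"
  using norm2_triangle[of M "\<lambda>x. f x - g x" g] norm2_triangle[of M "\<lambda>x. g x - f x" f] assms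
  by (simp add: sq_int_diff norm2_minus_commute[of M f g])

lemma norm2_eq_0_iff:
  assumes "sq_int M f"
  shows "norm2 M f = 0 \<longleftrightarrow> (AE x in M. f x = 0)"
  using assms integral_nonneg_eq_0_iff_AE[of M "\<lambda>x. (norm (f x))\<^sup>2"]
  by (simp add: norm2_def sq_int_def)

section \<open>Limits, Fatou's lemma and completeness in L2\<close>

lemma tendsto_norm2:
  assumes "(\<lambda>n. norm2 M (\<lambda>x. f n x - g x)) \<longlonglongrightarrow> 0" "\<And>n. sq_int M (f n)" "sq_int M g"
  shows "(\<lambda>n. norm2 M (f n)) \<longlonglongrightarrow> norm2 M g"
  by (rule LIM_zero_cancel, rule Lim_null_comparison[OF _ assms(1)])
     (use norm2_triangle_ineq2[OF assms(2,3)] in auto)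

lemma tendsto_inner2_right:
  assumes "(\<lambda>n. norm2 M (\<lambda>x. f n x - g x)) \<longlonglongrightarrow> 0" "\<And>n. sq_int M (f n)"
    "sq_int M g" "sq_int M h"
  shows "(\<lambda>n. inner2 M h (f n)) \<longlonglongrightarrow> inner2 M h g"
proof (rule LIM_zero_cancel, rule Lim_null_comparison)
  show "(\<lambda>n. norm2 M h * norm2 M (\<lambda>x. f n x - g x)) \<longlonglongrightarrow> 0"
    using tendsto_mult_right_zero[OF assms(1)] .
  show "\<forall>\<^sub>F n in sequentially. norm (inner2 M h (f n) - inner2 M h g)
      \<le> norm2 M h * norm2 M (\<lambda>x. f n x - g x)"
    using norm_inner2_le[OF assms(4) sq_int_diff[OF assms(2,3)]] assms
    by (simp add: inner2_diff_right)
qed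

lemma norm2_limit_unique:
  assumes "((\<lambda>n. norm2 M (\<lambda>x. f n x - g x)) \<longlongrightarrow> 0) F" "((\<lambda>n. norm2 M (\<lambda>x. f n x - h x)) \<longlongrightarrow> 0) F"
    and "F \<noteq> bot" "\<And>n. sq_int M (f n)" "sq_int M g" "sq_int M h"
  shows "AE x in M. g x = h x"
proof -
  have "norm2 M (\<lambda>x. g x - h x) \<le> norm2 M (\<lambda>x. f n x - g x) + norm2 M (\<lambda>x. f n x - h x)" for n
    using norm2_triangle_diff[of M g "f n" h] assms by (simp add: norm2_minus_commute[of M "f n" g])
  then have "norm2 M (\<lambda>x. g x - h x) \<le> 0"
    using tendsto_add[OF assms(1,2)] assms(3)
    by (intro tendsto_lowerbound[of _ 0 F]) auto
  then have "norm2 M (\<lambda>x. g x - h x) = 0" using norm2_nonneg by (metis antisym)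
  then show ?thesis
    using norm2_eq_0_iff[OF sq_int_diff[OF assms(5,6)]] by simp
qed

text \<open>Fatou for the squared moduli. The bound is asked for only eventually, so that it can be
  a limit of norms plus some slack; square integrability of the limit is part of the
  conclusion.\<close>

lemma norm2_Fatou:
  assumes lim: "AE x in M. (\<lambda>n. f n x) \<longlonglongrightarrow> g x"
    and f: "\<And>n. sq_int M (f n)" and [measurable]: "g \<in> borel_measurable M"
    and le: "\<forall>\<^sub>F n in sequentially. norm2 M (f n) \<le> c" and "0 \<le> c"
  shows "sq_int M g" "norm2 M g \<le> c"
proof -
  have [measurable]: "f n \<in> borel_measurable M" for n using f by (simp add: sq_int_def)
  have "(\<integral>\<^sup>+x. ennreal ((norm (g x))\<^sup>2) \<partial>M) = (\<integral>\<^sup>+x. liminf (\<lambda>n. ennreal ((norm (f n x))\<^sup>2)) \<partial>M)"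
  proof (rule nn_integral_cong_AE)
    show "AE x in M. ennreal ((norm (g x))\<^sup>2) = liminf (\<lambda>n. ennreal ((norm (f n x))\<^sup>2))"
      using lim
    proof eventually_elim
      case (elim x)
      then have "(\<lambda>n. ennreal ((norm (f n x))\<^sup>2)) \<longlonglongrightarrow> ennreal ((norm (g x))\<^sup>2)"
        by (intro tendsto_ennrealI tendsto_power tendsto_norm)
      then show ?case using lim_imp_Liminf trivial_limit_sequentially by metis
    qed
  qed
  also have "\<dots> \<le> liminf (\<lambda>n. \<integral>\<^sup>+x. ennreal ((norm (f n x))\<^sup>2) \<partial>M)"
    by (rule nn_integral_liminf) auto
  also have "\<dots> = liminf (\<lambda>n. ennreal ((norm2 M (f n))\<^sup>2))"
    using f by (simp add: nn_integral_norm_sq)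
  also have "\<dots> \<le> ennreal (c\<^sup>2)"
  proof -
    have "\<forall>\<^sub>F n in sequentially. ennreal ((norm2 M (f n))\<^sup>2) \<le> ennreal (c\<^sup>2)"
      using le by eventually_elim (auto intro!: ennreal_leI power_mono)
    then have "Limsup sequentially (\<lambda>n. ennreal ((norm2 M (f n))\<^sup>2)) \<le> ennreal (c\<^sup>2)"
      by (rule Limsup_bounded)
    then show ?thesis
      using Liminf_le_Limsup[of sequentially "\<lambda>n. ennreal ((norm2 M (f n))\<^sup>2)"] by auto
  qed
  finally have *: "(\<integral>\<^sup>+x. ennreal ((norm (g x))\<^sup>2) \<partial>M) \<le> ennreal (c\<^sup>2)" .
  then show g: "sq_int M g"
    unfolding sq_int_def
    by (intro conjI integrableI_bounded) (auto intro: le_less_trans)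
  have "(norm2 M g)\<^sup>2 \<le> c\<^sup>2"
    using * nn_integral_norm_sq[OF g] by simp
  then show "norm2 M g \<le> c" using \<open>0 \<le> c\<close> by (rule power2_le_imp_le)
qed

text \<open>Riesz--Fischer by reduction to L1: multiplication by a strictly positive square
  integrable \<open>h\<close> turns an L2 Cauchy sequence into an L1 Cauchy one, which has a
  subsequence that is Cauchy almost everywhere. Dividing by \<open>h\<close> and applying Fatou
  recovers L2 convergence of the full sequence.\<close>

lemma (in sigma_finite_measure) sq_int_complete:
  assumes f: "\<And>n. sq_int M (f n)"
    and cauchy: "\<And>e. e > 0 \<Longrightarrow> \<exists>N. \<forall>i\<ge>N. \<forall>j\<ge>N. norm2 M (\<lambda>x. f i x - f j x) < e"
  obtains g where "sq_int M g" "(\<lambda>n. norm2 M (\<lambda>x. f n x - g x)) \<longlonglongrightarrow> 0"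
proof -
  have [measurable]: "f n \<in> borel_measurable M" for n using f by (simp add: sq_int_def)
  \<comment> \<open>Sigma-finiteness supplies a positive integrable function; its square root is the
    factor \<open>h\<close>.\<close>
  obtain h0 :: "'a \<Rightarrow> real" where [measurable]: "h0 \<in> borel_measurable M"
    and h0: "\<And>x. h0 x > 0" "integrable M h0"
    using obtain_positive_integrable_function by metis
  define h where "h x = complex_of_real (sqrt (h0 x))" for x
  have [measurable]: "h \<in> borel_measurable M" unfolding h_def by measurable
  have h: "sq_int M h"
    using h0 by (simp add: sq_int_def h_def less_imp_le)
  have fh: "integrable M (\<lambda>x. h x * f n x)" for n
    by (intro integrable_mult_sq h f)
  have "\<exists>N. \<forall>i\<ge>N. \<forall>j\<ge>N. (LINT x|M. norm (h x * f i x - h x * f j x)) < e" if e: "e > 0" for e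
  proof -
    \<comment> \<open>The added 1 keeps the denominator positive even if \<open>h\<close> has norm
      0, as it does for the null measure.\<close>
    have pos: "e / (norm2 M h + 1) > 0"
      using e norm2_nonneg[of M h] by (intro divide_pos_pos) linarith+
    obtain N where N: "\<And>i j. i \<ge> N \<Longrightarrow> j \<ge> N \<Longrightarrow> norm2 M (\<lambda>x. f i x - f j x) < e / (norm2 M h + 1)"
      using cauchy[OF pos] by blast
    have "(LINT x|M. norm (h x * f i x - h x * f j x)) < e" if "i \<ge> N" "j \<ge> N" for i j
    proof -
      have "(LINT x|M. norm (h x * f i x - h x * f j x)) \<le> norm2 M h * norm2 M (\<lambda>x. f i x - f j x)"
        using Cauchy_Schwarz_norm2[OF h sq_int_diff[OF f f]]
        by (simp add: right_diff_distrib[symmetric] norm_mult)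
      also have "\<dots> \<le> (norm2 M h + 1) * norm2 M (\<lambda>x. f i x - f j x)"
        by (intro mult_right_mono) auto
      also have "\<dots> < (norm2 M h + 1) * (e / (norm2 M h + 1))"
        using norm2_nonneg[of M h] by (intro mult_strict_left_mono N that) linarith
      also have "\<dots> = e" using norm2_nonneg[of M h] by (simp add: add_nonneg_eq_0_iff)
      finally show ?thesis .
    qed
    then show ?thesis by blast
  qed
  then obtain r where r: "strict_mono r" "AE x in M. Cauchy (\<lambda>i. h x * f (r i) x)"
    using cauchy_L1_AE_cauchy_subseq[of M "\<lambda>n x. h x * f n x"] fh by blast
  define g where "g x = lim (\<lambda>i. f (r i) x)" for x
  have [measurable]: "g \<in> borel_measurable M" unfolding g_def by measurable
  have lim: "AE x in M. (\<lambda>i. f (r i) x) \<longlonglongrightarrow> g x"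
    using r(2)
  proof eventually_elim
    case (elim x)
    have nz: "h x \<noteq> 0" using h0(1)[of x] by (simp add: h_def)
    from elim have "convergent (\<lambda>i. h x * f (r i) x)" by (simp add: Cauchy_convergent_iff)
    then have "convergent (\<lambda>i. f (r i) x)" using nz by (simp add: convergent_mult_const_iff)
    then show ?case by (simp add: g_def convergent_LIMSEQ_iff)
  qed
  \<comment> \<open>Fatou along the subsequence with \<open>n\<close> fixed. The first conjunct
    yields \<open>sq_int M g\<close> later, by adding \<open>f n\<close> back.\<close>
  have small: "\<exists>N. \<forall>n\<ge>N. sq_int M (\<lambda>x. g x - f n x) \<and> norm2 M (\<lambda>x. g x - f n x) \<le> e" if e: "e > 0" for e
  proof -
    obtain N where N: "\<And>i j. i \<ge> N \<Longrightarrow> j \<ge> N \<Longrightarrow> norm2 M (\<lambda>x. f i x - f j x) < e"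
      using cauchy[OF e] by blast
    have "sq_int M (\<lambda>x. g x - f n x) \<and> norm2 M (\<lambda>x. g x - f n x) \<le> e" if n: "n \<ge> N" for n
    proof -
      have 1: "AE x in M. (\<lambda>i. f (r i) x - f n x) \<longlonglongrightarrow> g x - f n x"
        using lim by eventually_elim (auto intro: tendsto_intros)
      have 2: "\<forall>\<^sub>F i in sequentially. norm2 M (\<lambda>x. f (r i) x - f n x) \<le> e"
        using eventually_ge_at_top[of N]
      proof eventually_elim
        case (elim i)
        then have "r i \<ge> N" using seq_suble[OF r(1), of i] by linarith
        then show ?case using N[of "r i" n] n by simp
      qed
      show ?thesis
        using norm2_Fatou[OF 1 _ _ 2] f \<open>e > 0\<close> by (auto intro: sq_int_diff)
    qed
    then show ?thesis by blast
  qed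
  obtain n where "sq_int M (\<lambda>x. g x - f n x)" using small[of 1] by auto
  from sq_int_add[OF this f[of n]] have g: "sq_int M g" by simp
  have "(\<lambda>n. norm2 M (\<lambda>x. f n x - g x)) \<longlonglongrightarrow> 0"
  proof (rule LIMSEQ_I)
    fix e :: real assume "e > 0"
    then obtain N where "\<forall>n\<ge>N. norm2 M (\<lambda>x. g x - f n x) \<le> e / 2" using small[of "e / 2"] by auto
    then have "\<forall>n\<ge>N. norm (norm2 M (\<lambda>x. f n x - g x) - 0) < e"
      using \<open>e > 0\<close> by (subst norm2_minus_commute) (fastforce intro: le_less_trans)
    then show "\<exists>N. \<forall>n\<ge>N. norm (norm2 M (\<lambda>x. f n x - g x) - 0) < e" by blast
  qed
  with g that show ?thesis by blast
qed

section \<open>Affine changes of variables and the Gaussian\<close>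

text \<open>Negative \<open>c\<close> is allowed because the substitutions for
  \<open>\<eta> - \<xi>\<close> and \<open>x - r *\<^sub>R \<xi>\<close> involve a
  reflection.\<close>

lemma lborel_scale_shift:
  fixes t :: "'a::euclidean_space" and c :: real
  assumes "c \<noteq> 0" "f \<in> borel_measurable borel"
  shows "(\<integral>\<^sup>+x. f x \<partial>lborel) = ennreal (\<bar>c\<bar> ^ DIM('a)) * (\<integral>\<^sup>+x. f (t + c *\<^sub>R x) \<partial>lborel)"
  by (subst lborel_affine[OF assms(1), of t])
     (use assms in \<open>simp add: nn_integral_density nn_integral_distr nn_integral_cmult\<close>)

lemma lborel_integral_scale_shift:
  fixes f :: "'a::euclidean_space \<Rightarrow> 'b::{banach, second_countable_topology}"
  assumes c: "c \<noteq> 0" and f [measurable]: "f \<in> borel_measurable borel"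
  shows "integrable lborel (\<lambda>x. f (t + c *\<^sub>R x)) \<longleftrightarrow> integrable lborel f"
    and "(\<integral>x. f x \<partial>lborel) = \<bar>c\<bar> ^ DIM('a) *\<^sub>R (\<integral>x. f (t + c *\<^sub>R x) \<partial>lborel)"
proof -
  have pos: "\<bar>c\<bar> ^ DIM('a) > 0" using c by simp
  show "integrable lborel (\<lambda>x. f (t + c *\<^sub>R x)) \<longleftrightarrow> integrable lborel f"
    unfolding integrable_iff_bounded
    by (subst (2) lborel_scale_shift[OF c, of _ t])
       (use pos in \<open>auto simp: ennreal_mult_less_top ennreal_mult_eq_top_iff less_top\<close>)
  show "(\<integral>x. f x \<partial>lborel) = \<bar>c\<bar> ^ DIM('a) *\<^sub>R (\<integral>x. f (t + c *\<^sub>R x) \<partial>lborel)"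
    by (subst lborel_affine[OF c, of t]) (simp add: integral_density integral_distr)
qed

lemma lborel_AE_shift:
  fixes t :: "'a::euclidean_space"
  assumes c: "c \<noteq> 0" and P: "AE x in lborel. P x"
  shows "AE x in lborel. P (t + c *\<^sub>R x)"
proof -
  obtain N where N: "{x. \<not> P x} \<subseteq> N" "N \<in> null_sets lborel"
    using P by (auto elim!: AE_E simp: null_setsI)
  have "(\<integral>\<^sup>+x. indicator N x \<partial>lborel) =
      ennreal (\<bar>c\<bar> ^ DIM('a)) * (\<integral>\<^sup>+x. indicator N (t + c *\<^sub>R x) \<partial>lborel)"
    using N by (intro lborel_scale_shift c) auto
  then have "(\<integral>\<^sup>+x. indicator N (t + c *\<^sub>R x) \<partial>lborel) = (0::ennreal)"
    using N c by (auto simp: null_sets_def)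
  moreover have [measurable]: "N \<in> sets borel" using N by auto
  ultimately have "AE x in lborel. indicator N (t + c *\<^sub>R x) = (0::ennreal)"
    by (subst (asm) nn_integral_0_iff_AE) auto
  then show ?thesis
  proof eventually_elim
    case (elim x)
    then show ?case using N(1) by (auto simp: indicator_def split: if_splits)
  qed
qed

section \<open>The Gaussian and its Fourier integral\<close>

definition gauss :: "'a::euclidean_space \<Rightarrow> complex" where
  "gauss x = of_real (exp (- (norm x)\<^sup>2 / 2))"

text \<open>The integral is the characteristic function of the standard normal distribution at
  \<open>- a\<close>, freed from the factor \<open>1 / sqrt (2 * pi)\<close> of the density.\<close>

lemma gauss_1d:
  "integrable lborel (\<lambda>x::real. cis (- (x * a)) * of_real (exp (- x\<^sup>2 / 2)))"
  "(\<integral>x. cis (- (x * a)) * of_real (exp (- x\<^sup>2 / 2)) \<partial>lborel) = of_real (sqrt (2 * pi) * exp (- a\<^sup>2 / 2))"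
proof -
  have I: "integrable lborel (\<lambda>x::real. exp (- x\<^sup>2 / 2))"
    using integrable_mult_right[OF integrable_normal_moment[of 1 0 0], of "sqrt (2 * pi)"]
    by (simp add: normal_density_def)
  show "integrable lborel (\<lambda>x::real. cis (- (x * a)) * of_real (exp (- x\<^sup>2 / 2)))"
    by (rule Bochner_Integration.integrable_bound[OF I]) (auto simp: norm_mult cis_conv_exp)
  have "complex_of_real (exp (- (a\<^sup>2) / 2)) = char std_normal_distribution (- a)"
    by (simp add: char_std_normal_distribution)
  also have "\<dots> = (\<integral>x. std_normal_density x *\<^sub>R iexp (- a * x) \<partial>lborel)"
    unfolding char_def by (subst integral_density) (auto simp: normal_density_nonneg)
  also have "\<dots> = (\<integral>x. of_real (1 / sqrt (2 * pi)) * (cis (- (x * a)) * of_real (exp (- x\<^sup>2 / 2))) \<partial>lborel)"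
    by (intro Bochner_Integration.integral_cong)
       (auto simp: std_normal_density_def cis_conv_exp scaleR_conv_of_real mult_ac)
  also have "\<dots> = of_real (1 / sqrt (2 * pi)) * (\<integral>x. cis (- (x * a)) * of_real (exp (- x\<^sup>2 / 2)) \<partial>lborel)"
    by simp
  finally show "(\<integral>x. cis (- (x * a)) * of_real (exp (- x\<^sup>2 / 2)) \<partial>lborel) = of_real (sqrt (2 * pi) * exp (- a\<^sup>2 / 2))"
    by (simp add: field_simps)
qed

lemma sum_Basis_power2: "(\<Sum>b\<in>Basis. (x \<bullet> b)\<^sup>2) = (norm x)\<^sup>2"
  unfolding power2_norm_eq_inner euclidean_inner[of x x] by (simp add: power2_eq_square)

lemma gauss_prod:
  fixes x \<xi> :: "'a::euclidean_space"
  shows "(\<Prod>b\<in>Basis. cis (- (x \<bullet> b * (\<xi> \<bullet> b))) * of_real (exp (- (x \<bullet> b)\<^sup>2 / 2))) = cis (- (x \<bullet> \<xi>)) * gauss x"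
proof -
  have "(\<Prod>b\<in>Basis. cis (- (x \<bullet> b * (\<xi> \<bullet> b)))) = cis (- (x \<bullet> \<xi>))"
    unfolding cis_conv_exp by (simp add: exp_sum[symmetric] euclidean_inner[of x \<xi>] sum_negf sum_distrib_left)
  moreover have "(\<Prod>b\<in>Basis. exp (- (x \<bullet> b)\<^sup>2 / 2)) = exp (- (norm x)\<^sup>2 / 2)"
    by (simp add: exp_sum[symmetric] sum_Basis_power2 sum_negf flip: sum_divide_distrib)
  ultimately show ?thesis
    by (simp add: prod.distrib gauss_def flip: of_real_prod)
qed

text \<open>Lebesgue measure is the image of the product of one-dimensional Lebesgue measures over
  \<open>Basis\<close>, and the integrand factorises by \<open>gauss_prod\<close>, so both claims
  reduce to \<open>gauss_1d\<close>.\<close>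

lemma
  fixes \<xi> :: "'a::euclidean_space"
  shows integrable_cis_gauss: "integrable lborel (\<lambda>x::'a. cis (- (x \<bullet> \<xi>)) * gauss x)"
    and integral_cis_gauss: "(\<integral>x. cis (- (x \<bullet> \<xi>)) * gauss x \<partial>lborel) = of_real (sqrt (2 * pi) ^ DIM('a)) * gauss \<xi>"
proof -
  interpret product_sigma_finite "\<lambda>_::'a. lborel :: real measure" ..
  define f where "f b x = cis (- (x * (\<xi> \<bullet> b))) * complex_of_real (exp (- x\<^sup>2 / 2))" for b and x :: real
  have f: "integrable lborel (f b)" "integral\<^sup>L lborel (f b) = of_real (sqrt (2 * pi)) * of_real (exp (- (\<xi> \<bullet> b)\<^sup>2 / 2))" for b
    using gauss_1d[of "\<xi> \<bullet> b"] by (simp_all add: f_def[abs_def])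
  have [measurable]: "f b \<in> borel_measurable borel" for b using f(1)[of b] by auto
  have eq: "(\<lambda>x. cis (- (x \<bullet> \<xi>)) * gauss x) = (\<lambda>x. \<Prod>b\<in>Basis. f b (x \<bullet> b))"
    unfolding f_def gauss_prod[symmetric] ..
  have *: "(\<Prod>b\<in>Basis. f b ((\<Sum>c\<in>Basis. g c *\<^sub>R c) \<bullet> b)) = (\<Prod>b\<in>Basis. f b (g b))" for g :: "'a \<Rightarrow> real"
    by (intro prod.cong) auto
  show "integrable lborel (\<lambda>x::'a. cis (- (x \<bullet> \<xi>)) * gauss x)"
    unfolding eq lborel_eq[where ?'a='a]
    by (subst integrable_distr_eq) (auto simp: * intro!: product_integrable_prod f)
  have "(\<integral>x. cis (- (x \<bullet> \<xi>)) * gauss x \<partial>lborel) = (\<Prod>b\<in>Basis. integral\<^sup>L lborel (f b))"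
    unfolding eq lborel_eq[where ?'a='a]
    by (subst integral_distr) (auto simp: * intro!: product_integral_prod f)
  also have "\<dots> = of_real (sqrt (2 * pi) ^ DIM('a)) * of_real (\<Prod>b\<in>Basis. exp (- (\<xi> \<bullet> b)\<^sup>2 / 2))"
    by (simp add: f prod.distrib)
  also have "(\<Prod>b\<in>Basis. exp (- (\<xi> \<bullet> b)\<^sup>2 / 2)) = exp (- (norm \<xi>)\<^sup>2 / 2)"
    by (simp add: exp_sum[symmetric] sum_Basis_power2 sum_negf flip: sum_divide_distrib)
  finally show "(\<integral>x. cis (- (x \<bullet> \<xi>)) * gauss x \<partial>lborel) = of_real (sqrt (2 * pi) ^ DIM('a)) * gauss \<xi>"
    by (simp add: gauss_def)
qed

section \<open>The Fourier integral and Gaussian regularisation\<close>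

abbreviation "c\<^sub>F \<equiv> (2 * pi) powr (-3/2)"

text \<open>With this normalisation \<open>gauss\<close> is its own Fourier transform on
  \<open>R3\<close>, and every Gaussian mass appearing below cancels against
  \<open>c\<^sub>F\<close>.\<close>

lemma c\<^sub>F_sqrt: "c\<^sub>F * sqrt (2 * pi) ^ 3 = 1"
proof -
  have "sqrt (2 * pi) ^ 3 = (2 * pi) powr (3/2)"
    by (simp add: powr_half_sqrt[symmetric] powr_power)
  then show ?thesis by (simp add: powr_add[symmetric])
qed

lemma measurable_cis [measurable]: "cis \<in> borel_measurable borel"
  by (intro borel_measurable_continuous_onI continuous_intros)

lemma measurable_fourier [measurable]:
  assumes [measurable]: "f \<in> borel_measurable borel"
  shows "fourier f \<in> borel_measurable borel"
proof -
  have "(\<lambda>\<xi>. of_real c\<^sub>F * (\<integral>x. cis (- (x \<bullet> \<xi>)) * f x \<partial>lborel)) \<in> borel_measurable lborel"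
    by measurable
  then show ?thesis by (simp add: fourier_def[abs_def])
qed

lemma integrable_cis_mult:
  fixes f :: "'a::euclidean_space \<Rightarrow> complex"
  assumes f: "integrable lborel f" and g: "g \<in> borel_measurable borel"
  shows "integrable lborel (\<lambda>x. cis (g x) * f x)"
proof (rule Bochner_Integration.integrable_bound[OF f])
  show "(\<lambda>x. cis (g x) * f x) \<in> borel_measurable lborel"
    using f g by measurable
qed (simp add: norm_mult)

lemma fourier_add:
  "integrable lborel f \<Longrightarrow> integrable lborel g \<Longrightarrow> fourier (\<lambda>x. f x + g x) \<xi> = fourier f \<xi> + fourier g \<xi>"
  by (simp add: fourier_def distrib_left integrable_cis_mult)

lemma fourier_diff:
  "integrable lborel f \<Longrightarrow> integrable lborel g \<Longrightarrow> fourier (\<lambda>x. f x - g x) \<xi> = fourier f \<xi> - fourier g \<xi>"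
  by (simp add: fourier_def right_diff_distrib integrable_cis_mult)

lemma fourier_cmult: "fourier (\<lambda>x. c * f x) \<xi> = c * fourier f \<xi>"
proof -
  have "(\<integral>x. cis (- (x \<bullet> \<xi>)) * (c * f x) \<partial>lborel) = c * (\<integral>x. cis (- (x \<bullet> \<xi>)) * f x \<partial>lborel)"
    unfolding integral_mult_right_zero[symmetric] by (intro Bochner_Integration.integral_cong) auto
  then show ?thesis by (simp add: fourier_def)
qed

lemma norm_fourier_le: "norm (fourier f \<xi>) \<le> c\<^sub>F * (\<integral>x. norm (f x) \<partial>lborel)"
proof -
  have "norm (\<integral>x. cis (- (x \<bullet> \<xi>)) * f x \<partial>lborel) \<le> (\<integral>x. norm (cis (- (x \<bullet> \<xi>)) * f x) \<partial>lborel)"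
    by (rule integral_norm_bound)
  then show ?thesis by (simp add: fourier_def norm_mult)
qed

lemma (in pair_sigma_finite) integrable_pair_mult:
  fixes f :: "'a \<Rightarrow> 'c::{real_normed_algebra, banach, second_countable_topology}"
  assumes f: "integrable M1 f" and g: "integrable M2 g"
  shows "integrable (M1 \<Otimes>\<^sub>M M2) (\<lambda>(x, y). f x * g y)"
proof (rule Bochner_Integration.integrable_bound)
  have [measurable]: "f \<in> borel_measurable M1" "g \<in> borel_measurable M2"
    using f g by auto
  show "integrable (M1 \<Otimes>\<^sub>M M2) (\<lambda>(x, y). norm (f x) * norm (g y))"
    by (rule Fubini_integrable) (use f g in auto)
  show "(\<lambda>(x, y). f x * g y) \<in> borel_measurable (M1 \<Otimes>\<^sub>M M2)"
    by measurable
qed (auto simp: norm_mult_ineq)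

text \<open>Fubini, as the double integrand is dominated by the product of two integrable functions;
  the oscillating factor is symmetric in the two variables.\<close>

lemma fourier_multiplication_formula:
  assumes f: "integrable lborel f" and h: "integrable lborel h"
  shows "(\<integral>\<xi>. fourier f \<xi> * h \<xi> \<partial>lborel) = (\<integral>x. f x * fourier h x \<partial>lborel)"
proof -
  have [measurable]: "f \<in> borel_measurable borel" "h \<in> borel_measurable borel"
    using f h by auto
  have int: "integrable (lborel \<Otimes>\<^sub>M lborel) (\<lambda>(x, \<xi>). cis (- (x \<bullet> \<xi>)) * f x * h \<xi>)"
  proof (rule Bochner_Integration.integrable_bound)
    show "integrable (lborel \<Otimes>\<^sub>M lborel) (\<lambda>(x, \<xi>). norm (f x) * norm (h \<xi>))"
      using f h by (intro lborel_pair.integrable_pair_mult) simp_all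
  qed (auto simp: norm_mult)
  have "(\<integral>\<xi>. fourier f \<xi> * h \<xi> \<partial>lborel) = of_real c\<^sub>F * (\<integral>\<xi>. (\<integral>x. cis (- (x \<bullet> \<xi>)) * f x * h \<xi> \<partial>lborel) \<partial>lborel)"
  proof -
    have "(\<integral>x. cis (- (x \<bullet> \<xi>)) * f x * h \<xi> \<partial>lborel) = (\<integral>x. cis (- (x \<bullet> \<xi>)) * f x \<partial>lborel) * h \<xi>" for \<xi>
      by (rule integral_mult_left_zero)
    then show ?thesis by (simp only: fourier_def mult.assoc integral_mult_right_zero)
  qed
  also have "\<dots> = of_real c\<^sub>F * (\<integral>x. (\<integral>\<xi>. cis (- (x \<bullet> \<xi>)) * f x * h \<xi> \<partial>lborel) \<partial>lborel)"
    using lborel_pair.Fubini_integral[OF int] by simp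
  also have "(\<integral>x. (\<integral>\<xi>. cis (- (x \<bullet> \<xi>)) * f x * h \<xi> \<partial>lborel) \<partial>lborel) =
      (\<integral>x. f x * (\<integral>\<xi>. cis (- (\<xi> \<bullet> x)) * h \<xi> \<partial>lborel) \<partial>lborel)"
    unfolding integral_mult_right_zero[symmetric]
    by (intro Bochner_Integration.integral_cong refl) (simp add: inner_commute mult_ac)
  also have "of_real c\<^sub>F * \<dots> = (\<integral>x. of_real c\<^sub>F * (f x * (\<integral>\<xi>. cis (- (\<xi> \<bullet> x)) * h \<xi> \<partial>lborel)) \<partial>lborel)"
    by (rule integral_mult_right_zero[symmetric])
  finally show ?thesis
    by (simp only: fourier_def mult.left_commute)
qed

section \<open>Gaussians as an approximate identity\<close>

lemma measurable_gauss [measurable]: "gauss \<in> borel_measurable borel"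
  unfolding gauss_def[abs_def] by measurable

lemma integrable_gauss: "integrable lborel (gauss :: 'a::euclidean_space \<Rightarrow> complex)"
  using integrable_cis_gauss[of 0] by simp

lemma integral_gauss: "(\<integral>x. gauss (x::'a::euclidean_space) \<partial>lborel) = of_real (sqrt (2 * pi) ^ DIM('a))"
  using integral_cis_gauss[of "0::'a"] by (simp add: gauss_def)

lemma norm_gauss_le_1: "norm (gauss x) \<le> 1"
  by (simp add: gauss_def)

lemma cnj_gauss [simp]: "cnj (gauss x) = gauss x"
  by (simp add: gauss_def)

lemma gauss_at_scaled_limit: "((\<lambda>n. gauss (e n *\<^sub>R x)) \<longlonglongrightarrow> 1)" if "e \<longlonglongrightarrow> 0"
proof -
  have "(\<lambda>n. gauss (e n *\<^sub>R x)) \<longlonglongrightarrow> of_real (exp (- (norm (0 *\<^sub>R x))\<^sup>2 / 2))"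
    unfolding gauss_def using that by (intro tendsto_intros) auto
  then show ?thesis by simp
qed

text \<open>A flat Gaussian modulated by \<open>x\<close> becomes an approximate identity of width
  \<open>e\<close> centred at \<open>x\<close>; integrated against a function it averages that
  function near \<open>x\<close>.\<close>

lemma fourier_gauss_scaled:
  assumes e: "e > 0"
  shows "integrable lborel (\<lambda>\<xi>. cis (x \<bullet> \<xi>) * gauss (e *\<^sub>R \<xi>))"
    and "fourier (\<lambda>\<xi>. cis (x \<bullet> \<xi>) * gauss (e *\<^sub>R \<xi>)) y = of_real (1 / e ^ 3) * gauss ((1 / e) *\<^sub>R (y - x))"
proof -
  have "integrable lborel (\<lambda>\<xi>::R3. gauss (e *\<^sub>R \<xi>))"
    using lborel_integral_scale_shift(1)[of e gauss 0] e integrable_gauss by auto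
  then show "integrable lborel (\<lambda>\<xi>. cis (x \<bullet> \<xi>) * gauss (e *\<^sub>R \<xi>))"
    by (rule integrable_cis_mult) simp
  have "(\<integral>\<xi>. cis (- (\<xi> \<bullet> y)) * (cis (x \<bullet> \<xi>) * gauss (e *\<^sub>R \<xi>)) \<partial>lborel) =
      (\<integral>\<xi>. cis (- (\<xi> \<bullet> (y - x))) * gauss (e *\<^sub>R \<xi>) \<partial>lborel)"
    by (intro Bochner_Integration.integral_cong)
       (auto simp: cis_mult mult.assoc[symmetric] inner_diff_right inner_commute)
  also have "\<dots> = \<bar>1 / e\<bar> ^ DIM(R3) *\<^sub>R (\<integral>\<xi>. cis (- ((0 + (1 / e) *\<^sub>R \<xi>) \<bullet> (y - x))) * gauss (e *\<^sub>R (0 + (1 / e) *\<^sub>R \<xi>)) \<partial>lborel)"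
    by (rule lborel_integral_scale_shift(2)) (use e in auto)
  also have "(\<integral>\<xi>. cis (- ((0 + (1 / e) *\<^sub>R \<xi>) \<bullet> (y - x))) * gauss (e *\<^sub>R (0 + (1 / e) *\<^sub>R \<xi>)) \<partial>lborel)
      = (\<integral>\<xi>. cis (- (\<xi> \<bullet> ((1 / e) *\<^sub>R (y - x)))) * gauss \<xi> \<partial>lborel)"
    using e by simp
  also have "\<dots> = of_real (sqrt (2 * pi) ^ 3) * gauss ((1 / e) *\<^sub>R (y - x))"
    by (subst integral_cis_gauss) simp
  finally have I: "(\<integral>\<xi>. cis (- (\<xi> \<bullet> y)) * (cis (x \<bullet> \<xi>) * gauss (e *\<^sub>R \<xi>)) \<partial>lborel) =
      of_real (1 / e ^ 3) * (of_real (sqrt (2 * pi) ^ 3) * gauss ((1 / e) *\<^sub>R (y - x)))"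
    using e by (simp add: scaleR_conv_of_real power_one_over)
  have "fourier (\<lambda>\<xi>. cis (x \<bullet> \<xi>) * gauss (e *\<^sub>R \<xi>)) y =
      of_real (c\<^sub>F * sqrt (2 * pi) ^ 3) * (of_real (1 / e ^ 3) * gauss ((1 / e) *\<^sub>R (y - x)))"
    unfolding fourier_def I of_real_mult by (simp only: mult_ac)
  then show "fourier (\<lambda>\<xi>. cis (x \<bullet> \<xi>) * gauss (e *\<^sub>R \<xi>)) y = of_real (1 / e ^ 3) * gauss ((1 / e) *\<^sub>R (y - x))"
    unfolding c\<^sub>F_sqrt by simp
qed

text \<open>Plancherel's identity for continuous \<open>f\<close> of compact support follows from this as \<open>e\<close> tends to 0.\<close>

lemma fourier_gauss_regularised:
  assumes f: "integrable lborel f" and e: "e > 0"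
  shows "(\<integral>\<xi>. of_real ((norm (fourier f \<xi>))\<^sup>2) * gauss (e *\<^sub>R \<xi>) \<partial>lborel)
    = of_real c\<^sub>F * (\<integral>x. f x * cnj (\<integral>z. f (x + e *\<^sub>R z) * gauss z \<partial>lborel) \<partial>lborel)"
proof -
  have [measurable]: "f \<in> borel_measurable borel" using f by auto
  \<comment> \<open>Chosen so that \<open>fourier f \<xi> * h \<xi>\<close> is the integrand on the
    left; the multiplication formula then moves the transform onto \<open>h\<close>.\<close>
  define h where "h \<xi> = cnj (fourier f \<xi>) * gauss (e *\<^sub>R \<xi>)" for \<xi> :: R3
  have ge: "integrable lborel (\<lambda>\<xi>::R3. gauss (e *\<^sub>R \<xi>))"
    using fourier_gauss_scaled(1)[OF e, of 0] by simp
  have h: "integrable lborel h"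
  proof (rule Bochner_Integration.integrable_bound)
    show "integrable lborel (\<lambda>\<xi>::R3. of_real (c\<^sub>F * (\<integral>x. norm (f x) \<partial>lborel)) * gauss (e *\<^sub>R \<xi>))"
      by (intro integrable_mult_right ge)
    have "c\<^sub>F * (\<integral>x. norm (f x) \<partial>lborel) \<ge> 0" by simp
    then have "norm (fourier f \<xi>) \<le> norm (complex_of_real (c\<^sub>F * (\<integral>x. norm (f x) \<partial>lborel)))" for \<xi>
      using norm_fourier_le[of f \<xi>] by (simp only: norm_of_real abs_of_nonneg)
    then show "AE \<xi> in lborel. norm (h \<xi>) \<le> norm (of_real (c\<^sub>F * (\<integral>x. norm (f x) \<partial>lborel)) * gauss (e *\<^sub>R \<xi>))"
      unfolding h_def norm_mult complex_mod_cnj by (intro AE_I2 mult_right_mono) auto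
  qed (simp add: h_def[abs_def])
  \<comment> \<open>A second use of the multiplication formula: up to conjugation, \<open>h\<close>
    times the oscillation is \<open>fourier f\<close> times a modulated Gaussian. The substitution
    \<open>y = x + e *\<^sub>R z\<close> then produces the average of \<open>f\<close>.\<close>
  have fh: "fourier h x = of_real c\<^sub>F * cnj (\<integral>z. f (x + e *\<^sub>R z) * gauss z \<partial>lborel)" for x
  proof -
    have "(\<integral>\<xi>. cis (- (\<xi> \<bullet> x)) * h \<xi> \<partial>lborel) = (\<integral>\<xi>. cnj (fourier f \<xi> * (cis (x \<bullet> \<xi>) * gauss (e *\<^sub>R \<xi>))) \<partial>lborel)"
      by (intro Bochner_Integration.integral_cong) (auto simp: h_def cis_cnj inner_commute mult_ac)
    also have "\<dots> = cnj (\<integral>\<xi>. fourier f \<xi> * (cis (x \<bullet> \<xi>) * gauss (e *\<^sub>R \<xi>)) \<partial>lborel)"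
      by (rule Bochner_Integration.integral_cnj)
    also have "(\<integral>\<xi>. fourier f \<xi> * (cis (x \<bullet> \<xi>) * gauss (e *\<^sub>R \<xi>)) \<partial>lborel) =
        (\<integral>y. f y * (of_real (1 / e ^ 3) * gauss ((1 / e) *\<^sub>R (y - x))) \<partial>lborel)"
      by (subst fourier_multiplication_formula[OF f fourier_gauss_scaled(1)[OF e]])
         (simp only: fourier_gauss_scaled(2)[OF e])
    also have "\<dots> = \<bar>e\<bar> ^ DIM(R3) *\<^sub>R (\<integral>z. f (x + e *\<^sub>R z) * (of_real (1 / e ^ 3) * gauss ((1 / e) *\<^sub>R ((x + e *\<^sub>R z) - x))) \<partial>lborel)"
      by (rule lborel_integral_scale_shift(2)) (use e in auto)
    also have "\<dots> = (\<integral>z. \<bar>e\<bar> ^ DIM(R3) *\<^sub>R (f (x + e *\<^sub>R z) * (of_real (1 / e ^ 3) * gauss ((1 / e) *\<^sub>R ((x + e *\<^sub>R z) - x)))) \<partial>lborel)"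
      by simp
    also have "\<dots> = (\<integral>z. f (x + e *\<^sub>R z) * gauss z \<partial>lborel)"
    proof (intro Bochner_Integration.integral_cong refl)
      fix z :: R3
      have "(1 / e) *\<^sub>R ((x + e *\<^sub>R z) - x) = z" using e by simp
      then show "\<bar>e\<bar> ^ DIM(R3) *\<^sub>R (f (x + e *\<^sub>R z) * (of_real (1 / e ^ 3) * gauss ((1 / e) *\<^sub>R ((x + e *\<^sub>R z) - x)))) = f (x + e *\<^sub>R z) * gauss z"
        using e by (simp only:) (simp add: scaleR_conv_of_real[where ?'a = complex])
    qed
    finally show ?thesis by (simp add: fourier_def)
  qed
  have "(\<integral>\<xi>. of_real ((norm (fourier f \<xi>))\<^sup>2) * gauss (e *\<^sub>R \<xi>) \<partial>lborel) = (\<integral>\<xi>. fourier f \<xi> * h \<xi> \<partial>lborel)"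
    by (intro Bochner_Integration.integral_cong) (auto simp: h_def complex_norm_square[symmetric] mult.assoc[symmetric])
  also have "\<dots> = (\<integral>x. f x * fourier h x \<partial>lborel)"
    by (rule fourier_multiplication_formula[OF f h])
  also have "\<dots> = (\<integral>x. of_real c\<^sub>F * (f x * cnj (\<integral>z. f (x + e *\<^sub>R z) * gauss z \<partial>lborel)) \<partial>lborel)"
    unfolding fh by (intro Bochner_Integration.integral_cong) (simp_all add: mult.left_commute)
  also have "\<dots> = of_real c\<^sub>F * (\<integral>x. f x * cnj (\<integral>z. f (x + e *\<^sub>R z) * gauss z \<partial>lborel) \<partial>lborel)"
    by simp
  finally show ?thesis .
qed

text \<open>Dominated convergence at a point of continuity. The average is not normalised, so the
  limit carries the Gaussian mass. The second claim is the uniform bound that dominates the outer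
  integral over \<open>x\<close> later.\<close>

lemma gauss_average_tendsto:
  assumes f [measurable]: "f \<in> borel_measurable borel" and M: "\<And>x. norm (f x) \<le> M"
    and cont: "isCont f (x::R3)" and e: "e \<longlonglongrightarrow> 0"
  shows "(\<lambda>n. \<integral>z. f (x + e n *\<^sub>R z) * gauss z \<partial>lborel) \<longlonglongrightarrow> f x * of_real (sqrt (2 * pi) ^ 3)"
    and "norm (\<integral>z. f (x + d *\<^sub>R z) * gauss z \<partial>lborel) \<le> M * (\<integral>z. norm (gauss (z::R3)) \<partial>lborel)"
proof -
  have "(\<lambda>n. \<integral>z. f (x + e n *\<^sub>R z) * gauss z \<partial>lborel) \<longlonglongrightarrow> (\<integral>z. f x * gauss (z::R3) \<partial>lborel)"
  proof (rule integral_dominated_convergence)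
    show "integrable lborel (\<lambda>z::R3. M * norm (gauss z))"
      by (intro integrable_mult_right integrable_norm integrable_gauss)
    show "AE z in lborel. (\<lambda>n. f (x + e n *\<^sub>R z) * gauss z) \<longlonglongrightarrow> f x * gauss z"
    proof (intro AE_I2 tendsto_mult tendsto_const isCont_tendsto_compose[OF cont])
      show "(\<lambda>n. x + e n *\<^sub>R z) \<longlonglongrightarrow> x" for z
        using tendsto_add[OF tendsto_const[of x] tendsto_scaleR[OF e tendsto_const[of z]]] by simp
    qed
  qed (use M in \<open>auto simp: norm_mult mult_right_mono\<close>)
  then show "(\<lambda>n. \<integral>z. f (x + e n *\<^sub>R z) * gauss z \<partial>lborel) \<longlonglongrightarrow> f x * of_real (sqrt (2 * pi) ^ 3)"
    by (simp add: integral_gauss)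
  have "norm (\<integral>z. f (x + d *\<^sub>R z) * gauss z \<partial>lborel) \<le> (\<integral>z. M * norm (gauss (z::R3)) \<partial>lborel)"
  proof (rule order_trans[OF integral_norm_bound], rule integral_mono)
    have le: "norm (f (x + d *\<^sub>R z) * gauss z) \<le> M * norm (gauss z)" for z :: R3
      unfolding norm_mult by (intro mult_right_mono M norm_ge_zero)
    show Mg: "integrable lborel (\<lambda>z::R3. M * norm (gauss z))"
      by (intro integrable_mult_right integrable_norm integrable_gauss)
    show "norm (f (x + d *\<^sub>R z) * gauss z) \<le> M * norm (gauss z)" for z by (rule le)
    show "integrable lborel (\<lambda>z. norm (f (x + d *\<^sub>R z) * gauss z))"
    proof (rule Bochner_Integration.integrable_bound[OF Mg])
      show "AE z in lborel. norm (norm (f (x + d *\<^sub>R z) * gauss z)) \<le> norm (M * norm (gauss z))"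
        unfolding real_norm_def abs_norm_cancel using le by (intro AE_I2 order_trans[OF _ abs_ge_self])
    qed measurable
  qed
  then show "norm (\<integral>z. f (x + d *\<^sub>R z) * gauss z \<partial>lborel) \<le> M * (\<integral>z. norm (gauss (z::R3)) \<partial>lborel)"
    by simp
qed

lemma norm2_mono:
  assumes "sq_int M f" "g \<in> borel_measurable M" "\<And>x. norm (g x) \<le> norm (f x)"
  shows "norm2 M g \<le> norm2 M f"
  unfolding norm2_def
proof (intro real_sqrt_le_mono integral_mono)
  show "integrable M (\<lambda>x. (norm (g x))\<^sup>2)" "integrable M (\<lambda>x. (norm (f x))\<^sup>2)"
    using assms sq_int_mono[of M f g 1] by (auto simp: sq_int_def)
  show "(norm (g x))\<^sup>2 \<le> (norm (f x))\<^sup>2" for x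
    using assms(3) by (rule power_mono) simp
qed

lemma norm2_tendsto_dominated:
  assumes lim: "AE x in M. (\<lambda>n. f n x) \<longlonglongrightarrow> g x"
    and f: "\<And>n. f n \<in> borel_measurable M" and g: "sq_int M g" and w: "sq_int M w"
    and bound: "\<And>n x. norm (f n x - g x) \<le> norm (w x)"
  shows "(\<lambda>n. norm2 M (\<lambda>x. f n x - g x)) \<longlonglongrightarrow> 0"
proof -
  have [measurable]: "f n \<in> borel_measurable M" "g \<in> borel_measurable M" for n
    using f g by (auto simp: sq_int_def)
  have "(\<lambda>n. \<integral>x. (norm (f n x - g x))\<^sup>2 \<partial>M) \<longlonglongrightarrow> (\<integral>x. 0 \<partial>M)"
  proof (rule integral_dominated_convergence)
    show "integrable M (\<lambda>x. (norm (w x))\<^sup>2)" using w by (simp add: sq_int_def)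
    show "AE x in M. (\<lambda>n. (norm (f n x - g x))\<^sup>2) \<longlonglongrightarrow> 0"
      using lim
    proof eventually_elim
      case (elim x)
      then have "(\<lambda>n. (norm (f n x - g x))\<^sup>2) \<longlonglongrightarrow> (norm (g x - g x))\<^sup>2"
        by (intro tendsto_intros)
      then show ?case by simp
    qed
    show "AE x in M. norm ((norm (f n x - g x))\<^sup>2) \<le> (norm (w x))\<^sup>2" for n
      using bound by (intro AE_I2) (simp add: power_mono)
  qed measurable
  then show ?thesis
    unfolding norm2_def using tendsto_real_sqrt by fastforce
qed

text \<open>Cauchy--Schwarz against the indicator of the ball. It makes the Fourier integral
  available and lets L2 convergence with common bounded support imply L1 convergence.\<close>

lemma integrable_bounded_support:
  fixes f :: "R3 \<Rightarrow> complex"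
  assumes f: "sq_int lborel f" and supp: "\<And>x. x \<notin> cball 0 R \<Longrightarrow> f x = 0"
  shows "integrable lborel f"
    and "(\<integral>x. norm (f x) \<partial>lborel) \<le> norm2 lborel (indicator (cball 0 R) :: R3 \<Rightarrow> complex) * norm2 lborel f"
proof -
  have i: "sq_int lborel (indicator (cball 0 R) :: R3 \<Rightarrow> complex)"
  proof (rule sq_intI)
    show "integrable lborel (indicator (cball 0 R) :: R3 \<Rightarrow> real)"
      using emeasure_lborel_cball_finite[of 0 R] by (intro integrable_real_indicator) auto
    show "(norm (indicator (cball 0 R) x :: complex))\<^sup>2 \<le> indicator (cball 0 R) x" for x :: R3
      by (simp add: indicator_def)
  qed (auto intro: borel_measurable_indicator)
  have eq: "indicator (cball 0 R) x * f x = f x" for x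
    using supp[of x] by (auto simp: indicator_def)
  show "integrable lborel f"
    using integrable_mult_sq[OF i f] by (simp add: eq)
  have "norm (indicator (cball 0 R) x :: complex) * norm (f x) = norm (f x)" for x
    using eq[of x] by (metis norm_mult)
  then show "(\<integral>x. norm (f x) \<partial>lborel) \<le> norm2 lborel (indicator (cball 0 R) :: R3 \<Rightarrow> complex) * norm2 lborel f"
    using Cauchy_Schwarz_norm2[OF i f] by (simp only:)
qed

text \<open>Let the width tend to 0 in \<open>fourier_gauss_regularised\<close>. Continuity gives
  convergence of the averages at every point, boundedness and bounded support give domination, so
  the right side tends to the squared norm of \<open>f\<close>.\<close>

lemma plancherel_continuous:
  fixes f :: wave
  assumes cont: "continuous_on UNIV f" and M: "\<And>x. norm (f x) \<le> M"
    and supp: "\<And>x. x \<notin> cball 0 R \<Longrightarrow> f x = 0"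
  shows "sq_int lborel f" "sq_int lborel (fourier f)" "norm2 lborel (fourier f) = norm2 lborel f"
proof -
  have [measurable]: "f \<in> borel_measurable borel" using cont by (rule borel_measurable_continuous_onI)
  show f: "sq_int lborel f"
  proof (rule sq_intI)
    show "integrable lborel (\<lambda>x::R3. M\<^sup>2 * indicator (cball 0 R) x :: real)"
      by (intro integrable_mult_right integrable_real_indicator emeasure_lborel_cball_finite) simp
    show "(norm (f x))\<^sup>2 \<le> M\<^sup>2 * indicator (cball 0 R) x" for x
      using supp[of x] M[of x] by (auto simp: indicator_def intro!: power_mono)
  qed simp
  note int = integrable_bounded_support(1)[OF f supp]
  define e where "e n = 1 / real (Suc n)" for n
  have e: "e n > 0" "e \<longlonglongrightarrow> 0" for n
    using LIMSEQ_inverse_real_of_nat by (simp_all add: e_def[abs_def] inverse_eq_divide del: of_nat_Suc)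
  define G where "G = (\<integral>z. norm (gauss (z::R3)) \<partial>lborel)"
  define avg where "avg n x = (\<integral>z. f (x + e n *\<^sub>R z) * gauss z \<partial>lborel)" for n x
  have [measurable]: "avg n \<in> borel_measurable borel" for n
  proof -
    have "(\<lambda>x. \<integral>z. f (x + e n *\<^sub>R z) * gauss z \<partial>lborel) \<in> borel_measurable lborel" by measurable
    then show ?thesis by (simp add: avg_def[abs_def])
  qed
  have isc: "isCont f x" for x using cont by (simp add: continuous_on_eq_continuous_at)
  have avg: "(\<lambda>n. avg n x) \<longlonglongrightarrow> f x * of_real (sqrt (2 * pi) ^ 3)" "norm (avg n x) \<le> M * G" for n x
    using gauss_average_tendsto[OF _ M isc e(2)] by (simp_all add: avg_def G_def)
  have M0: "M * G \<ge> 0" using avg(2) norm_ge_zero order_trans by blast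
  have "(\<lambda>n. \<integral>x. f x * cnj (avg n x) \<partial>lborel) \<longlonglongrightarrow> (\<integral>x. f x * cnj (f x * of_real (sqrt (2 * pi) ^ 3)) \<partial>lborel)"
  proof (rule integral_dominated_convergence)
    show "integrable lborel (\<lambda>x. norm (f x) * (M * G))" using int by simp
    show "AE x in lborel. norm (f x * cnj (avg n x)) \<le> norm (f x) * (M * G)" for n
      unfolding norm_mult complex_mod_cnj using avg(2) by (intro AE_I2 mult_left_mono) auto
    show "AE x in lborel. (\<lambda>n. f x * cnj (avg n x)) \<longlonglongrightarrow> f x * cnj (f x * of_real (sqrt (2 * pi) ^ 3))"
      using avg(1) by (intro AE_I2 tendsto_intros)
  qed measurable
  also have "(\<integral>x. f x * cnj (f x * of_real (sqrt (2 * pi) ^ 3)) \<partial>lborel) = of_real (sqrt (2 * pi) ^ 3) * of_real ((norm2 lborel f)\<^sup>2)"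
    unfolding inner2_self[symmetric] inner2_def integral_mult_right_zero[symmetric]
    by (intro Bochner_Integration.integral_cong) (auto simp: mult_ac)
  finally have "(\<lambda>n. of_real c\<^sub>F * (\<integral>x. f x * cnj (avg n x) \<partial>lborel)) \<longlonglongrightarrow>
      of_real c\<^sub>F * (of_real (sqrt (2 * pi) ^ 3) * of_real ((norm2 lborel f)\<^sup>2))"
    by (rule tendsto_mult_left)
  also have "of_real c\<^sub>F * (of_real (sqrt (2 * pi) ^ 3) * of_real ((norm2 lborel f)\<^sup>2)) =
      complex_of_real ((c\<^sub>F * sqrt (2 * pi) ^ 3) * (norm2 lborel f)\<^sup>2)"
    by (simp only: of_real_mult mult.assoc)
  also have "\<dots> = of_real ((norm2 lborel f)\<^sup>2)" unfolding c\<^sub>F_sqrt by simp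
  also have "(\<lambda>n. of_real c\<^sub>F * (\<integral>x. f x * cnj (avg n x) \<partial>lborel)) =
      (\<lambda>n. \<integral>\<xi>. of_real ((norm (fourier f \<xi>))\<^sup>2) * gauss (e n *\<^sub>R \<xi>) \<partial>lborel)"
    unfolding avg_def by (rule ext, rule fourier_gauss_regularised[OF int e(1), symmetric])
  finally have lim: "(\<lambda>n. \<integral>\<xi>. of_real ((norm (fourier f \<xi>))\<^sup>2) * gauss (e n *\<^sub>R \<xi>) \<partial>lborel) \<longlonglongrightarrow>
      of_real ((norm2 lborel f)\<^sup>2)" .
  \<comment> \<open>The square of \<open>gauss\<close> at scale \<open>e n / sqrt 2\<close> is
    \<open>gauss\<close> at scale \<open>e n\<close>, so the regularised integral is the squared L2
    norm of \<open>F n\<close>.\<close>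
  define F where "F n \<xi> = fourier f \<xi> * gauss ((e n / sqrt 2) *\<^sub>R \<xi>)" for n \<xi>
  have g2: "(norm (gauss ((e n / sqrt 2) *\<^sub>R \<xi>)))\<^sup>2 = Re (gauss (e n *\<^sub>R \<xi>))" for n and \<xi> :: R3
    by (simp add: gauss_def exp_double[symmetric] power_mult_distrib power_divide)
  have sqF: "sq_int lborel (F n)" for n
    unfolding F_def[abs_def]
  proof (rule sq_int_bounded_mult)
    show "sq_int lborel (\<lambda>\<xi>::R3. gauss ((e n / sqrt 2) *\<^sub>R \<xi>))"
      unfolding sq_int_def g2
      using integrable_Re[OF fourier_gauss_scaled(1)[OF e(1), of 0]] by simp
  qed (use norm_fourier_le in auto)
  have "(norm2 lborel (F n))\<^sup>2 = Re (\<integral>\<xi>. of_real ((norm (fourier f \<xi>))\<^sup>2) * gauss (e n *\<^sub>R \<xi>) \<partial>lborel)" for n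
  proof -
    have eq: "of_real ((norm (fourier f \<xi>))\<^sup>2) * gauss (e n *\<^sub>R \<xi>) = of_real ((norm (F n \<xi>))\<^sup>2)" for \<xi>
      unfolding F_def norm_mult power_mult_distrib g2 by (simp add: gauss_def)
    show ?thesis unfolding eq norm2_power2 integral_complex_of_real Re_complex_of_real ..
  qed
  then have "(\<lambda>n. (norm2 lborel (F n))\<^sup>2) \<longlonglongrightarrow> (norm2 lborel f)\<^sup>2"
    using tendsto_Re[OF lim] by simp
  from tendsto_real_sqrt[OF this]
  have limF: "(\<lambda>n. norm2 lborel (F n)) \<longlonglongrightarrow> norm2 lborel f"
    by simp
  have "AE \<xi> in lborel. (\<lambda>n. F n \<xi>) \<longlonglongrightarrow> fourier f \<xi>"
  proof (rule AE_I2)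
    fix \<xi> :: R3
    have "(\<lambda>n. e n / sqrt 2) \<longlonglongrightarrow> 0" using tendsto_divide_zero[OF e(2)] by simp
    from tendsto_mult[OF tendsto_const[of "fourier f \<xi>"] gauss_at_scaled_limit[OF this]]
    show "(\<lambda>n. F n \<xi>) \<longlonglongrightarrow> fourier f \<xi>" by (simp add: F_def)
  qed
  \<comment> \<open>Fatou gives square integrability of the transform and one inequality; the other
    one holds because the damping factor in \<open>F n\<close> has modulus at most 1.\<close>
  note fatou = norm2_Fatou[OF this sqF]
  have ev: "\<forall>\<^sub>F n in sequentially. norm2 lborel (F n) \<le> norm2 lborel f + d" if "d > 0" for d
    using order_tendstoD(2)[OF limF, of "norm2 lborel f + d"] that by (auto elim: eventually_mono)
  show sq: "sq_int lborel (fourier f)"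
    by (rule fatou(1)[OF _ ev[of 1]]) auto
  have "norm2 lborel (fourier f) \<le> norm2 lborel f + d" if "d > 0" for d
    by (rule fatou(2)[OF _ ev[OF that]]) (use that in auto)
  then have "norm2 lborel (fourier f) \<le> norm2 lborel f"
    by (rule field_le_epsilon)
  moreover have "norm2 lborel (F n) \<le> norm2 lborel (fourier f)" for n
    using sqF[of n]
    by (intro norm2_mono[OF sq]) (auto simp: sq_int_def F_def norm_mult intro!: mult_left_le norm_gauss_le_1)
  then have "norm2 lborel f \<le> norm2 lborel (fourier f)"
    by (intro LIMSEQ_le_const2[OF limF]) auto
  ultimately show "norm2 lborel (fourier f) = norm2 lborel f" by simp
qed

section \<open>Plancherel's theorem for functions of bounded support\<close>

lemma fourier_integrable_tendsto:
  assumes f: "\<And>n. integrable lborel (f n)" and g: "integrable lborel g"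
    and lim: "(\<lambda>n. \<integral>x. norm (f n x - g x) \<partial>lborel) \<longlonglongrightarrow> 0"
  shows "(\<lambda>n. fourier (f n) \<xi>) \<longlonglongrightarrow> fourier g \<xi>"
proof (rule LIM_zero_cancel, rule Lim_null_comparison)
  show "(\<lambda>n. c\<^sub>F * (\<integral>x. norm (f n x - g x) \<partial>lborel)) \<longlonglongrightarrow> 0"
    using tendsto_mult_right_zero[OF lim] .
  show "\<forall>\<^sub>F n in sequentially. norm (fourier (f n) \<xi> - fourier g \<xi>) \<le> c\<^sub>F * (\<integral>x. norm (f n x - g x) \<partial>lborel)"
    using norm_fourier_le[of "\<lambda>x. f _ x - g x" \<xi>] by (simp add: fourier_diff[OF f g])
qed

definition plancherel :: "wave \<Rightarrow> bool" where
  "plancherel f \<longleftrightarrow> sq_int lborel f \<and> sq_int lborel (fourier f) \<and> norm2 lborel (fourier f) = norm2 lborel f"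

text \<open>
  The uniform support makes \<open>L\<^sup>2\<close> convergence imply \<open>L\<^sup>1\<close> convergence, hence pointwise convergence of the
  transforms, to which Fatou's lemma applies.
\<close>

lemma plancherel_limit:
  fixes f :: "nat \<Rightarrow> wave"
  assumes f: "\<And>n. plancherel (f n)" and d: "\<And>m n. plancherel (\<lambda>x. f m x - f n x)"
    and g: "sq_int lborel g" and lim: "(\<lambda>n. norm2 lborel (\<lambda>x. f n x - g x)) \<longlonglongrightarrow> 0"
    and supp: "\<And>n x. x \<notin> cball 0 R \<Longrightarrow> f n x = 0" "\<And>x. x \<notin> cball 0 R \<Longrightarrow> g x = 0"
  shows "plancherel g"
proof -
  have sqf: "sq_int lborel (f n)" "sq_int lborel (fourier (f n))"
    "norm2 lborel (fourier (f n)) = norm2 lborel (f n)" for n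
    using f by (auto simp: plancherel_def)
  have intf: "integrable lborel (f n)" "integrable lborel g" for n
    using integrable_bounded_support(1)[OF sqf(1)[of n], of R] integrable_bounded_support(1)[OF g, of R] supp by auto
  have [measurable]: "g \<in> borel_measurable borel" using g by (auto simp: sq_int_def)
  have "(\<lambda>n. \<integral>x. norm (f n x - g x) \<partial>lborel) \<longlonglongrightarrow> 0"
  proof (rule Lim_null_comparison)
    show "(\<lambda>n. norm2 lborel (indicator (cball 0 R) :: R3 \<Rightarrow> complex) * norm2 lborel (\<lambda>x. f n x - g x)) \<longlonglongrightarrow> 0"
      using tendsto_mult_right_zero[OF lim] .
    show "\<forall>\<^sub>F n in sequentially. norm (\<integral>x. norm (f n x - g x) \<partial>lborel)
        \<le> norm2 lborel (indicator (cball 0 R) :: R3 \<Rightarrow> complex) * norm2 lborel (\<lambda>x. f n x - g x)"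
      using integrable_bounded_support(2)[OF sq_int_diff[OF sqf(1) g], of R] supp by simp
  qed
  then have pw: "(\<lambda>n. fourier (f n) \<xi>) \<longlonglongrightarrow> fourier g \<xi>" for \<xi>
    by (intro fourier_integrable_tendsto intf)
  \<comment> \<open>Fatou in \<open>m\<close> with \<open>n\<close> fixed. The slack
    \<open>e\<close> is there because the norms of \<open>f m - f n\<close> merely converge to the
    bound.\<close>
  have *: "sq_int lborel (\<lambda>\<xi>. fourier g \<xi> - fourier (f n) \<xi>) \<and>
      norm2 lborel (\<lambda>\<xi>. fourier g \<xi> - fourier (f n) \<xi>) \<le> norm2 lborel (\<lambda>x. g x - f n x) + e" if e: "e > 0" for n e
  proof -
    have 1: "AE \<xi> in lborel. (\<lambda>m. fourier (f m) \<xi> - fourier (f n) \<xi>) \<longlonglongrightarrow> fourier g \<xi> - fourier (f n) \<xi>"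
      using pw by (intro AE_I2 tendsto_intros)
    have n2: "norm2 lborel (\<lambda>\<xi>. fourier (f m) \<xi> - fourier (f n) \<xi>) = norm2 lborel (\<lambda>x. f m x - f n x)" for m
    proof -
      have "fourier (\<lambda>x. f m x - f n x) = (\<lambda>\<xi>. fourier (f m) \<xi> - fourier (f n) \<xi>)"
        by (rule ext) (rule fourier_diff[OF intf(1) intf(1)])
      then show ?thesis using d[of m n] by (simp add: plancherel_def)
    qed
    have "(\<lambda>m. norm2 lborel (\<lambda>x. f m x - f n x)) \<longlonglongrightarrow> norm2 lborel (\<lambda>x. g x - f n x)"
    proof (rule tendsto_norm2)
      show "(\<lambda>m. norm2 lborel (\<lambda>x. (f m x - f n x) - (g x - f n x))) \<longlonglongrightarrow> 0" using lim by simp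
    qed (use sqf g in \<open>auto intro: sq_int_diff\<close>)
    then have "\<forall>\<^sub>F m in sequentially. norm2 lborel (\<lambda>x. f m x - f n x) < norm2 lborel (\<lambda>x. g x - f n x) + e"
      by (rule order_tendstoD) (use e in simp)
    then have 2: "\<forall>\<^sub>F m in sequentially. norm2 lborel (\<lambda>\<xi>. fourier (f m) \<xi> - fourier (f n) \<xi>) \<le> norm2 lborel (\<lambda>x. g x - f n x) + e"
      unfolding n2 by eventually_elim simp
    have "0 \<le> norm2 lborel (\<lambda>x. g x - f n x) + e" using e by (simp add: add_nonneg_nonneg)
    moreover have "(\<lambda>\<xi>. fourier g \<xi> - fourier (f n) \<xi>) \<in> borel_measurable lborel"
      using sqf(1)[of n] by (auto simp: sq_int_def)
    ultimately show ?thesis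
      using norm2_Fatou[OF 1 _ _ 2] sq_int_diff[OF sqf(2) sqf(2)] by blast
  qed
  have sqg: "sq_int lborel (fourier g)"
    using sq_int_add[OF conjunct1[OF *[of 1 0]] sqf(2)[of 0]] by simp
  have "norm2 lborel (\<lambda>\<xi>. fourier g \<xi> - fourier (f n) \<xi>) \<le> norm2 lborel (\<lambda>x. g x - f n x)" for n
    using conjunct2[OF *] by (rule field_le_epsilon)
  then have "(\<lambda>n. norm2 lborel (\<lambda>\<xi>. fourier (f n) \<xi> - fourier g \<xi>)) \<longlonglongrightarrow> 0"
    by (intro Lim_null_comparison[OF _ lim]) (simp add: norm2_minus_commute[of lborel g] norm2_minus_commute[of lborel "fourier g"])
  from tendsto_norm2[OF this sqf(2) sqg] tendsto_norm2[OF lim sqf(1) g]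
  have "norm2 lborel (fourier g) = norm2 lborel g"
    unfolding sqf(3) by (rule LIMSEQ_unique)
  with g sqg show ?thesis by (simp add: plancherel_def)
qed

text \<open>Radial retraction onto the closed disc of radius \<open>M\<close>; writing the
  denominator with \<open>max\<close> makes it continuous without a case split.\<close>

definition clamp_norm :: "real \<Rightarrow> complex \<Rightarrow> complex" where
  "clamp_norm M z = z / of_real (max 1 (norm z / M))"

lemma norm_clamp_norm_le:
  assumes "M > 0"
  shows "norm (clamp_norm M z) \<le> M"
proof -
  have "norm z / M \<le> max 1 (norm z / M)" by simp
  then have "norm z \<le> M * max 1 (norm z / M)"
    by (simp only: pos_divide_le_eq[OF assms] mult.commute)
  moreover have "norm (clamp_norm M z) = norm z / max 1 (norm z / M)"
    by (simp only: clamp_norm_def norm_divide norm_of_real)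
  ultimately show ?thesis
    by (simp add: divide_le_eq)
qed

lemma clamp_norm_eq: "norm z \<le> M \<Longrightarrow> M > 0 \<Longrightarrow> clamp_norm M z = z"
  by (simp add: clamp_norm_def max_def)

lemma continuous_clamp_norm:
  assumes "M > 0" "continuous_on A f"
  shows "continuous_on A (\<lambda>x. clamp_norm M (f x))"
proof -
  have "max 1 (norm z / M) \<noteq> 0" for z :: complex
    using max.cobounded1[of 1 "norm z / M"] by linarith
  then have nz: "complex_of_real (max 1 (norm z / M)) \<noteq> 0" for z :: complex by (simp only: of_real_eq_0_iff) simp
  show ?thesis
    unfolding clamp_norm_def using assms
    by (intro continuous_on_divide continuous_on_of_real continuous_on_max continuous_on_const continuous_on_norm ballI nz) auto
qed

text \<open>A measurable function is an almost everywhere limit of continuous ones. A continuous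
  cutoff and \<open>clamp_norm\<close> make these uniformly bounded with common compact support and
  leave the limit \<open>f\<close> unchanged, so \<open>plancherel_continuous\<close> passes to the
  limit.\<close>

lemma plancherel_bounded:
  fixes f :: wave
  assumes f [measurable]: "f \<in> borel_measurable borel" and M: "\<And>x. norm (f x) \<le> M"
    and supp: "\<And>x. x \<notin> cball 0 R \<Longrightarrow> f x = 0"
  shows "plancherel f"
proof -
  \<comment> \<open>\<open>M\<close> itself may be 0, while \<open>clamp_norm\<close> needs a
    positive radius.\<close>
  define K where "K = M + 1"
  have K: "K > 0" "norm (f x) \<le> K" for x
    using M[of x] norm_ge_zero[of "f x"] unfolding K_def by linarith+
  have "f \<in> borel_measurable lebesgue" by (rule measurable_completion) simp
  then have "f measurable_on UNIV" by (rule lebesgue_measurable_imp_measurable_on) simp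
  then obtain N g where N: "negligible N" and g: "\<And>n. continuous_on UNIV (g n)"
     "\<And>x. x \<notin> N \<Longrightarrow> (\<lambda>n. g n x) \<longlonglongrightarrow> f x"
    by (auto simp: measurable_on_def)
  have "AE x in lebesgue. x \<notin> N"
    using N by (intro AE_not_in) (simp add: negligible_iff_null_sets)
  then have AEN: "AE x in lborel. x \<notin> N" by (simp add: AE_completion_iff)
  \<comment> \<open>Equal to 1 on the ball of radius \<open>R\<close> and vanishing beyond
    \<open>R + 1\<close>; the collar of width 1 is what allows continuity.\<close>
  define cut where "cut x = max 0 (min 1 (R + 1 - norm x))" for x :: R3
  define F where "F n x = of_real (cut x) * clamp_norm K (g n x)" for n x
  have cut: "0 \<le> cut x" "cut x \<le> 1" "x \<notin> cball 0 (R + 1) \<Longrightarrow> cut x = 0" "x \<in> cball 0 R \<Longrightarrow> cut x = 1" for x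
    by (auto simp: cut_def)
  have contF: "continuous_on UNIV (F n)" for n
    unfolding F_def cut_def using K(1) by (intro continuous_intros continuous_clamp_norm g)
  have F_le: "norm (F n x) \<le> K" for n x
    using mult_mono[OF cut(2)[of x] norm_clamp_norm_le[OF K(1), of "g n x"]] cut(1)[of x]
    by (simp add: F_def norm_mult)
  have suppF: "F n x = 0" if "x \<notin> cball 0 (R + 1)" for n x
    using cut(3)[OF that] by (simp add: F_def)
  have suppf: "f x = 0" if "x \<notin> cball 0 (R + 1)" for x
    by (rule supp) (use that in auto)
  have PF: "plancherel (F n)" for n
    using plancherel_continuous[OF contF F_le suppF] by (simp add: plancherel_def)
  have Fd: "norm (F m x - F n x) \<le> K + K" for m n x
    by (rule order_trans[OF norm_triangle_ineq4 add_mono[OF F_le F_le]])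
  have PFd: "plancherel (\<lambda>x. F m x - F n x)" for m n
    using plancherel_continuous[OF continuous_on_diff[OF contF[of m] contF[of n]] Fd, of "R + 1"] suppF
    by (simp add: plancherel_def)
  define w where "w x = of_real (2 * K) * (indicator (cball 0 (R + 1)) x :: complex)" for x :: R3
  have "sq_int lborel (indicator (cball 0 (R + 1)) :: R3 \<Rightarrow> complex)"
  proof (rule sq_intI)
    show "integrable lborel (indicator (cball 0 (R + 1)) :: R3 \<Rightarrow> real)"
      using emeasure_lborel_cball_finite[of 0 "R + 1"] by (intro integrable_real_indicator) auto
  qed (auto intro: borel_measurable_indicator simp: indicator_def)
  then have w: "sq_int lborel w"
    unfolding w_def[abs_def] by (rule sq_int_cmult)
  have nw: "norm (w x) = (if x \<in> cball 0 (R + 1) then 2 * K else 0)" for x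
    using K(1) by (simp add: w_def norm_mult)
  have sqf: "sq_int lborel f"
  proof (rule sq_int_mono[OF w, of _ 1])
    show "norm (f x) \<le> 1 * norm (w x)" for x
      unfolding nw using K(1) K(2)[of x] suppf[of x] by (cases "x \<in> cball 0 (R + 1)") simp_all
  qed simp
  have "(\<lambda>n. norm2 lborel (\<lambda>x. F n x - f x)) \<longlonglongrightarrow> 0"
  proof (rule norm2_tendsto_dominated[OF _ _ sqf w])
    show "norm (F n x - f x) \<le> norm (w x)" for n x
      unfolding nw using order_trans[OF norm_triangle_ineq4 add_mono[OF F_le[of n x] K(2)[of x]]] suppF[of x] suppf[of x]
      by (cases "x \<in> cball 0 (R + 1)") simp_all
    show "AE x in lborel. (\<lambda>n. F n x) \<longlonglongrightarrow> f x"
      using AEN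
    proof eventually_elim
      case (elim x)
      have "isCont (clamp_norm K) (f x)"
        using continuous_clamp_norm[OF K(1), of UNIV "\<lambda>x. x"]
        by (simp add: continuous_on_eq_continuous_at continuous_on_id)
      from isCont_tendsto_compose[OF this g(2)[OF elim]]
      have "(\<lambda>n. of_real (cut x) * clamp_norm K (g n x)) \<longlonglongrightarrow> of_real (cut x) * clamp_norm K (f x)"
        by (rule tendsto_mult_left)
      moreover have "of_real (cut x) * clamp_norm K (f x) = f x"
        using clamp_norm_eq[OF K(2) K(1)] cut(4)[of x] supp[of x] by (cases "x \<in> cball 0 R") (simp_all add: clamp_norm_def)
      ultimately show ?case by (simp add: F_def)
    qed
    show "F n \<in> borel_measurable lborel" for n
      using PF[of n] by (simp add: plancherel_def sq_int_def)
  qed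
  from plancherel_limit[OF PF PFd sqf this suppF suppf] show ?thesis .
qed

text \<open>Discarding the values of modulus above \<open>n\<close> gives bounded functions with the
  same support, and they converge in L2 because \<open>f\<close> itself dominates the error.\<close>

lemma plancherel_bounded_support:
  fixes f :: wave
  assumes f: "sq_int lborel f" and supp: "\<And>x. x \<notin> cball 0 R \<Longrightarrow> f x = 0"
  shows "plancherel f"
proof -
  have [measurable]: "f \<in> borel_measurable borel" using f by (auto simp: sq_int_def)
  define F where "F n x = (if norm (f x) \<le> real n then f x else 0)" for n x
  have [measurable]: "F n \<in> borel_measurable borel" for n unfolding F_def by measurable
  have F_le: "norm (F n x) \<le> real n" for n x by (simp add: F_def)
  have suppF: "F n x = 0" if "x \<notin> cball 0 R" for n x using supp[OF that] by (simp add: F_def)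
  have 1: "plancherel (F n)" for n
    by (rule plancherel_bounded[OF _ F_le suppF]) auto
  have Fd: "norm (F m x - F n x) \<le> real m + real n" for m n x
    by (rule order_trans[OF norm_triangle_ineq4 add_mono[OF F_le F_le]])
  have 2: "plancherel (\<lambda>x. F m x - F n x)" for m n
    by (rule plancherel_bounded[OF _ Fd, where R = R]) (auto simp: suppF)
  have "(\<lambda>n. norm2 lborel (\<lambda>x. F n x - f x)) \<longlonglongrightarrow> 0"
  proof (rule norm2_tendsto_dominated[OF _ _ f f])
    show "AE x in lborel. (\<lambda>n. F n x) \<longlonglongrightarrow> f x"
    proof (rule AE_I2)
      fix x
      obtain k where k: "norm (f x) \<le> real k" using real_arch_simple by blast
      have "\<forall>\<^sub>F n in sequentially. F n x = f x"
        using eventually_ge_at_top[of k] by eventually_elim (use k in \<open>simp add: F_def\<close>)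
      then show "(\<lambda>n. F n x) \<longlonglongrightarrow> f x" by (rule tendsto_eventually)
    qed
  qed (auto simp: F_def)
  from plancherel_limit[OF 1 2 f this suppF supp] show ?thesis .
qed

section \<open>The Fourier--Plancherel transform\<close>

lemma ennsqrt_ennreal: "0 \<le> r \<Longrightarrow> ennsqrt (ennreal r) = ennreal (sqrt r)"
  by (simp add: ennsqrt_def)

lemma ennsqrt_less_top: "ennsqrt x < top \<longleftrightarrow> x < top"
  by (simp add: ennsqrt_def less_top)

lemma L2_iff: "f \<in> L2 \<longleftrightarrow> sq_int lborel f"
proof
  assume "f \<in> L2"
  then show "sq_int lborel f"
    unfolding L2_def l2norm_def ennsqrt_less_top sq_int_def
    by (auto intro!: integrableI_bounded)
next
  assume f: "sq_int lborel f"
  then show "f \<in> L2"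
    unfolding L2_def l2norm_def ennsqrt_less_top using nn_integral_norm_sq[OF f]
    by (simp add: sq_int_def)
qed

lemma l2norm_eq: "sq_int lborel f \<Longrightarrow> l2norm f = ennreal (norm2 lborel f)"
  by (simp add: l2norm_def nn_integral_norm_sq ennsqrt_ennreal)

lemma l2inner_eq: "l2inner = inner2 lborel"
  by (simp add: l2inner_def inner2_def fun_eq_iff)

lemma inner2_eq_imp_AE:
  assumes "sq_int M f" "sq_int M g"
    and "\<And>h. sq_int M h \<Longrightarrow> inner2 M h f = inner2 M h g"
  shows "AE x in M. f x = g x"
proof -
  have d: "sq_int M (\<lambda>x. f x - g x)" by (intro sq_int_diff assms)
  have "inner2 M (\<lambda>x. f x - g x) (\<lambda>x. f x - g x) = 0"
    by (simp add: inner2_diff_right assms d)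
  then have "norm2 M (\<lambda>x. f x - g x) = 0" by (simp add: inner2_self)
  then show ?thesis using norm2_eq_0_iff[OF d] by simp
qed

lemma tendsto_inner2:
  assumes f: "(\<lambda>n. norm2 M (\<lambda>x. f n x - f' x)) \<longlonglongrightarrow> 0" and g: "(\<lambda>n. norm2 M (\<lambda>x. g n x - g' x)) \<longlonglongrightarrow> 0"
    and sq: "\<And>n. sq_int M (f n)" "sq_int M f'" "\<And>n. sq_int M (g n)" "sq_int M g'"
  shows "(\<lambda>n. inner2 M (f n) (g n)) \<longlonglongrightarrow> inner2 M f' g'"
proof (rule LIM_zero_cancel, rule Lim_null_comparison)
  have "(\<lambda>n. norm2 M (f n) * norm2 M (\<lambda>x. g n x - g' x) + norm2 M g' * norm2 M (\<lambda>x. f n x - f' x))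
      \<longlonglongrightarrow> norm2 M f' * 0 + norm2 M g' * 0"
    by (intro tendsto_intros f g tendsto_norm2[OF f] sq)
  then show "(\<lambda>n. norm2 M (f n) * norm2 M (\<lambda>x. g n x - g' x) + norm2 M g' * norm2 M (\<lambda>x. f n x - f' x)) \<longlonglongrightarrow> 0"
    by simp
  have "norm (inner2 M (f n) (g n) - inner2 M f' g')
      \<le> norm2 M (f n) * norm2 M (\<lambda>x. g n x - g' x) + norm2 M g' * norm2 M (\<lambda>x. f n x - f' x)" for n
  proof -
    have "inner2 M (f n) (g n) - inner2 M f' g' =
        inner2 M (f n) (\<lambda>x. g n x - g' x) + cnj (inner2 M g' (\<lambda>x. f n x - f' x))"
      using sq by (simp add: inner2_diff_right inner2_commute[of M _ g'])
    also have "norm \<dots> \<le> norm (inner2 M (f n) (\<lambda>x. g n x - g' x)) + norm (inner2 M g' (\<lambda>x. f n x - f' x))"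
      by (rule order_trans[OF norm_triangle_ineq]) simp
    also have "\<dots> \<le> norm2 M (f n) * norm2 M (\<lambda>x. g n x - g' x) + norm2 M g' * norm2 M (\<lambda>x. f n x - f' x)"
      by (intro add_mono norm_inner2_le sq sq_int_diff)
    finally show ?thesis .
  qed
  then show "\<forall>\<^sub>F n in sequentially. norm (inner2 M (f n) (g n) - inner2 M f' g')
      \<le> norm2 M (f n) * norm2 M (\<lambda>x. g n x - g' x) + norm2 M g' * norm2 M (\<lambda>x. f n x - f' x)"
    by simp
qed

text \<open>The norm of \<open>T (f + g)\<close> determines the real part of the inner product, and
  replacing \<open>f\<close> by \<open>\<i> * f\<close> gives the imaginary part. Linearity is
  assumed only almost everywhere, which is all that a transform chosen by \<open>SOME\<close>
  satisfies.\<close>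

lemma polarization:
  assumes T: "\<And>f. sq_int M f \<Longrightarrow> sq_int N (T f)" "\<And>f. sq_int M f \<Longrightarrow> norm2 N (T f) = norm2 M f"
    and add: "\<And>f g. sq_int M f \<Longrightarrow> sq_int M g \<Longrightarrow> AE x in N. T (\<lambda>x. f x + g x) x = T f x + T g x"
    and cmult: "\<And>c f. sq_int M f \<Longrightarrow> AE x in N. T (\<lambda>x. c * f x) x = c * T f x"
    and f: "sq_int M f" and g: "sq_int M g"
  shows "inner2 N (T f) (T g) = inner2 M f g"
proof -
  have Re: "Re (inner2 N (T f) (T g)) = Re (inner2 M f g)" if f: "sq_int M f" and g: "sq_int M g" for f g
  proof -
    have "norm2 N (\<lambda>x. T f x + T g x) = norm2 N (T (\<lambda>x. f x + g x))"
      using add[OF f g] T(1)[OF f] T(1)[OF g] T(1)[OF sq_int_add[OF f g]]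
      by (intro norm2_cong_AE) (auto simp: sq_int_def)
    also have "\<dots> = norm2 M (\<lambda>x. f x + g x)" by (intro T sq_int_add f g)
    finally show ?thesis
      using norm2_add_sq[OF T(1)[OF f] T(1)[OF g]] norm2_add_sq[OF f g] T(2)[OF f] T(2)[OF g] by simp
  qed
  have if': "sq_int M (\<lambda>x. \<i> * f x)" by (rule sq_int_cmult[OF f])
  have "inner2 N (T (\<lambda>x. \<i> * f x)) (T g) = inner2 N (\<lambda>x. \<i> * T f x) (T g)"
    using cmult[OF f, of \<i>] T(1)[OF f] T(1)[OF g] T(1)[OF if']
    by (intro inner2_cong_AE) (auto intro: sq_int_cmult)
  then have "Re (- \<i> * inner2 N (T f) (T g)) = Re (- \<i> * inner2 M f g)"
    using Re[OF if' g] by (simp add: inner2_cmult_left)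
  then show ?thesis using Re[OF f g] by (simp add: complex_eq_iff)
qed

lemma
  fixes f :: "'a::euclidean_space \<Rightarrow> complex"
  assumes f: "sq_int lborel f"
  shows sq_int_shift: "sq_int lborel (\<lambda>x. f (x - a))"
    and norm2_shift: "norm2 lborel (\<lambda>x. f (x - a)) = norm2 lborel f"
proof -
  have [measurable]: "f \<in> borel_measurable borel" using f by (auto simp: sq_int_def)
  have "(\<lambda>x. (norm (f x))\<^sup>2) \<in> borel_measurable borel" by measurable
  note s = lborel_integral_scale_shift[of 1 "\<lambda>x. (norm (f x))\<^sup>2" "- a", OF _ this]
  show "sq_int lborel (\<lambda>x. f (x - a))"
    using s(1) f by (auto simp: sq_int_def)
  show "norm2 lborel (\<lambda>x. f (x - a)) = norm2 lborel f"
    using s(2) by (simp add: norm2_def)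
qed

section \<open>Truncation to balls and construction of the transform\<close>

definition trunc :: "real \<Rightarrow> wave \<Rightarrow> wave" where
  "trunc R f = (\<lambda>x. indicator (cball 0 R) x * f x)"

lemma sq_int_trunc: "sq_int lborel f \<Longrightarrow> sq_int lborel (trunc R f)"
  unfolding trunc_def
  by (rule sq_int_bounded_mult[of _ _ _ 1]) (auto intro: borel_measurable_indicator simp: indicator_def)

lemma trunc_outside: "x \<notin> cball 0 R \<Longrightarrow> trunc R f x = 0"
  by (simp add: trunc_def)

lemma plancherel_trunc: "sq_int lborel f \<Longrightarrow> plancherel (trunc R f)"
  by (rule plancherel_bounded_support[OF sq_int_trunc trunc_outside])

lemma integrable_trunc: "sq_int lborel f \<Longrightarrow> integrable lborel (trunc R f)"
  by (rule integrable_bounded_support(1)[OF sq_int_trunc trunc_outside])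

text \<open>The difference is supported in the ball of radius \<open>max R S\<close>, where
  Plancherel is already known. This makes the truncated transforms Cauchy.\<close>

lemma norm2_fourier_trunc_diff:
  assumes f: "sq_int lborel f"
  shows "norm2 lborel (\<lambda>\<xi>. fourier (trunc R f) \<xi> - fourier (trunc S f) \<xi>) = norm2 lborel (\<lambda>x. trunc R f x - trunc S f x)"
proof -
  have "plancherel (\<lambda>x. trunc R f x - trunc S f x)"
  proof (rule plancherel_bounded_support)
    show "sq_int lborel (\<lambda>x. trunc R f x - trunc S f x)"
      by (intro sq_int_diff sq_int_trunc f)
    show "trunc R f x - trunc S f x = 0" if "x \<notin> cball 0 (max R S)" for x
      using that by (simp add: trunc_def)
  qed
  moreover have "fourier (\<lambda>x. trunc R f x - trunc S f x) = (\<lambda>\<xi>. fourier (trunc R f) \<xi> - fourier (trunc S f) \<xi>)"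
    by (rule ext) (intro fourier_diff integrable_trunc f)
  ultimately show ?thesis by (simp add: plancherel_def)
qed

lemma trunc_tendsto:
  assumes f: "sq_int lborel f"
  shows "((\<lambda>R. norm2 lborel (\<lambda>x. trunc R f x - f x)) \<longlongrightarrow> 0) at_top"
proof (rule tendsto_at_topI_sequentially)
  fix X :: "nat \<Rightarrow> real" assume X: "filterlim X at_top sequentially"
  show "(\<lambda>n. norm2 lborel (\<lambda>x. trunc (X n) f x - f x)) \<longlonglongrightarrow> 0"
  proof (rule norm2_tendsto_dominated[OF _ _ f f])
    show "AE x in lborel. (\<lambda>n. trunc (X n) f x) \<longlonglongrightarrow> f x"
    proof (rule AE_I2)
      fix x :: R3
      have "\<forall>\<^sub>F n in sequentially. norm x \<le> X n" using X by (simp add: filterlim_at_top)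
      then have "\<forall>\<^sub>F n in sequentially. trunc (X n) f x = f x"
        by eventually_elim (simp add: trunc_def)
      then show "(\<lambda>n. trunc (X n) f x) \<longlonglongrightarrow> f x" by (rule tendsto_eventually)
    qed
    show "trunc (X n) f \<in> borel_measurable lborel" for n
      using sq_int_trunc[OF f] by (simp add: sq_int_def)
    show "norm (trunc (X n) f x - f x) \<le> norm (f x)" for n x
      by (simp add: trunc_def indicator_def)
  qed
qed

text \<open>Integer radii form a Cauchy sequence, so completeness gives \<open>g\<close>; an exact
  tail identity then extends the convergence to real radii, as the definition of
  \<open>l2_fourier\<close> demands.\<close>

lemma l2_fourier_exists:
  assumes f: "sq_int lborel f"
  obtains g where "sq_int lborel g"
    "((\<lambda>R. norm2 lborel (\<lambda>\<xi>. g \<xi> - fourier (trunc R f) \<xi>)) \<longlongrightarrow> 0) at_top"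
proof -
  let ?F = "\<lambda>R. fourier (trunc R f)"
  have sqF: "sq_int lborel (?F R)" for R using plancherel_trunc[OF f] by (simp add: plancherel_def)
  have lim: "(\<lambda>n. norm2 lborel (\<lambda>x. trunc (real n) f x - f x)) \<longlonglongrightarrow> 0"
    by (rule filterlim_compose[OF trunc_tendsto[OF f] filterlim_real_sequentially])
  have cauchy: "\<exists>N. \<forall>i\<ge>N. \<forall>j\<ge>N. norm2 lborel (\<lambda>\<xi>. ?F (real i) \<xi> - ?F (real j) \<xi>) < e" if e: "e > 0" for e
  proof -
    obtain N where N: "\<And>n. n \<ge> N \<Longrightarrow> norm2 lborel (\<lambda>x. trunc (real n) f x - f x) < e / 2"
      using order_tendstoD(2)[OF lim, of "e / 2"] e by (auto simp: eventually_sequentially)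
    have "norm2 lborel (\<lambda>\<xi>. ?F (real i) \<xi> - ?F (real j) \<xi>) < e" if "i \<ge> N" "j \<ge> N" for i j
      using norm2_triangle_diff[OF sq_int_trunc[OF f, of i] f sq_int_trunc[OF f, of j]] N[OF that(1)] N[OF that(2)]
      unfolding norm2_fourier_trunc_diff[OF f] norm2_minus_commute[of lborel f] by simp
    then show ?thesis by blast
  qed
  obtain g where g: "sq_int lborel g" "(\<lambda>n. norm2 lborel (\<lambda>\<xi>. ?F (real n) \<xi> - g \<xi>)) \<longlonglongrightarrow> 0"
    by (rule lborel.sq_int_complete[of "\<lambda>n. ?F (real n)", OF sqF cauchy])
  \<comment> \<open>Fix \<open>R\<close> and let \<open>n\<close> tend to infinity in the isometry
    for differences of truncations: the distance from \<open>g\<close> is exactly the tail of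
    \<open>f\<close>.\<close>
  have "norm2 lborel (\<lambda>\<xi>. g \<xi> - ?F R \<xi>) = norm2 lborel (\<lambda>x. trunc R f x - f x)" for R
  proof (rule LIMSEQ_unique)
    show "(\<lambda>n. norm2 lborel (\<lambda>\<xi>. ?F (real n) \<xi> - ?F R \<xi>)) \<longlonglongrightarrow> norm2 lborel (\<lambda>\<xi>. g \<xi> - ?F R \<xi>)"
      by (rule tendsto_norm2) (use g sqF in \<open>auto intro: sq_int_diff\<close>)
    have "(\<lambda>n. norm2 lborel (\<lambda>x. trunc (real n) f x - trunc R f x)) \<longlonglongrightarrow> norm2 lborel (\<lambda>x. f x - trunc R f x)"
      by (rule tendsto_norm2) (use lim f in \<open>auto intro: sq_int_diff sq_int_trunc\<close>)
    then show "(\<lambda>n. norm2 lborel (\<lambda>\<xi>. ?F (real n) \<xi> - ?F R \<xi>)) \<longlonglongrightarrow> norm2 lborel (\<lambda>x. trunc R f x - f x)"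
      unfolding norm2_fourier_trunc_diff[OF f] norm2_minus_commute[of lborel f] .
  qed
  then show thesis using that[OF g(1)] trunc_tendsto[OF f] by simp
qed

lemma
  assumes f: "sq_int lborel f"
  shows sq_int_l2_fourier: "sq_int lborel (l2_fourier f)"
    and l2_fourier_tendsto: "((\<lambda>R. norm2 lborel (\<lambda>\<xi>. l2_fourier f \<xi> - fourier (trunc R f) \<xi>)) \<longlongrightarrow> 0) at_top"
proof -
  have sqF: "sq_int lborel (fourier (trunc R f))" for R
    using plancherel_trunc[OF f] by (simp add: plancherel_def)
  let ?P = "\<lambda>g. g \<in> L2 \<and>
     ((\<lambda>R::real. l2norm (\<lambda>\<xi>. g \<xi> - fourier (\<lambda>x. indicator (cball 0 R) x * f x) \<xi>)) \<longlongrightarrow> 0) at_top"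
  have P: "?P g \<longleftrightarrow> sq_int lborel g \<and> ((\<lambda>R. norm2 lborel (\<lambda>\<xi>. g \<xi> - fourier (trunc R f) \<xi>)) \<longlongrightarrow> 0) at_top" for g
    using tendsto_ennreal_iff[where f = "\<lambda>R. norm2 lborel (\<lambda>\<xi>. g \<xi> - fourier (trunc R f) \<xi>)" and F = at_top and x = 0]
    unfolding L2_iff trunc_def[symmetric]
    by (auto simp: l2norm_eq sq_int_diff sqF)
  obtain g where "sq_int lborel g" "((\<lambda>R. norm2 lborel (\<lambda>\<xi>. g \<xi> - fourier (trunc R f) \<xi>)) \<longlongrightarrow> 0) at_top"
    by (rule l2_fourier_exists[OF f])
  then have "?P g" by (intro iffD2[OF P] conjI)
  then have "?P (l2_fourier f)" unfolding l2_fourier_def by (rule someI[of ?P])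
  then show "sq_int lborel (l2_fourier f)"
    "((\<lambda>R. norm2 lborel (\<lambda>\<xi>. l2_fourier f \<xi> - fourier (trunc R f) \<xi>)) \<longlongrightarrow> 0) at_top"
    using iffD1[OF P, of "l2_fourier f"] by auto
qed

lemma l2_fourier_lim:
  assumes f: "sq_int lborel f"
  shows "(\<lambda>n. norm2 lborel (\<lambda>\<xi>. fourier (trunc (real n) f) \<xi> - l2_fourier f \<xi>)) \<longlonglongrightarrow> 0"
    "\<And>R. sq_int lborel (fourier (trunc R f))"
    "(\<lambda>n. norm2 lborel (\<lambda>\<xi>. trunc (real n) f \<xi> - f \<xi>)) \<longlonglongrightarrow> 0"
proof -
  show "(\<lambda>n. norm2 lborel (\<lambda>\<xi>. fourier (trunc (real n) f) \<xi> - l2_fourier f \<xi>)) \<longlonglongrightarrow> 0"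
    unfolding norm2_minus_commute[of lborel _ "l2_fourier f"]
    by (rule filterlim_compose[OF l2_fourier_tendsto[OF f] filterlim_real_sequentially])
  show "sq_int lborel (fourier (trunc R f))" for R
    using plancherel_trunc[OF f] by (simp add: plancherel_def)
  show "(\<lambda>n. norm2 lborel (\<lambda>x. trunc (real n) f x - f x)) \<longlonglongrightarrow> 0"
    by (rule filterlim_compose[OF trunc_tendsto[OF f] filterlim_real_sequentially])
qed

text \<open>Integer radii already determine the transform, so rules valid for the Fourier integrals
  of truncations pass to \<open>l2_fourier\<close>.\<close>

lemma l2_fourier_unique:
  assumes f: "sq_int lborel f" and g: "sq_int lborel g"
    and lim: "(\<lambda>n. norm2 lborel (\<lambda>\<xi>. fourier (trunc (real n) f) \<xi> - g \<xi>)) \<longlonglongrightarrow> 0"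
  shows "AE \<xi> in lborel. l2_fourier f \<xi> = g \<xi>"
  by (rule norm2_limit_unique[OF l2_fourier_lim(1)[OF f] lim]) (simp_all add: l2_fourier_lim f g sq_int_l2_fourier)

lemma norm2_l2_fourier:
  assumes f: "sq_int lborel f"
  shows "norm2 lborel (l2_fourier f) = norm2 lborel f"
proof (rule LIMSEQ_unique)
  show "(\<lambda>n. norm2 lborel (fourier (trunc (real n) f))) \<longlonglongrightarrow> norm2 lborel (l2_fourier f)"
    by (intro tendsto_norm2 l2_fourier_lim f sq_int_l2_fourier)
  have "(\<lambda>n. norm2 lborel (trunc (real n) f)) \<longlonglongrightarrow> norm2 lborel f"
    by (intro tendsto_norm2 l2_fourier_lim f sq_int_trunc)
  then show "(\<lambda>n. norm2 lborel (fourier (trunc (real n) f))) \<longlonglongrightarrow> norm2 lborel f"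
    using plancherel_trunc[OF f] by (simp add: plancherel_def)
qed

lemma l2_fourier_add:
  assumes f: "sq_int lborel f" and g: "sq_int lborel g"
  shows "AE \<xi> in lborel. l2_fourier (\<lambda>x. f x + g x) \<xi> = l2_fourier f \<xi> + l2_fourier g \<xi>"
proof (rule l2_fourier_unique)
  have tr: "trunc R (\<lambda>x. f x + g x) = (\<lambda>x. trunc R f x + trunc R g x)" for R
    by (simp add: trunc_def distrib_left)
  have eq: "fourier (trunc R (\<lambda>x. f x + g x)) \<xi> = fourier (trunc R f) \<xi> + fourier (trunc R g) \<xi>" for R \<xi>
    unfolding tr by (intro fourier_add integrable_trunc f g)
  show "(\<lambda>n. norm2 lborel (\<lambda>\<xi>. fourier (trunc (real n) (\<lambda>x. f x + g x)) \<xi> - (l2_fourier f \<xi> + l2_fourier g \<xi>))) \<longlonglongrightarrow> 0"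
  proof (rule Lim_null_comparison)
    show "(\<lambda>n. norm2 lborel (\<lambda>\<xi>. fourier (trunc (real n) f) \<xi> - l2_fourier f \<xi>) + norm2 lborel (\<lambda>\<xi>. fourier (trunc (real n) g) \<xi> - l2_fourier g \<xi>)) \<longlonglongrightarrow> 0"
      using tendsto_add[OF l2_fourier_lim(1)[OF f] l2_fourier_lim(1)[OF g]] by simp
    show "\<forall>\<^sub>F n in sequentially. norm (norm2 lborel (\<lambda>\<xi>. fourier (trunc (real n) (\<lambda>x. f x + g x)) \<xi> - (l2_fourier f \<xi> + l2_fourier g \<xi>)))
       \<le> norm2 lborel (\<lambda>\<xi>. fourier (trunc (real n) f) \<xi> - l2_fourier f \<xi>) + norm2 lborel (\<lambda>\<xi>. fourier (trunc (real n) g) \<xi> - l2_fourier g \<xi>)"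
      unfolding eq
      using norm2_triangle[OF sq_int_diff[OF l2_fourier_lim(2)[OF f] sq_int_l2_fourier[OF f]]
          sq_int_diff[OF l2_fourier_lim(2)[OF g] sq_int_l2_fourier[OF g]]]
      by (simp add: algebra_simps)
  qed
qed (intro sq_int_add sq_int_l2_fourier f g)+

lemma l2_fourier_cmult:
  assumes f: "sq_int lborel f"
  shows "AE \<xi> in lborel. l2_fourier (\<lambda>x. c * f x) \<xi> = c * l2_fourier f \<xi>"
proof (rule l2_fourier_unique)
  have tr: "trunc R (\<lambda>x. c * f x) = (\<lambda>x. c * trunc R f x)" for R
    by (simp add: trunc_def mult.left_commute)
  have eq: "fourier (trunc R (\<lambda>x. c * f x)) \<xi> - c * l2_fourier f \<xi> = c * (fourier (trunc R f) \<xi> - l2_fourier f \<xi>)" for R \<xi>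
    unfolding tr fourier_cmult by (simp add: right_diff_distrib)
  show "(\<lambda>n. norm2 lborel (\<lambda>\<xi>. fourier (trunc (real n) (\<lambda>x. c * f x)) \<xi> - c * l2_fourier f \<xi>)) \<longlonglongrightarrow> 0"
    unfolding eq norm2_cmult by (rule tendsto_mult_right_zero[OF l2_fourier_lim(1)[OF f]])
qed (intro sq_int_cmult sq_int_l2_fourier f)+

lemma inner2_l2_fourier:
  "sq_int lborel f \<Longrightarrow> sq_int lborel g \<Longrightarrow> inner2 lborel (l2_fourier f) (l2_fourier g) = inner2 lborel f g"
  by (rule polarization) (simp_all add: sq_int_l2_fourier norm2_l2_fourier l2_fourier_add l2_fourier_cmult)

text \<open>The multiplication formula for truncations, passed to the limit on both sides. The
  second factor on the right is the inverse transform, written as conjugation, transform,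
  conjugation.\<close>

lemma inner2_l2_fourier_adjoint:
  assumes f: "sq_int lborel f" and g: "sq_int lborel g"
  shows "inner2 lborel (l2_fourier f) g = inner2 lborel f (\<lambda>x. cnj (l2_fourier (\<lambda>\<xi>. cnj (g \<xi>)) x))"
proof (rule LIMSEQ_unique)
  let ?g = "\<lambda>\<xi>. cnj (g \<xi>)"
  have g': "sq_int lborel ?g" by (rule sq_int_cnj[OF g])
  show "(\<lambda>n. inner2 lborel (fourier (trunc (real n) f)) (trunc (real n) g)) \<longlonglongrightarrow> inner2 lborel (l2_fourier f) g"
    by (intro tendsto_inner2 l2_fourier_lim f g sq_int_l2_fourier sq_int_trunc)
  have "(\<lambda>n. norm2 lborel (\<lambda>x. cnj (fourier (trunc (real n) ?g) x) - cnj (l2_fourier ?g x))) \<longlonglongrightarrow> 0"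
    using l2_fourier_lim(1)[OF g'] unfolding complex_cnj_diff[symmetric] norm2_def complex_mod_cnj .
  then have "(\<lambda>n. inner2 lborel (trunc (real n) f) (\<lambda>x. cnj (fourier (trunc (real n) ?g) x))) \<longlonglongrightarrow>
      inner2 lborel f (\<lambda>x. cnj (l2_fourier ?g x))"
    by (intro tendsto_inner2 l2_fourier_lim f g' sq_int_l2_fourier sq_int_trunc sq_int_cnj)
  moreover have "inner2 lborel (fourier (trunc R f)) (trunc R g) = inner2 lborel (trunc R f) (\<lambda>x. cnj (fourier (trunc R ?g) x))" for R
  proof -
    have tr: "trunc R ?g = (\<lambda>x. cnj (trunc R g x))" by (simp add: trunc_def indicator_def fun_eq_iff)
    have "inner2 lborel (fourier (trunc R f)) (trunc R g) = cnj (\<integral>\<xi>. fourier (trunc R f) \<xi> * trunc R ?g \<xi> \<partial>lborel)"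
      unfolding inner2_def tr Bochner_Integration.integral_cnj[symmetric] by simp
    also have "(\<integral>\<xi>. fourier (trunc R f) \<xi> * trunc R ?g \<xi> \<partial>lborel) = (\<integral>x. trunc R f x * fourier (trunc R ?g) x \<partial>lborel)"
      by (intro fourier_multiplication_formula integrable_trunc f g')
    also have "cnj \<dots> = inner2 lborel (trunc R f) (\<lambda>x. cnj (fourier (trunc R ?g) x))"
      unfolding inner2_def Bochner_Integration.integral_cnj[symmetric] by simp
    finally show ?thesis .
  qed
  ultimately show "(\<lambda>n. inner2 lborel (fourier (trunc (real n) f)) (trunc (real n) g)) \<longlonglongrightarrow>
      inner2 lborel f (\<lambda>x. cnj (l2_fourier ?g x))" by simp
qed

lemma inner2_cnj: "inner2 M (\<lambda>x. cnj (f x)) (\<lambda>x. cnj (g x)) = cnj (inner2 M f g)"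
  unfolding inner2_def Bochner_Integration.integral_cnj[symmetric] by simp

text \<open>
  The preimage of \<open>g\<close> is the conjugate transform \<open>inv g\<close>: it is the adjoint of the transform and
  itself isometric, so no inversion formula is needed.
\<close>

lemma l2_fourier_surj:
  assumes g: "sq_int lborel g"
  obtains f where "sq_int lborel f" "AE \<xi> in lborel. l2_fourier f \<xi> = g \<xi>"
proof -
  define inv where "inv g = (\<lambda>x. cnj (l2_fourier (\<lambda>\<xi>. cnj (g \<xi>)) x))" for g
  have inv: "sq_int lborel (inv h)" if "sq_int lborel h" for h
    unfolding inv_def by (intro sq_int_cnj sq_int_l2_fourier that)
  have "AE \<xi> in lborel. l2_fourier (inv g) \<xi> = g \<xi>"
  proof (rule inner2_eq_imp_AE)
    fix h :: wave assume h: "sq_int lborel h"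
    have "inner2 lborel (l2_fourier (inv g)) h = inner2 lborel (inv g) (inv h)"
      using inner2_l2_fourier_adjoint[OF inv[OF g] h] by (simp add: inv_def)
    also have "\<dots> = inner2 lborel g h"
      unfolding inv_def inner2_cnj
      by (subst inner2_l2_fourier) (simp_all add: g h sq_int_cnj inner2_cnj)
    finally show "inner2 lborel h (l2_fourier (inv g)) = inner2 lborel h g"
      using inner2_commute[of lborel h] by simp
  qed (intro g inv sq_int_l2_fourier)+
  then show thesis using that inv[OF g] by blast
qed

section \<open>Modulations and translations\<close>

lemma sq_int_cis_mult:
  "sq_int M f \<Longrightarrow> g \<in> borel_measurable M \<Longrightarrow> sq_int M (\<lambda>x. cis (g x) * f x)"
  by (rule sq_int_bounded_mult[of M f _ 1]) simp_all

text \<open>Modulation commutes with truncation, so the rule is exact for each truncated integral,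
  and the shift on the Fourier side is an isometry.\<close>

lemma l2_fourier_modulation:
  assumes f: "sq_int lborel f"
  shows "AE \<eta> in lborel. l2_fourier (\<lambda>x. cis (x \<bullet> \<xi>) * f x) \<eta> = l2_fourier f (\<eta> - \<xi>)"
proof (rule l2_fourier_unique)
  show "sq_int lborel (\<lambda>x. cis (x \<bullet> \<xi>) * f x)"
    by (rule sq_int_cis_mult[OF f]) simp
  show "sq_int lborel (\<lambda>\<eta>. l2_fourier f (\<eta> - \<xi>))"
    by (rule sq_int_shift[OF sq_int_l2_fourier[OF f]])
  have eq: "fourier (trunc R (\<lambda>x. cis (x \<bullet> \<xi>) * f x)) \<eta> = fourier (trunc R f) (\<eta> - \<xi>)" for R \<eta>
  proof -
    have "cis (- (x \<bullet> \<eta>)) * trunc R (\<lambda>x. cis (x \<bullet> \<xi>) * f x) x = cis (- (x \<bullet> (\<eta> - \<xi>))) * trunc R f x" for x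
    proof -
      have "cis (- (x \<bullet> (\<eta> - \<xi>))) = cis (- (x \<bullet> \<eta>)) * cis (x \<bullet> \<xi>)"
        by (simp add: cis_mult inner_diff_right)
      then show ?thesis by (simp add: trunc_def)
    qed
    then show ?thesis by (simp add: fourier_def)
  qed
  show "(\<lambda>n. norm2 lborel (\<lambda>\<eta>. fourier (trunc (real n) (\<lambda>x. cis (x \<bullet> \<xi>) * f x)) \<eta> - l2_fourier f (\<eta> - \<xi>))) \<longlonglongrightarrow> 0"
    unfolding eq
      norm2_shift[OF sq_int_diff[OF l2_fourier_lim(2)[OF f] sq_int_l2_fourier[OF f]]]
    by (rule l2_fourier_lim(1)[OF f])
qed

lemma inner2_shift: "inner2 lborel (\<lambda>x. f (x - a)) g = inner2 lborel f (\<lambda>x. g (x + a))"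
  if "sq_int lborel f" "sq_int lborel g" for a :: "'a::euclidean_space"
proof -
  have [measurable]: "f \<in> borel_measurable borel" "g \<in> borel_measurable borel"
    using that by (auto simp: sq_int_def)
  show ?thesis
    unfolding inner2_def
    by (subst lborel_integral_scale_shift(2)[of 1 _ a]) (simp_all add: add.commute)
qed

text \<open>Translation does not commute with truncation to centred balls. The rule is obtained by
  duality instead: against a test function, the phase moves to the other side and becomes a
  modulation under the adjoint transform.\<close>

lemma l2_fourier_translation:
  assumes f: "sq_int lborel f"
  shows "AE \<eta> in lborel. l2_fourier (\<lambda>x. f (x - a)) \<eta> = cis (- (a \<bullet> \<eta>)) * l2_fourier f \<eta>"
proof (rule inner2_eq_imp_AE)
  note sF = sq_int_l2_fourier
  show "sq_int lborel (l2_fourier (\<lambda>x. f (x - a)))"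
    by (intro sF sq_int_shift f)
  show sq: "sq_int lborel (\<lambda>\<eta>. cis (- (a \<bullet> \<eta>)) * l2_fourier f \<eta>)"
    by (intro sq_int_cis_mult sF f) simp
  fix h :: wave assume h: "sq_int lborel h"
  let ?h = "\<lambda>x. cnj (l2_fourier (\<lambda>\<xi>. cnj (h \<xi>)) x)"
  have ch: "sq_int lborel (\<lambda>\<eta>. cis (a \<bullet> \<eta>) * h \<eta>)"
    by (intro sq_int_cis_mult h) simp
  have "AE x in lborel. l2_fourier (\<lambda>\<xi>. cnj (cis (a \<bullet> \<xi>) * h \<xi>)) x = l2_fourier (\<lambda>\<xi>. cnj (h \<xi>)) (x + a)"
    using l2_fourier_modulation[OF sq_int_cnj[OF h], of "- a"] by (simp add: cis_cnj inner_commute)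
  then have ae: "AE x in lborel. cnj (l2_fourier (\<lambda>\<xi>. cnj (cis (a \<bullet> \<xi>) * h \<xi>)) x) = ?h (x + a)"
    by eventually_elim simp
  have "inner2 lborel (\<lambda>\<eta>. cis (- (a \<bullet> \<eta>)) * l2_fourier f \<eta>) h = inner2 lborel (l2_fourier f) (\<lambda>\<eta>. cis (a \<bullet> \<eta>) * h \<eta>)"
    unfolding inner2_def by (intro Bochner_Integration.integral_cong) (auto simp: cis_cnj mult_ac)
  also have "\<dots> = inner2 lborel f (\<lambda>x. cnj (l2_fourier (\<lambda>\<xi>. cnj (cis (a \<bullet> \<xi>) * h \<xi>)) x))"
    by (rule inner2_l2_fourier_adjoint[OF f ch])
  also have "\<dots> = inner2 lborel f (\<lambda>x. ?h (x + a))"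
  proof (rule inner2_cong_AE[OF _ ae f f])
    show "sq_int lborel (\<lambda>x. ?h (x + a))"
      using sq_int_shift[OF sq_int_cnj[OF sF[OF sq_int_cnj[OF h]]], of "- a"] by simp
  qed (intro AE_I2 refl sq_int_cnj sF ch)+
  also have "\<dots> = inner2 lborel (\<lambda>x. f (x - a)) ?h"
    by (rule inner2_shift[symmetric]) (intro f h sq_int_cnj sF)+
  also have "\<dots> = inner2 lborel (l2_fourier (\<lambda>x. f (x - a))) h"
    by (rule inner2_l2_fourier_adjoint[symmetric]) (intro h sq_int_shift f)+
  finally show "inner2 lborel h (l2_fourier (\<lambda>x. f (x - a))) = inner2 lborel h (\<lambda>\<eta>. cis (- (a \<bullet> \<eta>)) * l2_fourier f \<eta>)"
    using inner2_commute[of lborel h] by simp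
qed

section \<open>Hilbert--Schmidt kernels\<close>

text \<open>The sum of the norms has finite integral by monotone convergence, hence is finite almost
  everywhere.\<close>

lemma AE_summable_norm:
  fixes f :: "nat \<Rightarrow> 'a \<Rightarrow> 'b::{banach, second_countable_topology}"
  assumes f: "\<And>n. integrable M (f n)" and s: "summable (\<lambda>n. \<integral>x. norm (f n x) \<partial>M)"
  shows "AE x in M. summable (\<lambda>n. norm (f n x))"
proof -
  have [measurable]: "f n \<in> borel_measurable M" for n using f by auto
  have "(\<integral>\<^sup>+x. (\<Sum>n. ennreal (norm (f n x))) \<partial>M) = (\<Sum>n. \<integral>\<^sup>+x. ennreal (norm (f n x)) \<partial>M)"
    by (rule nn_integral_suminf) simp
  also have "\<dots> = (\<Sum>n. ennreal (\<integral>x. norm (f n x) \<partial>M))"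
    using f by (intro suminf_cong nn_integral_eq_integral) auto
  also have "\<dots> \<noteq> \<infinity>"
    using s by (simp add: suminf_ennreal2)
  finally have "AE x in M. (\<Sum>n. ennreal (norm (f n x))) \<noteq> \<infinity>"
    by (intro nn_integral_PInf_AE) auto
  then show ?thesis
    by eventually_elim (auto intro!: summable_suminf_not_top)
qed

lemma inner2_sum_left:
  "sq_int M f \<Longrightarrow> (\<And>i. i \<in> I \<Longrightarrow> sq_int M (g i)) \<Longrightarrow>
    inner2 M (\<lambda>x. \<Sum>i\<in>I. g i x) f = (\<Sum>i\<in>I. inner2 M (g i) f)"
  by (subst (1 2) inner2_commute) (simp add: inner2_sum_right)

lemma (in pair_sigma_finite) integral_pair_mult:
  fixes f :: "'a \<Rightarrow> complex"
  assumes f: "integrable M1 f" and g: "integrable M2 g"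
  shows "(\<integral>(x, y). f x * g y \<partial>(M1 \<Otimes>\<^sub>M M2)) = (\<integral>x. f x \<partial>M1) * (\<integral>y. g y \<partial>M2)"
proof -
  have "(\<integral>x. (\<integral>y. f x * g y \<partial>M2) \<partial>M1) = (\<integral>(x, y). f x * g y \<partial>(M1 \<Otimes>\<^sub>M M2))"
    using integral_fst[OF integrable_pair_mult[OF f g]] by simp
  then show ?thesis by simp
qed

text \<open>Dynkin's argument: rectangles form an intersection-stable generator, and the sets over
  which \<open>f\<close> integrates to 0 are closed under complements and disjoint countable unions.
  A function with vanishing integral over every measurable set is 0 almost everywhere.\<close>

lemma (in pair_sigma_finite) rectangles_imp_AE_zero:
  fixes f :: "'a \<times> 'b \<Rightarrow> complex"
  assumes f: "integrable (M1 \<Otimes>\<^sub>M M2) f"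
    and rect: "\<And>A B. A \<in> sets M1 \<Longrightarrow> B \<in> sets M2 \<Longrightarrow> set_lebesgue_integral (M1 \<Otimes>\<^sub>M M2) (A \<times> B) f = 0"
  shows "AE z in M1 \<Otimes>\<^sub>M M2. f z = 0"
proof -
  let ?M = "M1 \<Otimes>\<^sub>M M2"
  let ?G = "{A \<times> B | A B. A \<in> sets M1 \<and> B \<in> sets M2}"
  have si: "set_integrable ?M S f" if "S \<in> sets ?M" for S
    unfolding set_integrable_def using that f by (intro integrable_mult_indicator)
  \<comment> \<open>The whole space is itself a rectangle; this is what makes the complement step
    work.\<close>
  have \<Omega>: "set_lebesgue_integral ?M (space M1 \<times> space M2) f = 0" by (rule rect) auto
  have zero: "set_lebesgue_integral ?M S f = 0" if "S \<in> sets ?M" for S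
    using Int_stable_pair_measure_generator pair_measure_closed that[unfolded sets_pair_measure]
  proof (induction rule: sigma_sets_induct_disjoint)
    case (basic A) then show ?case using rect by auto
  next
    case empty show ?case by (simp add: set_lebesgue_integral_def)
  next
    case (compl A)
    then have A: "A \<in> sets ?M" by (simp add: sets_pair_measure)
    then have "A \<subseteq> space M1 \<times> space M2" using sets.sets_into_space by (fastforce simp: space_pair_measure)
    then have "set_lebesgue_integral ?M (A \<union> (space M1 \<times> space M2 - A)) f = set_lebesgue_integral ?M (space M1 \<times> space M2) f"
      by (simp add: Un_absorb1)
    moreover have "set_lebesgue_integral ?M (A \<union> (space M1 \<times> space M2 - A)) f =
        set_lebesgue_integral ?M A f + set_lebesgue_integral ?M (space M1 \<times> space M2 - A) f"
      by (intro set_integral_Un si A sets.Diff pair_measureI sets.top) auto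
    ultimately show ?case using compl \<Omega> by simp
  next
    case (union A)
    then have A: "A i \<in> sets ?M" for i by (auto simp: sets_pair_measure)
    have "set_lebesgue_integral ?M (\<Union>(range A)) f = (\<Sum>i. set_lebesgue_integral ?M (A i) f)"
    proof (rule lebesgue_integral_countable_add)
      show "set_integrable ?M (\<Union> (range A)) f" using A by (intro si) auto
      show "A i \<inter> A j = {}" if "i \<noteq> j" for i j
        using union(1) that by (auto simp: disjoint_family_on_def)
    qed (rule A)
    then show ?case using union by simp
  qed
  show ?thesis
  proof (rule P.density_unique_banach[OF f])
    show "set_lebesgue_integral ?M A f = set_lebesgue_integral ?M A (\<lambda>z. 0)" if "A \<in> sets ?M" for A
      unfolding zero[OF that] by (simp add: set_lebesgue_integral_def)
  qed simp
qed

abbreviation "lborel2 \<equiv> lborel \<Otimes>\<^sub>M lborel"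

text \<open>Integral kernel of the rank one operator \<open>|f><g|\<close>. Consequently
  \<open>inner2 lborel2 (tens f g) k\<close> is the sesquilinear form \<open><f, T g>\<close> of the
  operator \<open>T\<close> with kernel \<open>k\<close>.\<close>

definition tens :: "('a \<Rightarrow> complex) \<Rightarrow> ('a \<Rightarrow> complex) \<Rightarrow> 'a \<times> 'a \<Rightarrow> complex" where
  "tens f g = (\<lambda>(x, y). f x * cnj (g y))"

lemma
  fixes f g :: "'a::euclidean_space \<Rightarrow> complex"
  assumes f: "sq_int lborel f" and g: "sq_int lborel g"
  shows sq_int_tens: "sq_int lborel2 (tens f g)"
    and inner2_tens: "\<And>f' g'. sq_int lborel f' \<Longrightarrow> sq_int lborel g' \<Longrightarrow>
      inner2 lborel2 (tens f g) (tens f' g') = inner2 lborel f f' * inner2 lborel g' g"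
proof -
  have [measurable]: "f \<in> borel_measurable lborel" "g \<in> borel_measurable lborel"
    using f g by (auto simp: sq_int_def)
  have "integrable lborel2 (\<lambda>(x, y). (norm (f x))\<^sup>2 * (norm (g y))\<^sup>2)"
    using f g by (intro lborel_pair.integrable_pair_mult) (auto simp: sq_int_def)
  then show "sq_int lborel2 (tens f g)"
    unfolding sq_int_def tens_def by (simp add: norm_mult power_mult_distrib case_prod_beta')
  fix f' g' :: "'a \<Rightarrow> complex" assume f': "sq_int lborel f'" and g': "sq_int lborel g'"
  have "inner2 lborel2 (tens f g) (tens f' g') = (\<integral>(x, y). (cnj (f x) * f' x) * (cnj (g' y) * g y) \<partial>lborel2)"
    unfolding inner2_def tens_def by (intro Bochner_Integration.integral_cong) (auto simp: mult_ac)
  also have "\<dots> = inner2 lborel f f' * inner2 lborel g' g"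
    unfolding inner2_def by (intro lborel_pair.integral_pair_mult integrable_inner2 f g f' g')
  finally show "inner2 lborel2 (tens f g) (tens f' g') = inner2 lborel f f' * inner2 lborel g' g" .
qed

text \<open>Pythagoras: orthonormality of the second factors makes the summands orthogonal, whatever
  the \<open>b n\<close> are.\<close>

lemma norm2_sum_tens:
  fixes b e :: "nat \<Rightarrow> 'a::euclidean_space \<Rightarrow> complex"
  assumes e: "\<And>n. sq_int lborel (e n)" "\<And>m n. inner2 lborel (e m) (e n) = (if m = n then 1 else 0)"
    and b: "\<And>n. sq_int lborel (b n)" and I: "finite I"
  shows "(norm2 lborel2 (\<lambda>z. \<Sum>n\<in>I. tens (b n) (e n) z))\<^sup>2 = (\<Sum>n\<in>I. (norm2 lborel (b n))\<^sup>2)"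
proof -
  have t: "sq_int lborel2 (tens (b n) (e n))" for n by (intro sq_int_tens b e)
  have "complex_of_real ((norm2 lborel2 (\<lambda>z. \<Sum>n\<in>I. tens (b n) (e n) z))\<^sup>2) =
      (\<Sum>m\<in>I. \<Sum>n\<in>I. inner2 lborel2 (tens (b m) (e m)) (tens (b n) (e n)))"
    unfolding inner2_self[symmetric] using t by (simp add: inner2_sum_left inner2_sum_right sq_int_sum)
  also have "\<dots> = (\<Sum>m\<in>I. \<Sum>n\<in>I. if n = m then inner2 lborel (b m) (b n) else 0)"
    by (intro sum.cong refl) (simp add: inner2_tens b e)
  also have "\<dots> = (\<Sum>m\<in>I. of_real ((norm2 lborel (b m))\<^sup>2))"
    using I by (simp add: inner2_self)
  finally show ?thesis by (simp only: of_real_sum[symmetric] of_real_eq_iff)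
qed

text \<open>With \<open>b n\<close> in the role of \<open>B (e n)\<close>, the series of
  \<open>tens (b n) (e n)\<close> converges in L2 by Pythagoras, and its limit is the kernel of
  \<open>B\<close>. The last conclusion is how the kernel is identified later.\<close>

lemma hilbert_schmidt_kernel:
  fixes b e :: "nat \<Rightarrow> 'a::euclidean_space \<Rightarrow> complex"
  assumes e: "\<And>n. sq_int lborel (e n)" "\<And>m n. inner2 lborel (e m) (e n) = (if m = n then 1 else 0)"
    and b: "\<And>n. sq_int lborel (b n)" and s: "summable (\<lambda>n. (norm2 lborel (b n))\<^sup>2)"
  obtains k where "sq_int lborel2 k" "norm2 lborel2 k = sqrt (\<Sum>n. (norm2 lborel (b n))\<^sup>2)"
    "\<And>f g. sq_int lborel f \<Longrightarrow> sq_int lborel g \<Longrightarrow>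
      (\<lambda>n. inner2 lborel f (b n) * inner2 lborel (e n) g) sums inner2 lborel2 (tens f g) k"
proof -
  let ?M = "lborel2"
  have t: "sq_int ?M (tens (b n) (e n))" for n by (intro sq_int_tens b e)
  define k' where "k' N = (\<lambda>z. \<Sum>n<N. tens (b n) (e n) z)" for N
  have k': "sq_int ?M (k' N)" for N unfolding k'_def by (intro sq_int_sum t)
  have le: "norm2 ?M (\<lambda>z. k' j z - k' i z) = sqrt (\<Sum>n\<in>{i..<j}. (norm2 lborel (b n))\<^sup>2)" if "i \<le> j" for i j
  proof -
    have "(\<lambda>z. k' j z - k' i z) = (\<lambda>z. \<Sum>n\<in>{i..<j}. tens (b n) (e n) z)"
      unfolding k'_def using that by (auto simp: fun_eq_iff lessThan_atLeast0 sum_diff_nat_ivl)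
    then show ?thesis
      using real_sqrt_unique[OF norm2_sum_tens[OF e b, of "{i..<j}"] norm2_nonneg] by simp
  qed
  have cauchy: "\<exists>N. \<forall>i\<ge>N. \<forall>j\<ge>N. norm2 ?M (\<lambda>z. k' i z - k' j z) < r" if r: "r > 0" for r
  proof -
    obtain N where N: "\<And>m n. m \<ge> N \<Longrightarrow> norm (\<Sum>n\<in>{m..<n}. (norm2 lborel (b n))\<^sup>2) < r\<^sup>2"
      using s[unfolded summable_Cauchy, rule_format, of "r\<^sup>2"] r by auto
    have "norm2 ?M (\<lambda>z. k' j z - k' i z) < r" if "i \<ge> N" "i \<le> j" for i j
    proof -
      have "(\<Sum>n\<in>{i..<j}. (norm2 lborel (b n))\<^sup>2) < r\<^sup>2" using N[OF that(1), of j] by simp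
      then show ?thesis unfolding le[OF that(2)] using r real_sqrt_less_iff[of _ "r\<^sup>2"] by simp
    qed
    note * = this
    have "norm2 ?M (\<lambda>z. k' i z - k' j z) < r" if ij: "i \<ge> N" "j \<ge> N" for i j
    proof (cases "i \<le> j")
      case True
      then show ?thesis using *[OF ij(1) True] norm2_minus_commute[of ?M "k' i" "k' j"] by simp
    next
      case False
      then show ?thesis using *[OF ij(2), of i] by simp
    qed
    then show ?thesis by blast
  qed
  obtain k where k: "sq_int ?M k" "(\<lambda>n. norm2 ?M (\<lambda>z. k' n z - k z)) \<longlonglongrightarrow> 0"
    by (rule lborel_pair.P.sq_int_complete[of k', OF k' cauchy])
  have "norm2 ?M (k' N) = sqrt (\<Sum>n<N. (norm2 lborel (b n))\<^sup>2)" for N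
    using le[of 0 N] by (simp add: k'_def lessThan_atLeast0)
  then have "(\<lambda>N. sqrt (\<Sum>n<N. (norm2 lborel (b n))\<^sup>2)) \<longlonglongrightarrow> norm2 ?M k"
    using tendsto_norm2[OF k(2) k' k(1)] by simp
  moreover have "(\<lambda>N. sqrt (\<Sum>n<N. (norm2 lborel (b n))\<^sup>2)) \<longlonglongrightarrow> sqrt (\<Sum>n. (norm2 lborel (b n))\<^sup>2)"
    by (intro tendsto_real_sqrt summable_LIMSEQ s)
  ultimately have "norm2 ?M k = sqrt (\<Sum>n. (norm2 lborel (b n))\<^sup>2)" by (rule LIMSEQ_unique)
  moreover have "(\<lambda>n. inner2 lborel f (b n) * inner2 lborel (e n) g) sums inner2 ?M (tens f g) k"
    if "sq_int lborel f" "sq_int lborel g" for f g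
  proof -
    have "inner2 ?M (tens f g) (k' N) = (\<Sum>n<N. inner2 lborel f (b n) * inner2 lborel (e n) g)" for N
      unfolding k'_def by (subst inner2_sum_right) (simp_all add: sq_int_tens t inner2_tens that b e)
    then show ?thesis
      unfolding sums_def using tendsto_inner2_right[OF k(2) k' k(1) sq_int_tens[OF that]] by simp
  qed
  ultimately show thesis using that k(1) by blast
qed

lemma norm2_tens:
  fixes f g :: "'a::euclidean_space \<Rightarrow> complex"
  assumes "sq_int lborel f" "sq_int lborel g"
  shows "norm2 lborel2 (tens f g) = norm2 lborel f * norm2 lborel g"
proof (rule power2_eq_imp_eq)
  have "complex_of_real ((norm2 lborel2 (tens f g))\<^sup>2) = of_real ((norm2 lborel f)\<^sup>2 * (norm2 lborel g)\<^sup>2)"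
    unfolding of_real_mult inner2_self[symmetric] by (rule inner2_tens[OF assms assms])
  then show "(norm2 lborel2 (tens f g))\<^sup>2 = (norm2 lborel f * norm2 lborel g)\<^sup>2"
    unfolding of_real_eq_iff by (simp add: power_mult_distrib)
qed simp_all

text \<open>
  The assumption \<open>H\<close> identifies the kernel on the left with the weighted Hilbert--Schmidt kernel of \<open>b\<close>
  and \<open>e\<close> by testing both on rectangles; a further weight makes both integrable.
\<close>

lemma weighted_kernel_L1_bound:
  fixes v :: "'a::euclidean_space \<Rightarrow> real" and p q e b :: "nat \<Rightarrow> 'a \<Rightarrow> complex"
  assumes v: "\<And>x. 0 < v x" "\<And>x. v x \<le> 1" "v \<in> borel_measurable borel" "integrable lborel (\<lambda>x. (v x)\<^sup>2)"
    and a: "\<And>n. 0 \<le> a n" "summable a"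
    and p: "\<And>n. sq_int lborel (p n)" "\<And>n. norm2 lborel (p n) = 1"
    and q: "\<And>n. sq_int lborel (q n)" "\<And>n. norm2 lborel (q n) = 1"
    and e: "\<And>n. sq_int lborel (e n)" "\<And>m n. inner2 lborel (e m) (e n) = (if m = n then 1 else 0)"
    and b: "\<And>n. sq_int lborel (b n)" and s: "summable (\<lambda>n. (norm2 lborel (b n))\<^sup>2)"
    and H: "\<And>\<phi> \<psi>. sq_int lborel \<phi> \<Longrightarrow> sq_int lborel \<psi> \<Longrightarrow>
      (\<Sum>n. of_real (a n) * (inner2 lborel \<phi> (p n) * inner2 lborel (q n) \<psi>)) =
      (\<Sum>n. inner2 lborel (\<lambda>x. of_real (v x) * \<phi> x) (b n) * inner2 lborel (e n) (\<lambda>x. of_real (v x) * \<psi> x))"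
  shows "(\<integral>\<^sup>+z. ennreal (norm (\<Sum>n. of_real (a n) * tens (p n) (q n) z)) \<partial>lborel2)
    \<le> ennreal ((\<integral>x. (v x)\<^sup>2 \<partial>lborel) * sqrt (\<Sum>n. (norm2 lborel (b n))\<^sup>2))"
proof -
  let ?M = "lborel2 :: ('a \<times> 'a) measure"
  define V where "V x = complex_of_real (v x)" for x
  have [measurable]: "v \<in> borel_measurable borel" by fact
  have [measurable]: "V \<in> borel_measurable borel" unfolding V_def by measurable
  have V: "sq_int lborel V"
    using v(4) by (simp add: sq_int_def V_def)
  have nV: "norm2 lborel V * norm2 lborel V = (\<integral>x. (v x)\<^sup>2 \<partial>lborel)"
    using norm2_power2[of lborel V] by (simp add: V_def power2_eq_square)
  have Vmult: "sq_int lborel (\<lambda>x. V x * f x)" if "sq_int lborel f" for f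
    by (rule sq_int_bounded_mult[OF that, of _ 1]) (use v in \<open>auto simp: V_def abs_of_pos\<close>)
  define VV where "VV = tens V V"
  have VV: "sq_int ?M VV" "norm2 ?M VV = (\<integral>x. (v x)\<^sup>2 \<partial>lborel)"
    unfolding VV_def by (simp_all add: sq_int_tens norm2_tens V nV)
  have VV_nz: "VV z \<noteq> 0" for z
    using v(1)[of "fst z"] v(1)[of "snd z"] by (simp add: VV_def tens_def V_def case_prod_beta)
  define K where "K n z = of_real (a n) * tens (p n) (q n) z" for n z
  have K: "sq_int ?M (K n)" "norm2 ?M (K n) = a n" for n
    unfolding K_def using a(1)[of n] p q
    by (auto intro!: sq_int_cmult sq_int_tens simp: norm2_cmult norm2_tens)
  \<comment> \<open>The factor \<open>VV\<close> puts each term in L1 with norm at most a constant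
    times \<open>a n\<close>, so the series can be integrated term by term and the rectangle
    criterion applies.\<close>
  define G where "G n z = VV z * K n z" for n z
  have G: "integrable ?M (G n)" for n
    unfolding G_def by (intro integrable_mult_sq VV K)
  have "(\<integral>z. norm (G n z) \<partial>?M) \<le> norm2 ?M VV * a n" for n
    using Cauchy_Schwarz_norm2[OF VV(1) K(1)[of n]] by (simp add: G_def norm_mult K(2))
  then have sG: "summable (\<lambda>n. \<integral>z. norm (G n z) \<partial>?M)"
    by (intro summable_comparison_test'[OF summable_mult[OF a(2)], of 0]) simp
  have AE_sum: "AE z in ?M. summable (\<lambda>n. norm (G n z))"
    by (rule AE_summable_norm[OF G sG])
  obtain k where k: "sq_int ?M k" "norm2 ?M k = sqrt (\<Sum>n. (norm2 lborel (b n))\<^sup>2)"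
    "\<And>f g. sq_int lborel f \<Longrightarrow> sq_int lborel g \<Longrightarrow>
      (\<lambda>n. inner2 lborel f (b n) * inner2 lborel (e n) g) sums inner2 ?M (tens f g) k"
    by (rule hilbert_schmidt_kernel[OF e b s]) (rule that)
  have bVV: "norm (VV z) \<le> 1" for z
    using v(1)[of "fst z"] v(1)[of "snd z"] v(2)[of "fst z"] v(2)[of "snd z"]
    by (simp add: VV_def tens_def V_def case_prod_beta norm_mult mult_le_one abs_of_pos)
  have VVk: "integrable ?M (\<lambda>z. VV z * k z)" by (intro integrable_mult_sq VV k)
  have VVVVk: "integrable ?M (\<lambda>z. VV z * (VV z * k z))"
    by (intro integrable_mult_sq VV sq_int_bounded_mult[OF k(1), of _ 1] bVV)
       (use VV(1) in \<open>simp add: sq_int_def\<close>)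
  have D1: "integrable ?M (\<lambda>z. \<Sum>n. G n z)"
    by (rule integrable_suminf[OF G AE_sum sG])
  \<comment> \<open>One \<open>VV\<close> is the regularising factor of \<open>G\<close>, the other
    comes from the two weights in \<open>H\<close>. As \<open>VV\<close> has no zeros, the first can
    be cancelled afterwards.\<close>
  have "AE z in ?M. (\<Sum>n. G n z) - VV z * (VV z * k z) = 0"
  proof (rule lborel_pair.rectangles_imp_AE_zero)
    show "integrable ?M (\<lambda>z. (\<Sum>n. G n z) - VV z * (VV z * k z))"
      by (intro Bochner_Integration.integrable_diff D1 VVVVk)
    fix A B :: "'a set" assume A: "A \<in> sets lborel" and B: "B \<in> sets lborel"
    \<comment> \<open>The factor \<open>V\<close> in each test function turns their tensor product
      into the indicator of the rectangle times \<open>VV\<close>, the factor present in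
      \<open>G\<close>.\<close>
    define \<phi> where "\<phi> x = indicator A x * V x" for x
    define \<psi> where "\<psi> x = indicator B x * V x" for x
    have ind: "(indicator C :: 'a \<Rightarrow> complex) \<in> borel_measurable lborel" if "C \<in> sets lborel" for C
      using that by (rule borel_measurable_indicator)
    have \<phi>: "sq_int lborel \<phi>"
      unfolding \<phi>_def by (rule sq_int_bounded_mult[OF V ind[OF A], of 1]) (simp add: indicator_def)
    have \<psi>: "sq_int lborel \<psi>"
      unfolding \<psi>_def by (rule sq_int_bounded_mult[OF V ind[OF B], of 1]) (simp add: indicator_def)
    have tens_eq: "cnj (tens \<phi> \<psi> z) = indicator (A \<times> B) z * VV z" for z
      by (cases z) (simp add: tens_def \<phi>_def \<psi>_def VV_def V_def indicator_def)
    have tens_eq2: "cnj (tens (\<lambda>x. V x * \<phi> x) (\<lambda>x. V x * \<psi> x) z) = indicator (A \<times> B) z * (VV z * VV z)" for z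
      by (cases z) (simp add: tens_def \<phi>_def \<psi>_def VV_def V_def indicator_def)
    define f where "f n z = indicat_real (A \<times> B) z *\<^sub>R G n z" for n z
    have AB: "A \<times> B \<in> sets ?M" using A B by simp
    have f: "integrable ?M (f n)" for n
      unfolding f_def using AB G by (rule integrable_mult_indicator)
    have f_le: "norm (f n z) \<le> norm (G n z)" for n z by (simp add: f_def indicator_def)
    have "(\<integral>z. norm (f n z) \<partial>?M) \<le> (\<integral>z. norm (G n z) \<partial>?M)" for n
      using f G f_le by (intro integral_mono integrable_norm)
    then have sf: "summable (\<lambda>n. \<integral>z. norm (f n z) \<partial>?M)"
      by (intro summable_comparison_test'[OF sG, of 0]) simp
    have AE_f: "AE z in ?M. summable (\<lambda>n. norm (f n z))"
      by (rule AE_summable_norm[OF f sf])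
    have "set_lebesgue_integral ?M (A \<times> B) (\<lambda>z. \<Sum>n. G n z) = (\<integral>z. (\<Sum>n. f n z) \<partial>?M)"
      unfolding set_lebesgue_integral_def f_def
    proof (rule integral_cong_AE)
      show "(\<lambda>z. indicat_real (A \<times> B) z *\<^sub>R (\<Sum>n. G n z)) \<in> borel_measurable ?M"
        using integrable_mult_indicator[OF AB D1] by simp
      show "(\<lambda>z. \<Sum>n. indicat_real (A \<times> B) z *\<^sub>R G n z) \<in> borel_measurable ?M"
        using f unfolding f_def by (intro borel_measurable_suminf) auto
      show "AE z in ?M. indicat_real (A \<times> B) z *\<^sub>R (\<Sum>n. G n z) = (\<Sum>n. indicat_real (A \<times> B) z *\<^sub>R G n z)"
        using AE_sum by eventually_elim (rule suminf_scaleR_right[OF summable_norm_cancel])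
    qed
    also have "\<dots> = (\<Sum>n. \<integral>z. f n z \<partial>?M)"
      by (rule integral_suminf[OF f AE_f sf])
    also have "(\<lambda>n. \<integral>z. f n z \<partial>?M) = (\<lambda>n. of_real (a n) * (inner2 lborel \<phi> (p n) * inner2 lborel (q n) \<psi>))"
    proof
      fix n
      have "f n z = of_real (a n) * (cnj (tens \<phi> \<psi> z) * tens (p n) (q n) z)" for z
        unfolding tens_eq by (simp add: f_def G_def K_def indicator_def)
      then have "(\<integral>z. f n z \<partial>?M) = of_real (a n) * inner2 ?M (tens \<phi> \<psi>) (tens (p n) (q n))"
        by (simp add: inner2_def)
      then show "(\<integral>z. f n z \<partial>?M) = of_real (a n) * (inner2 lborel \<phi> (p n) * inner2 lborel (q n) \<psi>)"
        by (simp add: inner2_tens \<phi> \<psi> p q)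
    qed
    also have "(\<Sum>n. of_real (a n) * (inner2 lborel \<phi> (p n) * inner2 lborel (q n) \<psi>)) =
        (\<Sum>n. inner2 lborel (\<lambda>x. V x * \<phi> x) (b n) * inner2 lborel (e n) (\<lambda>x. V x * \<psi> x))"
      unfolding V_def by (rule H[OF \<phi> \<psi>])
    also have "\<dots> = inner2 ?M (tens (\<lambda>x. V x * \<phi> x) (\<lambda>x. V x * \<psi> x)) k"
      by (rule sums_unique[symmetric]) (intro k(3) Vmult \<phi> \<psi>)
    also have "\<dots> = set_lebesgue_integral ?M (A \<times> B) (\<lambda>z. VV z * (VV z * k z))"
      unfolding inner2_def tens_eq2 set_lebesgue_integral_def
      by (intro Bochner_Integration.integral_cong) (auto simp: indicator_def)
    finally show "set_lebesgue_integral ?M (A \<times> B) (\<lambda>z. (\<Sum>n. G n z) - VV z * (VV z * k z)) = 0"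
      using D1 VVVVk AB by (subst set_integral_diff) (auto simp: set_integrable_def intro!: integrable_mult_indicator)
  qed
  with AE_sum have "AE z in ?M. (\<Sum>n. K n z) = VV z * k z"
  proof eventually_elim
    case (elim z)
    from summable_norm_cancel[OF elim(1)] have "summable (\<lambda>n. K n z)"
      unfolding G_def using VV_nz[of z] by (simp add: summable_cmult_iff)
    from suminf_mult[OF this, of "VV z"] elim(2) have "VV z * (\<Sum>n. K n z) = VV z * (VV z * k z)"
      by (simp add: G_def)
    then show ?case using VV_nz[of z] by simp
  qed
  then have "(\<integral>\<^sup>+z. ennreal (norm (\<Sum>n. K n z)) \<partial>?M) = (\<integral>\<^sup>+z. ennreal (norm (VV z * k z)) \<partial>?M)"
    by (intro nn_integral_cong_AE) (auto elim: eventually_mono)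
  also have "\<dots> = ennreal (\<integral>z. norm (VV z * k z) \<partial>?M)"
    using VVk by (intro nn_integral_eq_integral) auto
  \<comment> \<open>The norm of \<open>VV\<close> is the integral of \<open>(v x)\<^sup>2\<close>:
    each variable contributes the square root of that integral.\<close>
  also have "\<dots> \<le> ennreal ((\<integral>x. (v x)\<^sup>2 \<partial>lborel) * sqrt (\<Sum>n. (norm2 lborel (b n))\<^sup>2))"
    using Cauchy_Schwarz_norm2[OF VV(1) k(1)] by (intro ennreal_leI) (simp add: norm_mult VV(2) k(2))
  finally show ?thesis by (simp add: K_def)
qed

section \<open>Unitary operators and singular value decompositions\<close>

lemma sq_int_cong_AE:
  assumes "AE x in M. f x = g x" "sq_int M f" "g \<in> borel_measurable M"
  shows "sq_int M g"
proof -
  have "integrable M (\<lambda>x. (norm (g x))\<^sup>2) \<longleftrightarrow> integrable M (\<lambda>x. (norm (f x))\<^sup>2)"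
    using assms by (intro integrable_cong_AE) (auto simp: sq_int_def)
  then show ?thesis using assms by (simp add: sq_int_def)
qed

lemma inner2_cong_AE_right:
  "AE x in M. g x = g' x \<Longrightarrow> sq_int M f \<Longrightarrow> sq_int M g \<Longrightarrow> sq_int M g' \<Longrightarrow> inner2 M f g = inner2 M f g'"
  by (rule inner2_cong_AE) simp_all

lemma inner2_cong_AE_left:
  "AE x in M. f x = f' x \<Longrightarrow> sq_int M f \<Longrightarrow> sq_int M f' \<Longrightarrow> sq_int M g \<Longrightarrow> inner2 M f g = inner2 M f' g"
  by (rule inner2_cong_AE) simp_all

text \<open>Surjectivity is up to null sets because the operators are chosen on representatives.
  Preserving inner products already forces linearity almost everywhere.\<close>

definition l2_unitary :: "wave_op \<Rightarrow> bool" where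
  "l2_unitary V \<longleftrightarrow> (\<forall>f. sq_int lborel f \<longrightarrow> sq_int lborel (V f)) \<and>
    (\<forall>f g. sq_int lborel f \<longrightarrow> sq_int lborel g \<longrightarrow> inner2 lborel (V f) (V g) = inner2 lborel f g) \<and>
    (\<forall>g. sq_int lborel g \<longrightarrow> (\<exists>f. sq_int lborel f \<and> (AE x in lborel. V f x = g x)))"

lemma l2_unitaryD:
  assumes "l2_unitary V"
  shows "sq_int lborel f \<Longrightarrow> sq_int lborel (V f)"
    and "sq_int lborel f \<Longrightarrow> sq_int lborel g \<Longrightarrow> inner2 lborel (V f) (V g) = inner2 lborel f g"
  using assms by (auto simp: l2_unitary_def)

lemma l2_unitary_surj:
  assumes "l2_unitary V" "sq_int lborel g"
  obtains f where "sq_int lborel f" "AE x in lborel. V f x = g x"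
  using assms by (auto simp: l2_unitary_def)

lemma l2_unitary_norm:
  assumes "l2_unitary V" "sq_int lborel f"
  shows "norm2 lborel (V f) = norm2 lborel f"
proof (rule power2_eq_imp_eq)
  have "complex_of_real ((norm2 lborel (V f))\<^sup>2) = of_real ((norm2 lborel f)\<^sup>2)"
    unfolding inner2_self[symmetric] using assms by (simp add: l2_unitaryD)
  then show "(norm2 lborel (V f))\<^sup>2 = (norm2 lborel f)\<^sup>2" by (simp only: of_real_eq_iff)
qed simp_all

text \<open>An operator on representatives need not respect null sets by construction. Here it does:
  every test function is almost everywhere some \<open>V h0\<close>, and inner products with
  \<open>V h0\<close> reduce to inner products with \<open>h0\<close>.\<close>

lemma l2_unitary_AE_iff:
  assumes V: "l2_unitary V" and f: "sq_int lborel f" and g: "sq_int lborel g"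
  shows "(AE x in lborel. V f x = V g x) \<longleftrightarrow> (AE x in lborel. f x = g x)"
proof
  assume ae: "AE x in lborel. V f x = V g x"
  show "AE x in lborel. f x = g x"
  proof (rule inner2_eq_imp_AE[OF f g])
    fix h :: wave assume h: "sq_int lborel h"
    show "inner2 lborel h f = inner2 lborel h g"
      using inner2_cong_AE_right[OF ae, of "V h"] l2_unitaryD[OF V] f g h by simp
  qed
next
  assume ae: "AE x in lborel. f x = g x"
  show "AE x in lborel. V f x = V g x"
  proof (rule inner2_eq_imp_AE)
    fix h :: wave assume h: "sq_int lborel h"
    obtain h0 where h0: "sq_int lborel h0" "AE x in lborel. V h0 x = h x"
      using l2_unitary_surj[OF V h] .
    have "inner2 lborel h (V f') = inner2 lborel h0 f'" if "sq_int lborel f'" for f'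
      using inner2_cong_AE_left[OF h0(2), of "V f'"] l2_unitaryD[OF V] h0(1) h that by simp
    then show "inner2 lborel h (V f) = inner2 lborel h (V g)"
      using inner2_cong_AE_right[OF ae h0(1) f g] f g by simp
  qed (use l2_unitaryD[OF V] f g in auto)
qed

lemma l2_unitary_id: "l2_unitary (\<lambda>f. f)"
  by (auto simp: l2_unitary_def)

lemma l2_unitary_l2_fourier: "l2_unitary l2_fourier"
  unfolding l2_unitary_def using l2_fourier_surj
  by (auto simp: sq_int_l2_fourier inner2_l2_fourier)

text \<open>Surjectivity of the transform provides the witness for the choice in
  \<open>fmult\<close>.\<close>

lemma fmult_spec:
  assumes "sq_int lborel (\<lambda>\<xi>. m \<xi> * l2_fourier f \<xi>)"
  shows "sq_int lborel (fmult m f)" "AE \<xi> in lborel. l2_fourier (fmult m f) \<xi> = m \<xi> * l2_fourier f \<xi>"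
proof -
  obtain g where "sq_int lborel g" "AE \<xi> in lborel. l2_fourier g \<xi> = m \<xi> * l2_fourier f \<xi>"
    using l2_fourier_surj[OF assms] .
  then have "g \<in> L2 \<and> ae_eq (l2_fourier g) (\<lambda>\<xi>. m \<xi> * l2_fourier f \<xi>)"
    by (simp add: L2_iff ae_eq_def)
  then have "fmult m f \<in> L2 \<and> ae_eq (l2_fourier (fmult m f)) (\<lambda>\<xi>. m \<xi> * l2_fourier f \<xi>)"
    unfolding fmult_def by (rule someI[where P = "\<lambda>g. g \<in> L2 \<and> ae_eq (l2_fourier g) (\<lambda>\<xi>. m \<xi> * l2_fourier f \<xi>)"])
  then show "sq_int lborel (fmult m f)" "AE \<xi> in lborel. l2_fourier (fmult m f) \<xi> = m \<xi> * l2_fourier f \<xi>"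
    by (simp_all add: L2_iff ae_eq_def)
qed

lemma propagator_spec:
  assumes f: "sq_int lborel f"
  shows "sq_int lborel (propagator h t f)"
    "AE \<xi> in lborel. l2_fourier (propagator h t f) \<xi> = cis (- (t * h * (norm \<xi>)\<^sup>2 / 2)) * l2_fourier f \<xi>"
proof -
  have "sq_int lborel (\<lambda>\<xi>. cis (- (t * h * (norm \<xi>)\<^sup>2 / 2)) * l2_fourier f \<xi>)"
    by (rule sq_int_cis_mult[OF sq_int_l2_fourier[OF f]]) simp
  then show "sq_int lborel (propagator h t f)"
    "AE \<xi> in lborel. l2_fourier (propagator h t f) \<xi> = cis (- (t * h * (norm \<xi>)\<^sup>2 / 2)) * l2_fourier f \<xi>"
    unfolding propagator_def by (rule fmult_spec)+
qed

text \<open>On the Fourier side it is multiplication by a unimodular function; preimages come from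
  the opposite phase.\<close>

lemma l2_unitary_propagator: "l2_unitary (propagator h t)"
  unfolding l2_unitary_def
proof (intro conjI allI impI)
  let ?U = "propagator h t" and ?m = "\<lambda>\<xi>::R3. cis (- (t * h * (norm \<xi>)\<^sup>2 / 2))"
  note F = l2_unitaryD[OF l2_unitary_l2_fourier]
  show U: "sq_int lborel (?U f)" if "sq_int lborel f" for f
    by (rule propagator_spec(1)[OF that])
  have mF: "sq_int lborel (\<lambda>\<xi>. ?m \<xi> * l2_fourier f \<xi>)" if "sq_int lborel f" for f
    by (rule sq_int_cis_mult[OF F(1)[OF that]]) simp
  show "inner2 lborel (?U f) (?U g) = inner2 lborel f g" if f: "sq_int lborel f" and g: "sq_int lborel g" for f g
  proof -
    have "inner2 lborel (?U f) (?U g) = inner2 lborel (l2_fourier (?U f)) (l2_fourier (?U g))"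
      by (rule F(2)[symmetric]) (intro U f g)+
    also have "\<dots> = inner2 lborel (\<lambda>\<xi>. ?m \<xi> * l2_fourier f \<xi>) (\<lambda>\<xi>. ?m \<xi> * l2_fourier g \<xi>)"
      by (intro inner2_cong_AE propagator_spec(2) F(1) U mF f g)
    also have "\<dots> = inner2 lborel (l2_fourier f) (l2_fourier g)"
    proof -
      have "cnj (cis r * z) * (cis r * w) = cnj z * w" for r z w
      proof -
        have "cnj (cis r * z) * (cis r * w) = (cnj (cis r) * cis r) * (cnj z * w)"
          by (simp only: complex_cnj_mult mult_ac)
        also have "cnj (cis r) * cis r = 1" by (simp add: cis_cnj cis_mult)
        finally show ?thesis by simp
      qed
      then show ?thesis unfolding inner2_def by (simp only:)
    qed
    also have "\<dots> = inner2 lborel f g" by (rule F(2)[OF f g])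
    finally show ?thesis .
  qed
  fix g :: wave assume g: "sq_int lborel g"
  have "sq_int lborel (\<lambda>\<xi>. cis (t * h * (norm \<xi>)\<^sup>2 / 2) * l2_fourier g \<xi>)"
    by (rule sq_int_cis_mult[OF F(1)[OF g]]) simp
  then obtain f where f: "sq_int lborel f" "AE \<xi> in lborel. l2_fourier f \<xi> = cis (t * h * (norm \<xi>)\<^sup>2 / 2) * l2_fourier g \<xi>"
    by (rule l2_fourier_surj)
  have "AE \<xi> in lborel. l2_fourier (?U f) \<xi> = l2_fourier g \<xi>"
    using propagator_spec(2)[OF f(1), of h t] f(2)
    by eventually_elim (simp add: cis_mult flip: mult.assoc)
  then have "AE x in lborel. ?U f x = g x"
    using l2_unitary_AE_iff[OF l2_unitary_l2_fourier U[OF f(1)] g] by simp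
  with f(1) show "\<exists>f. sq_int lborel f \<and> (AE x in lborel. ?U f x = g x)" by blast
qed

text \<open>Any preimage of \<open>g\<close> under \<open>U\<close> satisfies the condition in
  \<open>adj_op\<close>, so the choice there is not vacuous.\<close>

lemma adj_op_unitary:
  assumes U: "l2_unitary U" and g: "sq_int lborel g"
  shows "sq_int lborel (adj_op U g)"
    "\<And>f. sq_int lborel f \<Longrightarrow> inner2 lborel (adj_op U g) f = inner2 lborel g (U f)"
proof -
  obtain h where h: "sq_int lborel h" "AE x in lborel. U h x = g x"
    using l2_unitary_surj[OF U g] .
  have "h \<in> L2 \<and> (\<forall>f\<in>L2. l2inner h f = l2inner g (U f))"
    unfolding L2_iff l2inner_eq Ball_def
    using inner2_cong_AE_left[OF h(2) l2_unitaryD(1)[OF U h(1)] g l2_unitaryD(1)[OF U]] l2_unitaryD(2)[OF U h(1)] h(1)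
    by auto
  then have "adj_op U g \<in> L2 \<and> (\<forall>f\<in>L2. l2inner (adj_op U g) f = l2inner g (U f))"
    unfolding adj_op_def by (rule someI[where P = "\<lambda>h. h \<in> L2 \<and> (\<forall>f\<in>L2. l2inner h f = l2inner g (U f))"])
  then show "sq_int lborel (adj_op U g)"
    "\<And>f. sq_int lborel f \<Longrightarrow> inner2 lborel (adj_op U g) f = inner2 lborel g (U f)"
    by (auto simp: L2_iff l2inner_eq)
qed

lemma adj_op_unitary_left_inverse:
  assumes U: "l2_unitary U" and f: "sq_int lborel f"
  shows "AE x in lborel. adj_op U (U f) x = f x"
proof (rule inner2_eq_imp_AE)
  note Uf = l2_unitaryD(1)[OF U f]
  fix h :: wave assume h: "sq_int lborel h"
  show "inner2 lborel h (adj_op U (U f)) = inner2 lborel h f"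
    using adj_op_unitary(2)[OF U Uf h] l2_unitaryD(2)[OF U f h] inner2_commute[of lborel h] by simp
qed (use adj_op_unitary(1)[OF U l2_unitaryD(1)[OF U f]] f in auto)

section \<open>Bounded operators modulo null sets and weak series expansions\<close>

lemma bounded_opD:
  assumes A: "bounded_op A"
  shows "sq_int lborel f \<Longrightarrow> sq_int lborel (A f)"
    and "sq_int lborel f \<Longrightarrow> sq_int lborel g \<Longrightarrow> AE x in lborel. A (\<lambda>x. f x + g x) x = A f x + A g x"
    and "sq_int lborel f \<Longrightarrow> AE x in lborel. A (\<lambda>x. c * f x) x = c * A f x"
  using A unfolding bounded_op_def L2_iff ae_eq_def Ball_def by blast+

lemma bounded_op_bound:
  assumes A: "bounded_op A"
  obtains C where "C \<ge> 0" "\<And>f. sq_int lborel f \<Longrightarrow> norm2 lborel (A f) \<le> C * norm2 lborel f"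
proof -
  obtain C where C: "\<And>f. f \<in> L2 \<Longrightarrow> l2norm (A f) \<le> ennreal C * l2norm f"
    using A unfolding bounded_op_def by blast
  have "norm2 lborel (A f) \<le> max C 0 * norm2 lborel f" if f: "sq_int lborel f" for f
  proof -
    have "ennreal (norm2 lborel (A f)) \<le> ennreal C * ennreal (norm2 lborel f)"
      using C[of f] f bounded_opD(1)[OF A f] by (simp add: L2_iff l2norm_eq)
    also have "\<dots> \<le> ennreal (max C 0) * ennreal (norm2 lborel f)"
      by (intro mult_right_mono ennreal_leI) auto
    also have "\<dots> = ennreal (max C 0 * norm2 lborel f)" by (simp add: ennreal_mult)
    finally show ?thesis by (simp add: ennreal_le_iff)
  qed
  then show thesis using that[of "max C 0"] by simp
qed

lemma bounded_op_diff:
  assumes A: "bounded_op A" and f: "sq_int lborel f" and g: "sq_int lborel g"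
  shows "AE x in lborel. A (\<lambda>x. f x - g x) x = A f x - A g x"
proof -
  have "AE x in lborel. A f x = A (\<lambda>x. f x - g x) x + A g x"
    using bounded_opD(2)[OF A sq_int_diff[OF f g] g] by simp
  then show ?thesis by eventually_elim simp
qed

text \<open>The difference of two representatives has norm 0, so by boundedness its image has norm 0
  as well.\<close>

lemma bounded_op_cong_AE:
  assumes A: "bounded_op A" and f: "sq_int lborel f" and g: "sq_int lborel g"
    and ae: "AE x in lborel. f x = g x"
  shows "AE x in lborel. A f x = A g x"
proof -
  obtain C where C: "C \<ge> 0" "\<And>f. sq_int lborel f \<Longrightarrow> norm2 lborel (A f) \<le> C * norm2 lborel f"
    by (rule bounded_op_bound[OF A]) (rule that)
  have d: "sq_int lborel (\<lambda>x. f x - g x)" by (rule sq_int_diff[OF f g])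
  have "norm2 lborel (\<lambda>x. f x - g x) = 0" using ae norm2_eq_0_iff[OF d] by simp
  then have "norm2 lborel (A (\<lambda>x. f x - g x)) = 0"
    using C(2)[OF d] norm2_nonneg[of lborel "A (\<lambda>x. f x - g x)"] by simp
  then have "AE x in lborel. A (\<lambda>x. f x - g x) x = 0"
    using norm2_eq_0_iff[OF bounded_opD(1)[OF A d]] by simp
  then show ?thesis using bounded_op_diff[OF A f g] by eventually_elim simp
qed

lemma bounded_op_sum:
  assumes A: "bounded_op A" and f: "\<And>n. sq_int lborel (f n)"
  shows "AE x in lborel. A (\<lambda>x. \<Sum>n<(N::nat). c n * f n x) x = (\<Sum>n<N. c n * A (f n) x)"
proof (induction N)
  case 0
  \<comment> \<open>Homogeneity with the scalar 0 is the source of \<open>A 0 = 0\<close>.\<close>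
  have "AE x in lborel. A (\<lambda>x. 0 * 0) x = 0 * A (\<lambda>x. 0) x"
    using bounded_opD(3)[OF A sq_int_zero, of 0] .
  then show ?case by simp
next
  case (Suc N)
  have s: "sq_int lborel (\<lambda>x. \<Sum>n<N. c n * f n x)" "sq_int lborel (\<lambda>x. c N * f N x)"
    by (intro sq_int_sum sq_int_cmult f)+
  show ?case
    using bounded_opD(2)[OF A s] bounded_opD(3)[OF A f[of N], of "c N"] Suc
    by eventually_elim simp
qed

text \<open>Continuity of \<open>A\<close> carries the convergence of the basis expansion of
  \<open>f\<close> over to \<open>A f\<close>, and then into the inner product with
  \<open>h\<close>.\<close>

lemma inner2_bounded_op_sums:
  assumes A: "bounded_op A" and e: "orthonormal_basis e" and f: "sq_int lborel f" and h: "sq_int lborel h"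
  shows "(\<lambda>n. inner2 lborel h (A (e n)) * inner2 lborel (e n) f) sums inner2 lborel h (A f)"
proof -
  have e1: "sq_int lborel (e n)" for n
    using e by (simp add: orthonormal_basis_def orthonormal_def L2_iff)
  define c where "c n = inner2 lborel (e n) f" for n
  define S where "S N = (\<lambda>x. \<Sum>n<(N::nat). c n * e n x)" for N
  have S: "sq_int lborel (S N)" for N
    unfolding S_def by (intro sq_int_sum sq_int_cmult e1)
  have "(\<lambda>N. l2norm (\<lambda>x. f x - S N x)) \<longlonglongrightarrow> 0"
    using e f unfolding orthonormal_basis_def L2_iff l2inner_eq S_def c_def Ball_def by blast
  then have lim: "(\<lambda>N. norm2 lborel (\<lambda>x. f x - S N x)) \<longlonglongrightarrow> 0"
    by (simp add: l2norm_eq sq_int_diff f S ennreal_tendsto_0_iff)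
  obtain C where C: "C \<ge> 0" "\<And>f. sq_int lborel f \<Longrightarrow> norm2 lborel (A f) \<le> C * norm2 lborel f"
    by (rule bounded_op_bound[OF A]) (rule that)
  note Asq = bounded_opD(1)[OF A]
  have "(\<lambda>N. norm2 lborel (\<lambda>x. A (S N) x - A f x)) \<longlonglongrightarrow> 0"
  proof (rule Lim_null_comparison)
    show "(\<lambda>N. C * norm2 lborel (\<lambda>x. f x - S N x)) \<longlonglongrightarrow> 0"
      by (rule tendsto_mult_right_zero[OF lim])
    have "norm2 lborel (\<lambda>x. A (S N) x - A f x) = norm2 lborel (A (\<lambda>x. f x - S N x))" for N
      unfolding norm2_minus_commute[of lborel "A (S N)"]
      using bounded_op_diff[OF A f S[of N]] Asq[OF f] Asq[OF S[of N]] Asq[OF sq_int_diff[OF f S[of N]]]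
      by (intro norm2_cong_AE) (auto simp: sq_int_def elim: eventually_mono)
    then show "\<forall>\<^sub>F N in sequentially. norm (norm2 lborel (\<lambda>x. A (S N) x - A f x)) \<le> C * norm2 lborel (\<lambda>x. f x - S N x)"
      using C(2)[OF sq_int_diff[OF f S]] by simp
  qed
  from tendsto_inner2_right[OF this Asq[OF S] Asq[OF f] h]
  have "(\<lambda>N. inner2 lborel h (A (S N))) \<longlonglongrightarrow> inner2 lborel h (A f)" .
  moreover have "inner2 lborel h (A (S N)) = (\<Sum>n<N. inner2 lborel h (A (e n)) * inner2 lborel (e n) f)" for N
  proof -
    have sq: "sq_int lborel (\<lambda>x. c n * A (e n) x)" for n by (intro sq_int_cmult Asq e1)
    have "inner2 lborel h (A (S N)) = inner2 lborel h (\<lambda>x. \<Sum>n<N. c n * A (e n) x)"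
      unfolding S_def
      by (intro inner2_cong_AE_right bounded_op_sum[OF A e1] h Asq sq_int_sum sq_int_cmult e1)
    also have "\<dots> = (\<Sum>n<N. inner2 lborel h (A (e n)) * inner2 lborel (e n) f)"
      unfolding inner2_sum_right[OF h sq] inner2_cmult_right by (simp add: c_def mult.commute)
    finally show ?thesis .
  qed
  ultimately show ?thesis by (simp add: sums_def)
qed

lemma svd_sums:
  assumes A: "svd A a u v" and f: "sq_int lborel f" "sq_int lborel (A f)" and h: "sq_int lborel h"
  shows "(\<lambda>n. of_real (a n) * (inner2 lborel h (u n) * inner2 lborel (v n) f)) sums inner2 lborel h (A f)"
proof -
  have u: "sq_int lborel (u n)" for n
    using A by (simp add: svd_def orthonormal_def L2_iff)
  define c where "c n = of_real (a n) * inner2 lborel (v n) f" for n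
  define S where "S N = (\<lambda>x. \<Sum>n<(N::nat). c n * u n x)" for N
  have S: "sq_int lborel (S N)" for N
    unfolding S_def by (intro sq_int_sum sq_int_cmult u)
  have "(\<lambda>N. l2norm (\<lambda>x. A f x - S N x)) \<longlonglongrightarrow> 0"
    using A f unfolding svd_def L2_iff l2inner_eq S_def c_def Ball_def by blast
  then have "(\<lambda>N. norm2 lborel (\<lambda>x. S N x - A f x)) \<longlonglongrightarrow> 0"
    unfolding norm2_minus_commute[of lborel "S _"]
    by (simp add: l2norm_eq sq_int_diff f S ennreal_tendsto_0_iff)
  from tendsto_inner2_right[OF this S f(2) h]
  have "(\<lambda>N. inner2 lborel h (S N)) \<longlonglongrightarrow> inner2 lborel h (A f)" .
  moreover have "inner2 lborel h (S N) = (\<Sum>n<N. of_real (a n) * (inner2 lborel h (u n) * inner2 lborel (v n) f))" for N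
    unfolding S_def inner2_sum_right[OF h sq_int_cmult[OF u]] inner2_cmult_right
    by (simp add: c_def mult_ac)
  ultimately show ?thesis by (simp add: sums_def)
qed

text \<open>The right side involves only inner products and the coefficients, so an operator
  preserving inner products visibly preserves the left side, with no appeal to its
  linearity.\<close>

lemma norm2_diff_sum_sq:
  assumes f: "sq_int M f" and g: "\<And>n. sq_int M (g n)"
  shows "of_real ((norm2 M (\<lambda>x. f x - (\<Sum>n<(N::nat). c n * g n x)))\<^sup>2) =
    inner2 M f f - (\<Sum>n<N. c n * inner2 M f (g n)) - (\<Sum>n<N. cnj (c n) * inner2 M (g n) f)
    + (\<Sum>m<N. \<Sum>n<N. cnj (c m) * (c n * inner2 M (g m) (g n)))"
proof -
  have cg: "sq_int M (\<lambda>x. c n * g n x)" for n by (intro sq_int_cmult g)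
  have S: "sq_int M (\<lambda>x. \<Sum>n<N. c n * g n x)" by (intro sq_int_sum cg)
  have diff_left: "inner2 M (\<lambda>x. f x - h x) k = inner2 M f k - inner2 M h k" if "sq_int M h" "sq_int M k" for h k
    using inner2_diff_right[OF that(2) f that(1)] by (subst (1 2 3) inner2_commute) simp
  have "inner2 M (\<lambda>x. \<Sum>n<N. c n * g n x) (\<lambda>x. \<Sum>n<N. c n * g n x) = (\<Sum>m<N. \<Sum>n<N. cnj (c m) * (c n * inner2 M (g m) (g n)))"
    by (subst inner2_sum_left[OF S cg])
       (simp add: inner2_cmult_left inner2_sum_right[OF g cg] inner2_cmult_right sum_distrib_left)
  moreover have "inner2 M f (\<lambda>x. \<Sum>n<N. c n * g n x) = (\<Sum>n<N. c n * inner2 M f (g n))"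
    by (subst inner2_sum_right[OF f cg]) (simp add: inner2_cmult_right)
  moreover have "inner2 M (\<lambda>x. \<Sum>n<N. c n * g n x) f = (\<Sum>n<N. cnj (c n) * inner2 M (g n) f)"
    by (subst inner2_sum_left[OF f cg]) (simp add: inner2_cmult_left)
  ultimately show ?thesis
    unfolding inner2_self[symmetric]
    by (simp add: diff_left[OF S sq_int_diff[OF f S]] inner2_diff_right[OF f f S] inner2_diff_right[OF S f S])
qed

text \<open>Shows that the evolved operator has a summable decomposition at all, so that the choice
  in \<open>rho_h\<close> is meaningful. Partial sum errors are preserved by
  \<open>norm2_diff_sum_sq\<close>.\<close>

lemma svd_conjugate:
  assumes U: "l2_unitary U" and A: "svd A a u v" "bounded_op A"
  shows "svd (U \<circ> A \<circ> adj_op U) a (\<lambda>n. U (u n)) (\<lambda>n. U (v n))"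
  unfolding svd_def
proof (intro conjI ballI)
  have u: "sq_int lborel (u n)" and v: "sq_int lborel (v n)" for n
    using A by (simp_all add: svd_def orthonormal_def L2_iff)
  show "\<forall>n. 0 \<le> a n" using A by (simp add: svd_def)
  show "orthonormal (\<lambda>n. U (u n))" "orthonormal (\<lambda>n. U (v n))"
    using A l2_unitaryD[OF U] by (simp_all add: svd_def orthonormal_def L2_iff l2inner_eq)
  fix f assume "f \<in> L2"
  then have f: "sq_int lborel f" by (simp add: L2_iff)
  define g where "g = adj_op U f"
  have g: "sq_int lborel g" unfolding g_def by (rule adj_op_unitary(1)[OF U f])
  have Ag: "sq_int lborel (A g)" by (rule bounded_opD(1)[OF A(2) g])
  have vf: "inner2 lborel (U (v n)) f = inner2 lborel (v n) g" for n
    using adj_op_unitary(2)[OF U f v[of n]] by (subst (1 2) inner2_commute) (simp add: g_def)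
  let ?c = "\<lambda>n. complex_of_real (a n) * inner2 lborel (v n) g"
  have "norm2 lborel (\<lambda>x. U (A g) x - (\<Sum>n<N. ?c n * U (u n) x)) = norm2 lborel (\<lambda>x. A g x - (\<Sum>n<N. ?c n * u n x))" for N
  proof (rule power2_eq_imp_eq)
    have "complex_of_real ((norm2 lborel (\<lambda>x. U (A g) x - (\<Sum>n<N. ?c n * U (u n) x)))\<^sup>2) =
        of_real ((norm2 lborel (\<lambda>x. A g x - (\<Sum>n<N. ?c n * u n x)))\<^sup>2)"
      unfolding norm2_diff_sum_sq[OF Ag u] norm2_diff_sum_sq[OF l2_unitaryD(1)[OF U Ag] l2_unitaryD(1)[OF U u]]
      using l2_unitaryD(2)[OF U] Ag u by simp
    then show "(norm2 lborel (\<lambda>x. U (A g) x - (\<Sum>n<N. ?c n * U (u n) x)))\<^sup>2 =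
        (norm2 lborel (\<lambda>x. A g x - (\<Sum>n<N. ?c n * u n x)))\<^sup>2" by (simp only: of_real_eq_iff)
  qed simp_all
  moreover have "sq_int lborel (\<lambda>x. U (A g) x - (\<Sum>n<N. ?c n * U (u n) x))"
    "sq_int lborel (\<lambda>x. A g x - (\<Sum>n<N. ?c n * u n x))" for N
    by (intro sq_int_diff sq_int_sum sq_int_cmult l2_unitaryD(1)[OF U] Ag u)+
  ultimately have eq: "l2norm (\<lambda>x. U (A g) x - (\<Sum>n<N. ?c n * U (u n) x)) = l2norm (\<lambda>x. A g x - (\<Sum>n<N. ?c n * u n x))" for N
    by (simp add: l2norm_eq)
  have "(\<lambda>N. l2norm (\<lambda>x. A g x - (\<Sum>n<N. ?c n * u n x))) \<longlonglongrightarrow> 0"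
    using A(1) g unfolding svd_def l2inner_eq L2_iff Ball_def by blast
  then show "(\<lambda>N. l2norm (\<lambda>x. (U \<circ> A \<circ> adj_op U) f x - (\<Sum>n<N. of_real (a n) * l2inner (U (v n)) f * U (u n) x))) \<longlonglongrightarrow> 0"
    unfolding l2inner_eq vf comp_def g_def[symmetric] eq .
qed

text \<open>
  The density is defined through an arbitrarily chosen decomposition of the evolved operator; pulling
  that decomposition back to \<open>A\<close> avoids showing that the density does not depend on the choice.
\<close>

lemma svd_unconjugate_sums:
  assumes U: "l2_unitary U" and A: "bounded_op A" and s: "svd (U \<circ> A \<circ> adj_op U) a u v"
    and p: "\<And>n. sq_int lborel (p n)" "\<And>n. AE x in lborel. U (p n) x = u n x"
    and q: "\<And>n. sq_int lborel (q n)" "\<And>n. AE x in lborel. U (q n) x = v n x"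
    and f: "sq_int lborel f" and h: "sq_int lborel h"
  shows "(\<lambda>n. of_real (a n) * (inner2 lborel h (p n) * inner2 lborel (q n) f)) sums inner2 lborel h (A f)"
proof -
  have u: "sq_int lborel (u n)" and v: "sq_int lborel (v n)" for n
    using s by (simp_all add: svd_def orthonormal_def L2_iff)
  note Usq = l2_unitaryD(1)[OF U] and Uin = l2_unitaryD(2)[OF U]
  let ?g = "adj_op U (U f)"
  have g: "sq_int lborel ?g" by (rule adj_op_unitary(1)[OF U Usq[OF f]])
  have Af: "sq_int lborel (A f)" "sq_int lborel (A ?g)" by (intro bounded_opD(1)[OF A] f g)+
  \<comment> \<open>The conjugated operator is tested at \<open>U f\<close>. Since
    \<open>adj_op U\<close> undoes \<open>U\<close> only almost everywhere, \<open>A\<close> must be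
    known to respect null sets.\<close>
  have ae: "AE x in lborel. A ?g x = A f x"
    by (rule bounded_op_cong_AE[OF A g f adj_op_unitary_left_inverse[OF U f]])
  have "(\<lambda>n. of_real (a n) * (inner2 lborel (U h) (u n) * inner2 lborel (v n) (U f))) sums inner2 lborel (U h) ((U \<circ> A \<circ> adj_op U) (U f))"
    by (rule svd_sums[OF s]) (simp_all add: Usq f h Af)
  moreover have "inner2 lborel (U h) ((U \<circ> A \<circ> adj_op U) (U f)) = inner2 lborel h (A f)"
    using inner2_cong_AE_right[OF ae h Af(2,1)] by (simp add: Uin h Af)
  moreover have "inner2 lborel (U h) (u n) = inner2 lborel h (p n)" for n
    using inner2_cong_AE_right[OF p(2) Usq[OF h] Usq[OF p(1)] u] by (simp add: Uin h p)
  moreover have "inner2 lborel (v n) (U f) = inner2 lborel (q n) f" for n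
    using inner2_cong_AE_left[OF q(2) Usq[OF q(1)] v Usq[OF f]] by (simp add: Uin f q)
  ultimately show ?thesis by simp
qed

section \<open>Weighted Hilbert--Schmidt norms\<close>

text \<open>A positive real factor is invertible in \<open>ennreal\<close>, so it can be moved to
  the left and back. Positivity also makes the empty infimum give the bound
  \<open>top\<close>.\<close>

lemma ennreal_le_mult_INF:
  assumes c: "0 < c" and le: "\<And>i. i \<in> I \<Longrightarrow> X \<le> ennreal c * f i"
  shows "X \<le> ennreal c * (INF i\<in>I. f i)"
proof -
  have inv: "ennreal (1 / c) * (ennreal c * y) = y" "ennreal c * (ennreal (1 / c) * y) = y" for y
    using c by (simp_all add: ennreal_mult[symmetric] mult.assoc[symmetric])
  have "ennreal (1 / c) * X \<le> (INF i\<in>I. f i)"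
  proof (rule INF_greatest)
    fix i assume "i \<in> I"
    then have "ennreal (1 / c) * X \<le> ennreal (1 / c) * (ennreal c * f i)" by (intro mult_left_mono le) auto
    then show "ennreal (1 / c) * X \<le> f i" unfolding inv .
  qed
  then have "ennreal c * (ennreal (1 / c) * X) \<le> ennreal c * (INF i\<in>I. f i)" by (intro mult_left_mono) auto
  then show ?thesis unfolding inv .
qed

text \<open>
  \<open>V\<close> turns \<open>S\<close> into multiplication by \<open>w\<close>: it is the identity for position weights and the Fourier
  transform for momentum weights. \<open>C\<close> is required to be positive because \<open>0 * \<infinity> = 0\<close>.
\<close>

lemma sandwich_kernel_bound:
  fixes V S :: wave_op and w :: "R3 \<Rightarrow> real"
  assumes V: "l2_unitary V"
    and w: "\<And>x. 1 \<le> w x" "w \<in> borel_measurable borel" "integrable lborel (\<lambda>x. (1 / w x)\<^sup>2)"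
    and C: "0 < C" "(\<integral>x. (1 / w x)\<^sup>2 \<partial>lborel) \<le> C"
    and D: "\<And>f. f \<in> D \<longleftrightarrow> sq_int lborel f \<and> sq_int lborel (\<lambda>x. of_real (w x) * V f x)"
    and S: "\<And>f. f \<in> D \<Longrightarrow> sq_int lborel (S f)"
      "\<And>f. f \<in> D \<Longrightarrow> AE x in lborel. V (S f) x = of_real (w x) * V f x"
    and \<gamma>: "bounded_op \<gamma>" and a: "\<And>n. 0 \<le> a n" "summable a"
    and p: "\<And>n. sq_int lborel (p n)" "\<And>n. norm2 lborel (p n) = 1"
    and q: "\<And>n. sq_int lborel (q n)" "\<And>n. norm2 lborel (q n) = 1"
    and sums: "\<And>f g. sq_int lborel f \<Longrightarrow> sq_int lborel g \<Longrightarrow>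
      (\<lambda>n. of_real (a n) * (inner2 lborel g (p n) * inner2 lborel (q n) f)) sums inner2 lborel g (\<gamma> f)"
    and h: "0 < h"
  shows "(\<integral>\<^sup>+z. ennreal (norm (\<Sum>n. of_real (a n) * tens (V (p n)) (V (q n)) z)) \<partial>lborel2)
    \<le> ennreal (C * (2 * pi * h) powr (-3/2)) * sandwich_hs_norm_h h D S \<gamma>"
    (is "?X \<le> _")
proof -
  note Vsq = l2_unitaryD(1)[OF V] and Vin = l2_unitaryD(2)[OF V] and gsq = bounded_opD(1)[OF \<gamma>]
  define v where "v x = 1 / w x" for x
  have wpos: "0 < w x" for x using w(1)[of x] by linarith
  have v: "0 < v x" "v x \<le> 1" for x
    using wpos[of x] w(1)[of x] by (simp_all add: v_def)
  have [measurable]: "w \<in> borel_measurable borel" by fact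
  have [measurable]: "v \<in> borel_measurable borel" unfolding v_def by measurable
  have vsq: "sq_int lborel (\<lambda>x. of_real (v x) * f x)" if "sq_int lborel f" for f
    by (rule sq_int_bounded_mult[OF that, of _ 1]) (use v in \<open>auto simp: abs_of_pos\<close>)
  have vw: "of_real (v x) * (of_real (w x) * z) = z" "of_real (w x) * (of_real (v x) * z) = z" for x and z :: complex
    using wpos[of x] by (simp_all add: v_def)
  have bound: "?X \<le> ennreal C * ennsqrt (\<Sum>n. (l2norm (B (e n)))\<^sup>2)"
    if B: "bounded_op B" "\<And>f. f \<in> D \<Longrightarrow> \<gamma> (S f) \<in> D \<and> ae_eq (B f) (S (\<gamma> (S f)))"
      and e: "orthonormal_basis e" for B e
  proof (cases "(\<Sum>n. (l2norm (B (e n)))\<^sup>2) = top")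
    \<comment> \<open>An infinite Hilbert--Schmidt sum makes the right side infinite, since
      \<open>C\<close> is positive.\<close>
    case True
    then show ?thesis using C(1) by (simp add: ennsqrt_def ennreal_mult_top)
  next
    case False
    note Bsq = bounded_opD(1)[OF B(1)]
    have e1: "sq_int lborel (e n)" "inner2 lborel (e m) (e n) = (if m = n then 1 else 0)" for m n
      using e by (simp_all add: orthonormal_basis_def orthonormal_def L2_iff l2inner_eq)
    have l2: "(l2norm (B (e n)))\<^sup>2 = ennreal ((norm2 lborel (V (B (e n))))\<^sup>2)" for n
      by (simp add: l2norm_eq Bsq e1 l2_unitary_norm[OF V] ennreal_power)
    have s: "summable (\<lambda>n. (norm2 lborel (V (B (e n))))\<^sup>2)"
      using False unfolding l2 by (intro summable_suminf_not_top) auto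
    \<comment> \<open>Everything is transported by \<open>V\<close>: the orthonormal system is
      \<open>V (e n)\<close> and \<open>b n\<close> is \<open>V (B (e n))\<close>, with the same
      Hilbert--Schmidt sum.\<close>
    have "?X \<le> ennreal ((\<integral>x. (v x)\<^sup>2 \<partial>lborel) * sqrt (\<Sum>n. (norm2 lborel (V (B (e n))))\<^sup>2))"
    proof (rule weighted_kernel_L1_bound[where e = "\<lambda>n. V (e n)"])
      show "integrable lborel (\<lambda>x. (v x)\<^sup>2)" using w(3) by (simp add: v_def)
      fix \<phi> \<psi> :: wave assume \<phi>: "sq_int lborel \<phi>" and \<psi>: "sq_int lborel \<psi>"
      obtain \<phi>0 where \<phi>0: "sq_int lborel \<phi>0" "AE x in lborel. V \<phi>0 x = \<phi> x"
        by (rule l2_unitary_surj[OF V \<phi>])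
      obtain \<psi>0 where \<psi>0: "sq_int lborel \<psi>0" "AE x in lborel. V \<psi>0 x = \<psi> x"
        by (rule l2_unitary_surj[OF V \<psi>])
      obtain k where k: "sq_int lborel k" "AE x in lborel. V k x = of_real (v x) * \<phi> x"
        by (rule l2_unitary_surj[OF V vsq[OF \<phi>]])
      \<comment> \<open>Since \<open>V f\<close> is \<open>v\<close> times \<psi>, multiplication by
        \<open>w\<close> restores \<psi>. Hence \<open>f\<close> lies in \<open>D\<close> and
        \<open>S f\<close> equals \<open>\<psi>0\<close> almost everywhere, so the forms of
        \<open>B\<close> on such functions recover the form of \<gamma> on arbitrary ones.\<close>
      obtain f where f: "sq_int lborel f" "AE x in lborel. V f x = of_real (v x) * \<psi> x"
        by (rule l2_unitary_surj[OF V vsq[OF \<psi>]])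
      have wVf: "AE x in lborel. \<psi> x = of_real (w x) * V f x"
        using f(2) by eventually_elim (simp add: vw)
      have "(\<lambda>x. of_real (w x) * V f x) \<in> borel_measurable lborel"
        using sq_int_measurable[OF Vsq[OF f(1)]]
        by (intro borel_measurable_times borel_measurable_of_real) simp_all
      then have sqwVf: "sq_int lborel (\<lambda>x. of_real (w x) * V f x)"
        by (rule sq_int_cong_AE[OF wVf \<psi>])
      have fD: "f \<in> D" using D f(1) sqwVf by simp
      have Sf: "AE x in lborel. S f x = \<psi>0 x"
        unfolding l2_unitary_AE_iff[OF V S(1)[OF fD] \<psi>0(1), symmetric]
        using S(2)[OF fD] wVf \<psi>0(2) by eventually_elim simp
      have gSf: "AE x in lborel. \<gamma> (S f) x = \<gamma> \<psi>0 x"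
        by (rule bounded_op_cong_AE[OF \<gamma> S(1)[OF fD] \<psi>0(1) Sf])
      have gD: "\<gamma> (S f) \<in> D" and "AE x in lborel. B f x = S (\<gamma> (S f)) x"
        using B(2)[OF fD] by (simp_all add: ae_eq_def)
      then have "AE x in lborel. V (B f) x = V (S (\<gamma> (S f))) x"
        using l2_unitary_AE_iff[OF V Bsq[OF f(1)] S(1)[OF gD]] by simp
      then have VBf: "AE x in lborel. V (B f) x = of_real (w x) * V (\<gamma> (S f)) x"
        using S(2)[OF gD] by eventually_elim simp
      have sqVg: "sq_int lborel (\<lambda>x. of_real (w x) * V (\<gamma> (S f)) x)" using D gD by simp
      \<comment> \<open>In this chain the \<open>v\<close> in \<open>V k\<close> cancels the
        \<open>w\<close> produced by the outer \<open>S\<close>.\<close>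
      have "inner2 lborel k (B f) = inner2 lborel (V k) (V (B f))" by (simp add: Vin k Bsq f)
      also have "\<dots> = inner2 lborel (\<lambda>x. of_real (v x) * \<phi> x) (\<lambda>x. of_real (w x) * V (\<gamma> (S f)) x)"
        by (intro inner2_cong_AE k VBf Vsq Bsq f vsq \<phi> sqVg)
      also have "\<dots> = inner2 lborel \<phi> (V (\<gamma> (S f)))"
      proof -
        have "cnj (of_real (v x) * \<phi> x) * (of_real (w x) * V (\<gamma> (S f)) x) = cnj (\<phi> x) * V (\<gamma> (S f)) x" for x
        proof -
          have "cnj (of_real (v x) * \<phi> x) * (of_real (w x) * V (\<gamma> (S f)) x) =
              cnj (\<phi> x) * (of_real (v x) * (of_real (w x) * V (\<gamma> (S f)) x))" by simp
          then show ?thesis unfolding vw .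
        qed
        then show ?thesis by (simp only: inner2_def)
      qed
      also have "\<dots> = inner2 lborel (V \<phi>0) (V (\<gamma> (S f)))"
        by (rule inner2_cong_AE_left[symmetric]) (intro \<phi>0 \<phi> Vsq gsq S fD)+
      also have "\<dots> = inner2 lborel \<phi>0 (\<gamma> (S f))" by (intro Vin \<phi>0 gsq S fD)
      also have "\<dots> = inner2 lborel \<phi>0 (\<gamma> \<psi>0)" by (intro inner2_cong_AE_right gSf \<phi>0 \<psi>0 gsq S fD)
      finally have eq: "inner2 lborel k (B f) = inner2 lborel \<phi>0 (\<gamma> \<psi>0)" .
      have 1: "inner2 lborel \<phi> (V g) = inner2 lborel \<phi>0 g" if "sq_int lborel g" for g
        using inner2_cong_AE_left[OF \<phi>0(2) Vsq[OF \<phi>0(1)] \<phi> Vsq[OF that]] by (simp add: Vin \<phi>0 that)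
      have 2: "inner2 lborel (V g) \<psi> = inner2 lborel g \<psi>0" if "sq_int lborel g" for g
        using inner2_cong_AE_right[OF \<psi>0(2) Vsq[OF that] Vsq[OF \<psi>0(1)] \<psi>] by (simp add: Vin \<psi>0 that)
      have 3: "inner2 lborel (\<lambda>x. of_real (v x) * \<phi> x) (V g) = inner2 lborel k g" if "sq_int lborel g" for g
        using inner2_cong_AE_left[OF k(2) Vsq[OF k(1)] vsq[OF \<phi>] Vsq[OF that]] by (simp add: Vin k that)
      have 4: "inner2 lborel (V g) (\<lambda>x. of_real (v x) * \<psi> x) = inner2 lborel g f" if "sq_int lborel g" for g
        using inner2_cong_AE_right[OF f(2) Vsq[OF that] Vsq[OF f(1)] vsq[OF \<psi>]] by (simp add: Vin f that)
      have "(\<Sum>n. of_real (a n) * (inner2 lborel \<phi> (V (p n)) * inner2 lborel (V (q n)) \<psi>)) = inner2 lborel \<phi>0 (\<gamma> \<psi>0)"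
        unfolding 1[OF p(1)] 2[OF q(1)] by (rule sums_unique[symmetric]) (rule sums[OF \<psi>0(1) \<phi>0(1)])
      moreover have "(\<Sum>n. inner2 lborel (\<lambda>x. of_real (v x) * \<phi> x) (V (B (e n))) * inner2 lborel (V (e n)) (\<lambda>x. of_real (v x) * \<psi> x)) = inner2 lborel k (B f)"
        unfolding 3[OF Bsq[OF e1(1)]] 4[OF e1(1)]
        by (rule sums_unique[symmetric]) (rule inner2_bounded_op_sums[OF B(1) e f(1) k(1)])
      ultimately show "(\<Sum>n. of_real (a n) * (inner2 lborel \<phi> (V (p n)) * inner2 lborel (V (q n)) \<psi>)) =
        (\<Sum>n. inner2 lborel (\<lambda>x. of_real (v x) * \<phi> x) (V (B (e n))) * inner2 lborel (V (e n)) (\<lambda>x. of_real (v x) * \<psi> x))"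
        using eq by simp
    qed (use v a p q s e1 in \<open>simp_all add: Vsq Vin Bsq l2_unitary_norm[OF V]\<close>)
    also have "\<dots> \<le> ennreal (C * sqrt (\<Sum>n. (norm2 lborel (V (B (e n))))\<^sup>2))"
      using C(2) s by (intro ennreal_leI mult_right_mono) (auto simp: v_def suminf_nonneg)
    also have "\<dots> = ennreal C * ennsqrt (\<Sum>n. (l2norm (B (e n)))\<^sup>2)"
      unfolding l2 using C(1) s by (simp add: suminf_ennreal2 ennsqrt_ennreal suminf_nonneg ennreal_mult)
    finally show ?thesis .
  qed
  have pos: "0 < (2 * pi * h) powr (3/2)" "0 < (2 * pi * h) powr (-3/2)" using h by simp_all
  have "?X \<le> ennreal (C * (2 * pi * h) powr (-3/2)) * hs_norm_h h B"
    if B: "bounded_op B" "\<And>f. f \<in> D \<Longrightarrow> \<gamma> (S f) \<in> D \<and> ae_eq (B f) (S (\<gamma> (S f)))" for B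
  proof -
    have "?X \<le> ennreal C * hs_norm B"
      unfolding hs_norm_def by (rule ennreal_le_mult_INF[OF C(1)]) (use bound[OF B] in blast)
    \<comment> \<open>Undoes the normalisation of \<open>hs_norm_h\<close>.\<close>
    also have "C = C * (2 * pi * h) powr (-3/2) * (2 * pi * h) powr (3/2)"
      using h by (simp add: powr_add[symmetric])
    also have "ennreal \<dots> = ennreal (C * (2 * pi * h) powr (-3/2)) * ennreal ((2 * pi * h) powr (3/2))"
      using C(1) pos by (intro ennreal_mult) auto
    finally show ?thesis by (simp only: hs_norm_h_def mult.assoc)
  qed
  then show ?thesis
    unfolding sandwich_hs_norm_h_def
    by (intro ennreal_le_mult_INF mult_pos_pos C(1) pos(2)) blast
qed

section \<open>Integrability of the inverse squared weight\<close>

lemma bracket_ge_1: "1 \<le> bracket x"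
  unfolding bracket_def by (rule ge_one_powr_ge_zero) auto

lemma measurable_bracket [measurable]: "bracket \<in> borel_measurable borel"
  unfolding bracket_def[abs_def] by measurable

lemma bracket_powr_sq: "(1 / bracket x powr \<sigma>)\<^sup>2 = (1 + (norm x)\<^sup>2) powr (- \<sigma>)"
proof -
  have "0 < 1 + (norm x)\<^sup>2" by (rule add_pos_nonneg) auto
  then show ?thesis
    by (simp add: bracket_def powr_powr powr_minus power_divide powr_power inverse_eq_divide)
qed

text \<open>Comparison on dyadic balls: for the least \<open>k\<close> with
  \<open>norm x \<le> 2 ^ Suc k\<close> the integrand is at most
  \<open>4 powr (- \<sigma> * real k)\<close>, and the ball has volume of order
  \<open>8 ^ k\<close>. The ratio \<open>8 * 4 powr (- \<sigma>)\<close> is below 1 exactly for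
  \<sigma> above 3/2.\<close>

lemma integrable_bracket:
  assumes \<sigma>: "3/2 < \<sigma>"
  shows "integrable lborel (\<lambda>x. (1 / bracket x powr \<sigma>)\<^sup>2)"
proof -
  define r where "r k = 4 powr (- \<sigma> * real k)" for k :: nat
  define u where "u = unit_ball_vol (real DIM(R3))"
  have dom: "ennreal ((1 / bracket x powr \<sigma>)\<^sup>2) \<le> (\<Sum>k. ennreal (r k) * indicator (cball 0 (2 ^ Suc k)) x)" for x
  proof -
    obtain k0 where "norm x < 2 ^ k0" using real_arch_pow[of 2 "norm x"] by auto
    moreover have "(2::real) ^ k0 \<le> 2 ^ Suc k0" by simp
    ultimately have "norm x \<le> 2 ^ Suc k0" by linarith
    then have ex: "\<exists>k. norm x \<le> 2 ^ Suc k" by blast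
    define k where "k = (LEAST k. norm x \<le> 2 ^ Suc k)"
    have k: "norm x \<le> 2 ^ Suc k" unfolding k_def by (rule LeastI_ex[OF ex])
    have "(1 + (norm x)\<^sup>2) powr (- \<sigma>) \<le> (4 ^ k) powr (- \<sigma>)"
    proof (rule powr_mono2')
      \<comment> \<open>For \<open>k = 0\<close> minimality says nothing and the summand 1 gives the
        bound; otherwise minimality gives \<open>norm x > 2 ^ k\<close>.\<close>
      show "(4::real) ^ k \<le> 1 + (norm x)\<^sup>2"
      proof (cases k)
        case (Suc j)
        have "\<not> norm x \<le> 2 ^ Suc j" using not_less_Least[of j "\<lambda>k. norm x \<le> 2 ^ Suc k"] Suc by (simp add: k_def)
        then have "(2 ^ k)\<^sup>2 \<le> (norm x)\<^sup>2" unfolding Suc by (intro power_mono) auto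
        then show ?thesis by (simp add: power_mult[symmetric] mult.commute[of _ 2] power_mult)
      qed simp
    qed (use \<sigma> in auto)
    also have "(4 ^ k) powr (- \<sigma>) = r k"
      by (simp add: r_def powr_realpow[symmetric] powr_powr mult.commute)
    finally have "ennreal ((1 / bracket x powr \<sigma>)\<^sup>2) \<le> ennreal (r k) * indicator (cball 0 (2 ^ Suc k)) x"
      using k by (simp add: bracket_powr_sq ennreal_leI)
    also have "\<dots> \<le> (\<Sum>k. ennreal (r k) * indicator (cball 0 (2 ^ Suc k)) x)"
    proof -
      have "F k \<le> suminf F" for F :: "nat \<Rightarrow> ennreal" using sum_le_suminf[of F "{k}"] by simp
      then show ?thesis .
    qed
    finally show ?thesis .
  qed
  have "(\<integral>\<^sup>+x. ennreal ((1 / bracket x powr \<sigma>)\<^sup>2) \<partial>lborel) \<le>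
      (\<integral>\<^sup>+x. (\<Sum>k. ennreal (r k) * indicator (cball 0 (2 ^ Suc k)) (x::R3)) \<partial>lborel)"
    by (intro nn_integral_mono dom)
  also have "\<dots> = (\<Sum>k. ennreal (r k) * emeasure lborel (cball (0::R3) (2 ^ Suc k)))"
  proof -
    have m: "(indicator (cball 0 R) :: R3 \<Rightarrow> ennreal) \<in> borel_measurable lborel" for R :: real
      by (rule borel_measurable_indicator) simp
    have "(\<lambda>x::R3. ennreal (r k) * indicator (cball 0 (2 ^ Suc k)) x) \<in> borel_measurable lborel" for k
      by (intro borel_measurable_times_ennreal m borel_measurable_const)
    then show ?thesis
      by (subst nn_integral_suminf) (auto simp: nn_integral_cmult[OF m] simp del: power_Suc)
  qed
  also have "\<dots> = (\<Sum>k. ennreal (8 * u * (8 * 4 powr (- \<sigma>)) ^ k))"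
  proof (intro suminf_cong)
    fix k
    have "emeasure lborel (cball (0::R3) (2 ^ Suc k)) = ennreal (u * (2 ^ Suc k) ^ 3)"
      by (simp add: emeasure_cball u_def del: power_Suc)
    then have "ennreal (r k) * emeasure lborel (cball (0::R3) (2 ^ Suc k)) = ennreal (r k * (u * (2 ^ Suc k) ^ 3))"
      by (simp add: ennreal_mult'' r_def u_def)
    also have "r k * (u * (2 ^ Suc k) ^ 3) = 8 * u * (8 * 4 powr (- \<sigma>)) ^ k"
    proof -
      have rk: "r k = (4 powr (- \<sigma>)) ^ k"
        unfolding r_def powr_powr[symmetric] by (rule powr_realpow) simp
      have "((2::real) ^ Suc k) ^ 3 = (2 ^ 3) ^ Suc k" by (simp only: power_mult[symmetric] mult.commute)
      then have "((2::real) ^ Suc k) ^ 3 = 8 * 8 ^ k" by simp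
      then show ?thesis unfolding rk by (simp only: power_mult_distrib mult_ac)
    qed
    finally show "ennreal (r k) * emeasure lborel (cball (0::R3) (2 ^ Suc k)) = ennreal (8 * u * (8 * 4 powr (- \<sigma>)) ^ k)" .
  qed
  also have "\<dots> < \<infinity>"
  proof -
    have "4 powr (- \<sigma>) < 4 powr (- (3/2))" using \<sigma> by (intro powr_less_mono) auto
    also have "(4::real) powr (- (3/2)) = 1 / 8"
    proof -
      have "(4::real) powr (3/2) = (2 powr 2) powr (3/2)" by simp
      also have "\<dots> = 8" unfolding powr_powr by simp
      finally show ?thesis by (simp add: powr_minus inverse_eq_divide)
    qed
    finally have "norm (8 * 4 powr (- \<sigma>)) < 1" by simp
    then have "summable (\<lambda>k. 8 * u * (8 * 4 powr (- \<sigma>)) ^ k)" by (intro summable_mult summable_geometric)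
    then show ?thesis by (simp add: suminf_ennreal2 u_def)
  qed
  finally show ?thesis by (intro integrableI_bounded) auto
qed

section \<open>Fourier transform of the density\<close>

text \<open>By Cauchy--Schwarz the \<open>n\<close>-th term has L1 norm at most \<open>a n\<close>,
  so sum and integral may be exchanged; the unimodular \<theta> does not affect this.\<close>

lemma integrable_trace_series:
  assumes a: "\<And>n. 0 \<le> a n" "summable a"
    and r: "\<And>n. sq_int M (r n)" "\<And>n. norm2 M (r n) = 1"
    and s: "\<And>n. sq_int M (s n)" "\<And>n. norm2 M (s n) = 1"
    and \<theta>: "\<theta> \<in> borel_measurable M" "\<And>x. norm (\<theta> x) = 1"
  defines "f \<equiv> \<lambda>n x. complex_of_real (a n) * (r n x * cnj (s n x))"
  shows "AE x in M. summable (\<lambda>n. f n x)"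
    and "integrable M (\<lambda>x. \<Sum>n. f n x)"
    and "(\<integral>x. \<theta> x * (\<Sum>n. f n x) \<partial>M) = (\<Sum>n. of_real (a n) * (\<integral>x. \<theta> x * (r n x * cnj (s n x)) \<partial>M))"
proof -
  have f: "integrable M (f n)" for n
    unfolding f_def by (intro integrable_mult_right integrable_mult_sq sq_int_cnj r s)
  have "(\<integral>x. norm (f n x) \<partial>M) \<le> a n" for n
  proof -
    have "(\<integral>x. norm (f n x) \<partial>M) = a n * (\<integral>x. norm (r n x) * norm (s n x) \<partial>M)"
      using a(1)[of n] by (simp add: f_def norm_mult)
    also have "\<dots> \<le> a n * (norm2 M (r n) * norm2 M (s n))"
      by (intro mult_left_mono Cauchy_Schwarz_norm2 r s a)
    finally show ?thesis by (simp add: r s)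
  qed
  then have sf: "summable (\<lambda>n. \<integral>x. norm (f n x) \<partial>M)"
    by (intro summable_comparison_test'[OF a(2), of 0]) simp
  have AEf: "AE x in M. summable (\<lambda>n. norm (f n x))" by (rule AE_summable_norm[OF f sf])
  show AE: "AE x in M. summable (\<lambda>n. f n x)"
    using AEf by eventually_elim (rule summable_norm_cancel)
  show int: "integrable M (\<lambda>x. \<Sum>n. f n x)"
    by (rule integrable_suminf[OF f AEf sf])
  have nf: "norm (\<theta> x * f n x) = norm (f n x)" for n x by (simp add: norm_mult \<theta>)
  have \<theta>f: "integrable M (\<lambda>x. \<theta> x * f n x)" for n
    using f[of n] by (rule Bochner_Integration.integrable_bound) (use f[of n] \<theta>(1) nf in \<open>auto\<close>)
  have "(\<integral>x. \<theta> x * (\<Sum>n. f n x) \<partial>M) = (\<integral>x. (\<Sum>n. \<theta> x * f n x) \<partial>M)"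
  proof (rule integral_cong_AE)
    show "(\<lambda>x. \<theta> x * (\<Sum>n. f n x)) \<in> borel_measurable M"
      using int \<theta>(1) by (intro borel_measurable_times) auto
    show "(\<lambda>x. \<Sum>n. \<theta> x * f n x) \<in> borel_measurable M"
      using \<theta>f by (intro borel_measurable_suminf) auto
    show "AE x in M. \<theta> x * (\<Sum>n. f n x) = (\<Sum>n. \<theta> x * f n x)"
      using AE by eventually_elim (simp add: suminf_mult)
  qed
  also have "\<dots> = (\<Sum>n. \<integral>x. \<theta> x * f n x \<partial>M)"
    by (rule integral_suminf[OF \<theta>f]) (simp_all only: nf AEf sf)
  also have "(\<lambda>n. \<integral>x. \<theta> x * f n x \<partial>M) = (\<lambda>n. of_real (a n) * (\<integral>x. \<theta> x * (r n x * cnj (s n x)) \<partial>M))"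
    unfolding f_def integral_mult_right_zero[symmetric] by (simp only: mult.left_commute)
  finally show "(\<integral>x. \<theta> x * (\<Sum>n. f n x) \<partial>M) = (\<Sum>n. of_real (a n) * (\<integral>x. \<theta> x * (r n x * cnj (s n x)) \<partial>M))" .
qed

text \<open>The phase \<theta> is common to all terms: it is pulled out of the sum and disappears
  under the modulus, while the sum stays inside the modulus and remains a kernel.\<close>

lemma norm_trace_series_le:
  assumes a: "\<And>n. 0 \<le> a n" "summable a"
    and r: "\<And>n. sq_int M (r n)" "\<And>n. norm2 M (r n) = 1"
    and s: "\<And>n. sq_int M (s n)" "\<And>n. norm2 M (s n) = 1"
    and \<theta>: "\<theta> \<in> borel_measurable M" "\<And>x. norm (\<theta> x) = 1"
  shows "ennreal (norm (\<Sum>n. of_real (a n) * (\<integral>x. \<theta> x * (r n x * cnj (s n x)) \<partial>M)))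
    \<le> (\<integral>\<^sup>+x. ennreal (norm (\<Sum>n. of_real (a n) * (r n x * cnj (s n x)))) \<partial>M)"
proof -
  note t = integrable_trace_series[OF a r s \<theta>]
  have "norm (\<integral>x. \<theta> x * (\<Sum>n. of_real (a n) * (r n x * cnj (s n x))) \<partial>M)
      \<le> (\<integral>x. norm (\<theta> x * (\<Sum>n. of_real (a n) * (r n x * cnj (s n x)))) \<partial>M)"
    by (rule integral_norm_bound)
  also have "\<dots> = (\<integral>x. norm (\<Sum>n. of_real (a n) * (r n x * cnj (s n x))) \<partial>M)"
    by (simp add: norm_mult \<theta>)
  finally have "ennreal (norm (\<integral>x. \<theta> x * (\<Sum>n. of_real (a n) * (r n x * cnj (s n x))) \<partial>M))
      \<le> ennreal (\<integral>x. norm (\<Sum>n. of_real (a n) * (r n x * cnj (s n x))) \<partial>M)"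
    by (rule ennreal_leI)
  also have "\<dots> = (\<integral>\<^sup>+x. ennreal (norm (\<Sum>n. of_real (a n) * (r n x * cnj (s n x)))) \<partial>M)"
    using t(2) by (intro nn_integral_eq_integral[symmetric]) auto
  finally show ?thesis unfolding t(3) .
qed

text \<open>Termwise integration with the phase of the Fourier integral; each inner product is the
  trace of the modulated rank one operator \<open>|u n><v n|\<close>.\<close>

lemma fourier_density:
  assumes a: "\<And>n. 0 \<le> a n" "summable a"
    and u: "\<And>n. sq_int lborel (u n)" "\<And>n. norm2 lborel (u n) = 1"
    and v: "\<And>n. sq_int lborel (v n)" "\<And>n. norm2 lborel (v n) = 1"
  shows "fourier (\<lambda>x. of_real c * (\<Sum>n. of_real (a n) * u n x * cnj (v n x))) \<xi>
    = of_real (c\<^sub>F * c) * (\<Sum>n. of_real (a n) * inner2 lborel (\<lambda>x. cis (x \<bullet> \<xi>) * v n x) (u n))"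
proof -
  have \<theta>: "(\<lambda>x. cis (- (x \<bullet> \<xi>))) \<in> borel_measurable lborel" "norm (cis (- (x \<bullet> \<xi>))) = 1" for x :: R3
    by simp_all
  have "(\<integral>x. cis (- (x \<bullet> \<xi>)) * (u n x * cnj (v n x)) \<partial>lborel) = inner2 lborel (\<lambda>x. cis (x \<bullet> \<xi>) * v n x) (u n)" for n
    unfolding inner2_def by (intro Bochner_Integration.integral_cong) (simp_all add: cis_cnj mult_ac)
  then have "(\<integral>x. cis (- (x \<bullet> \<xi>)) * (\<Sum>n. of_real (a n) * (u n x * cnj (v n x))) \<partial>lborel)
      = (\<Sum>n. of_real (a n) * inner2 lborel (\<lambda>x. cis (x \<bullet> \<xi>) * v n x) (u n))"
    using integrable_trace_series(3)[OF a u v \<theta>] by simp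
  then show ?thesis
    unfolding fourier_cmult by (simp add: fourier_def mult_ac)
qed

text \<open>Plancherel and the modulation rule. The two propagator phases combine into one factor
  independent of \<open>p\<close> and \<open>q\<close>, as \<open>norm_trace_series_le\<close>
  requires.\<close>

lemma inner2_modulated_fourier:
  assumes p: "sq_int lborel p" "AE x in lborel. propagator h t p x = u x" and u: "sq_int lborel u"
    and q: "sq_int lborel q" "AE x in lborel. propagator h t q x = v x" and v: "sq_int lborel v"
  shows "inner2 lborel (\<lambda>x. cis (x \<bullet> \<xi>) * v x) u =
    (\<integral>\<eta>. cis (t * h * (norm (\<eta> - \<xi>))\<^sup>2 / 2 - t * h * (norm \<eta>)\<^sup>2 / 2) *
      (l2_fourier p \<eta> * cnj (l2_fourier q (\<eta> - \<xi>))) \<partial>lborel)"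
proof -
  note F = l2_unitaryD[OF l2_unitary_l2_fourier]
  note U = l2_unitaryD[OF l2_unitary_propagator[of h t]]
  let ?m = "\<lambda>\<eta>::R3. cis (- (t * h * (norm \<eta>)\<^sup>2 / 2))"
  have hat: "AE \<eta> in lborel. l2_fourier g \<eta> = ?m \<eta> * l2_fourier f \<eta>"
    if "sq_int lborel f" "sq_int lborel g" "AE x in lborel. propagator h t f x = g x" for f g
    using propagator_spec(2)[OF that(1), of h t] l2_unitary_AE_iff[OF l2_unitary_l2_fourier U(1)[OF that(1)] that(2)] that(3)
    by (auto elim: eventually_elim2)
  have vmod: "sq_int lborel (\<lambda>x. cis (x \<bullet> \<xi>) * v x)"
    by (rule sq_int_cis_mult[OF v]) simp
  have mF: "sq_int lborel (\<lambda>\<eta>. ?m \<eta> * l2_fourier f \<eta>)" if "sq_int lborel f" for f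
    by (rule sq_int_cis_mult[OF F(1)[OF that]]) simp
  have "AE \<eta> in lborel. l2_fourier v (- \<xi> + 1 *\<^sub>R \<eta>) = ?m (- \<xi> + 1 *\<^sub>R \<eta>) * l2_fourier q (- \<xi> + 1 *\<^sub>R \<eta>)"
    using hat[OF q(1) v q(2)] by (rule lborel_AE_shift[rotated]) simp
  then have "AE \<eta> in lborel. l2_fourier v (\<eta> - \<xi>) = ?m (\<eta> - \<xi>) * l2_fourier q (\<eta> - \<xi>)"
    by simp
  with l2_fourier_modulation[OF v, of \<xi>]
  have ae: "AE \<eta> in lborel. l2_fourier (\<lambda>x. cis (x \<bullet> \<xi>) * v x) \<eta> = ?m (\<eta> - \<xi>) * l2_fourier q (\<eta> - \<xi>)"
    by eventually_elim simp
  have "inner2 lborel (\<lambda>x. cis (x \<bullet> \<xi>) * v x) u = inner2 lborel (l2_fourier (\<lambda>x. cis (x \<bullet> \<xi>) * v x)) (l2_fourier u)"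
    by (rule F(2)[OF vmod u, symmetric])
  also have "\<dots> = inner2 lborel (\<lambda>\<eta>. ?m (\<eta> - \<xi>) * l2_fourier q (\<eta> - \<xi>)) (\<lambda>\<eta>. ?m \<eta> * l2_fourier p \<eta>)"
    by (intro inner2_cong_AE ae hat p u F(1) vmod mF sq_int_shift[OF mF] q)
  also have "\<dots> = (\<integral>\<eta>. cis (t * h * (norm (\<eta> - \<xi>))\<^sup>2 / 2 - t * h * (norm \<eta>)\<^sup>2 / 2) *
      (l2_fourier p \<eta> * cnj (l2_fourier q (\<eta> - \<xi>))) \<partial>lborel)"
    unfolding inner2_def
  proof (intro Bochner_Integration.integral_cong refl)
    fix \<eta> :: R3
    have "cis (t * h * (norm (\<eta> - \<xi>))\<^sup>2 / 2 - t * h * (norm \<eta>)\<^sup>2 / 2) = cnj (?m (\<eta> - \<xi>)) * ?m \<eta>"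
      by (simp add: cis_cnj cis_mult)
    then show "cnj (?m (\<eta> - \<xi>) * l2_fourier q (\<eta> - \<xi>)) * (?m \<eta> * l2_fourier p \<eta>) =
        cis (t * h * (norm (\<eta> - \<xi>))\<^sup>2 / 2 - t * h * (norm \<eta>)\<^sup>2 / 2) * (l2_fourier p \<eta> * cnj (l2_fourier q (\<eta> - \<xi>)))"
      by (simp only: complex_cnj_mult mult_ac)
  qed
  finally show ?thesis .
qed

text \<open>In the phase of \<open>inner2_modulated_fourier\<close> the terms quadratic in
  \<open>\<eta>\<close> cancel. What is left is a constant and a phase linear in
  \<open>\<eta>\<close>, which is a translation of \<open>p\<close> once the transform is
  undone.\<close>

lemma inner2_modulated_position:
  assumes p: "sq_int lborel p" "AE x in lborel. propagator h t p x = u x" and u: "sq_int lborel u"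
    and q: "sq_int lborel q" "AE x in lborel. propagator h t q x = v x" and v: "sq_int lborel v"
  shows "inner2 lborel (\<lambda>x. cis (x \<bullet> \<xi>) * v x) u =
    (\<integral>x. cis (t * h * (norm \<xi>)\<^sup>2 / 2 - x \<bullet> \<xi>) * (p (x - (t * h) *\<^sub>R \<xi>) * cnj (q x)) \<partial>lborel)"
proof -
  note F = l2_unitaryD[OF l2_unitary_l2_fourier]
  let ?a = "(t * h) *\<^sub>R \<xi>" and ?ph = "cis (t * h * (norm \<xi>)\<^sup>2 / 2)"
  have qmod: "sq_int lborel (\<lambda>x. cis (x \<bullet> \<xi>) * q x)"
    by (rule sq_int_cis_mult[OF q(1)]) simp
  have ps: "sq_int lborel (\<lambda>x. p (x - ?a))" by (rule sq_int_shift[OF p(1)])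
  have pm: "sq_int lborel (\<lambda>\<eta>. cis (- (?a \<bullet> \<eta>)) * l2_fourier p \<eta>)"
    by (rule sq_int_cis_mult[OF F(1)[OF p(1)]]) simp
  have phase: "cis (t * h * (norm (\<eta> - \<xi>))\<^sup>2 / 2 - t * h * (norm \<eta>)\<^sup>2 / 2) = ?ph * cis (- (?a \<bullet> \<eta>))" for \<eta> :: R3
  proof -
    have "t * h * (norm (\<eta> - \<xi>))\<^sup>2 / 2 - t * h * (norm \<eta>)\<^sup>2 / 2 = t * h * (norm \<xi>)\<^sup>2 / 2 + - (?a \<bullet> \<eta>)"
      by (simp add: power2_norm_eq_inner inner_diff_left inner_diff_right inner_commute field_simps)
    then show ?thesis by (simp only: cis_mult)
  qed
  have "inner2 lborel (\<lambda>x. cis (x \<bullet> \<xi>) * v x) u =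
      (\<integral>\<eta>. ?ph * (cnj (l2_fourier q (\<eta> - \<xi>)) * (cis (- (?a \<bullet> \<eta>)) * l2_fourier p \<eta>)) \<partial>lborel)"
    unfolding inner2_modulated_fourier[OF assms] phase by (simp only: mult_ac)
  also have "\<dots> = ?ph * inner2 lborel (\<lambda>\<eta>. l2_fourier q (\<eta> - \<xi>)) (\<lambda>\<eta>. cis (- (?a \<bullet> \<eta>)) * l2_fourier p \<eta>)"
    unfolding inner2_def by (rule integral_mult_right_zero)
  also have "inner2 lborel (\<lambda>\<eta>. l2_fourier q (\<eta> - \<xi>)) (\<lambda>\<eta>. cis (- (?a \<bullet> \<eta>)) * l2_fourier p \<eta>) =
      inner2 lborel (l2_fourier (\<lambda>x. cis (x \<bullet> \<xi>) * q x)) (l2_fourier (\<lambda>x. p (x - ?a)))"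
    by (rule inner2_cong_AE[symmetric])
       (intro l2_fourier_modulation l2_fourier_translation p q F(1) qmod ps pm sq_int_shift[OF F(1)[OF q(1)]])+
  also have "\<dots> = inner2 lborel (\<lambda>x. cis (x \<bullet> \<xi>) * q x) (\<lambda>x. p (x - ?a))"
    by (rule F(2)[OF qmod ps])
  also have "?ph * \<dots> = (\<integral>x. ?ph * (cnj (cis (x \<bullet> \<xi>) * q x) * p (x - ?a)) \<partial>lborel)"
    unfolding inner2_def by (rule integral_mult_right_zero[symmetric])
  also have "\<dots> = (\<integral>x. cis (t * h * (norm \<xi>)\<^sup>2 / 2 - x \<bullet> \<xi>) * (p (x - ?a) * cnj (q x)) \<partial>lborel)"
  proof (intro Bochner_Integration.integral_cong refl)
    fix x :: R3
    have "cis (t * h * (norm \<xi>)\<^sup>2 / 2 - x \<bullet> \<xi>) = ?ph * cnj (cis (x \<bullet> \<xi>))"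
      by (simp add: cis_cnj cis_mult)
    then show "?ph * (cnj (cis (x \<bullet> \<xi>) * q x) * p (x - ?a)) = cis (t * h * (norm \<xi>)\<^sup>2 / 2 - x \<bullet> \<xi>) * (p (x - ?a) * cnj (q x))"
      by (simp only: complex_cnj_mult mult_ac)
  qed
  finally show ?thesis .
qed

section \<open>Changes of variables for kernels\<close>

lemma nn_integral_shear_difference:
  fixes K :: "'a::euclidean_space \<times> 'a \<Rightarrow> ennreal"
  assumes [measurable]: "K \<in> borel_measurable lborel2"
  shows "(\<integral>\<^sup>+\<xi>. (\<integral>\<^sup>+\<eta>. K (\<eta>, \<eta> - \<xi>) \<partial>lborel) \<partial>lborel) = (\<integral>\<^sup>+z. K z \<partial>lborel2)"
proof -
  have "(\<integral>\<^sup>+\<xi>. (\<integral>\<^sup>+\<eta>. K (\<eta>, \<eta> - \<xi>) \<partial>lborel) \<partial>lborel) = (\<integral>\<^sup>+\<eta>. (\<integral>\<^sup>+\<xi>. K (\<eta>, \<eta> - \<xi>) \<partial>lborel) \<partial>lborel)"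
    by (rule lborel_pair.Fubini') measurable
  also have "\<dots> = (\<integral>\<^sup>+\<eta>. (\<integral>\<^sup>+\<zeta>. K (\<eta>, \<zeta>) \<partial>lborel) \<partial>lborel)"
  proof (rule nn_integral_cong)
    fix \<eta> :: 'a
    show "(\<integral>\<^sup>+\<xi>. K (\<eta>, \<eta> - \<xi>) \<partial>lborel) = (\<integral>\<^sup>+\<zeta>. K (\<eta>, \<zeta>) \<partial>lborel)"
      by (subst lborel_scale_shift[of "- 1" "\<lambda>\<zeta>. K (\<eta>, \<zeta>)" \<eta>]) simp_all
  qed
  also have "\<dots> = (\<integral>\<^sup>+z. K z \<partial>lborel2)"
    by (rule lborel.nn_integral_fst) measurable
  finally show ?thesis .
qed

text \<open>After exchanging the integrals, \<open>y = x - r *\<^sub>R \<xi>\<close> is substituted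
  for \<open>\<xi>\<close> with \<open>x\<close> fixed; this is where the dispersive factor
  arises.\<close>

lemma nn_integral_shear_translation:
  fixes K :: "'a::euclidean_space \<times> 'a \<Rightarrow> ennreal"
  assumes [measurable]: "K \<in> borel_measurable lborel2" and r: "r \<noteq> 0"
  shows "(\<integral>\<^sup>+\<xi>. (\<integral>\<^sup>+x. K (x - r *\<^sub>R \<xi>, x) \<partial>lborel) \<partial>lborel)
    = ennreal (1 / \<bar>r\<bar> ^ DIM('a)) * (\<integral>\<^sup>+z. K z \<partial>lborel2)"
proof -
  have inv: "ennreal (1 / \<bar>r\<bar> ^ DIM('a)) * (ennreal (\<bar>r\<bar> ^ DIM('a)) * y) = y" for y
    using r by (simp add: ennreal_mult[symmetric] mult.assoc[symmetric])
  have "(\<integral>\<^sup>+\<xi>. (\<integral>\<^sup>+x. K (x - r *\<^sub>R \<xi>, x) \<partial>lborel) \<partial>lborel) = (\<integral>\<^sup>+x. (\<integral>\<^sup>+\<xi>. K (x - r *\<^sub>R \<xi>, x) \<partial>lborel) \<partial>lborel)"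
    by (rule lborel_pair.Fubini') measurable
  also have "\<dots> = (\<integral>\<^sup>+x. ennreal (1 / \<bar>r\<bar> ^ DIM('a)) * (\<integral>\<^sup>+y. K (y, x) \<partial>lborel) \<partial>lborel)"
  proof (rule nn_integral_cong)
    fix x :: 'a
    show "(\<integral>\<^sup>+\<xi>. K (x - r *\<^sub>R \<xi>, x) \<partial>lborel) = ennreal (1 / \<bar>r\<bar> ^ DIM('a)) * (\<integral>\<^sup>+y. K (y, x) \<partial>lborel)"
      by (subst lborel_scale_shift[of "- r" "\<lambda>y. K (y, x)" x]) (simp_all add: r inv)
  qed
  also have "\<dots> = ennreal (1 / \<bar>r\<bar> ^ DIM('a)) * (\<integral>\<^sup>+x. (\<integral>\<^sup>+y. K (y, x) \<partial>lborel) \<partial>lborel)"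
    by (rule nn_integral_cmult) measurable
  also have "(\<integral>\<^sup>+x. (\<integral>\<^sup>+y. K (y, x) \<partial>lborel) \<partial>lborel) = (\<integral>\<^sup>+z. K z \<partial>lborel2)"
    by (rule lborel_pair.nn_integral_snd) measurable
  finally show ?thesis .
qed

section \<open>The estimates\<close>

lemma norm2_orthonormal: "orthonormal u \<Longrightarrow> norm2 lborel (u n) = 1"
proof -
  assume "orthonormal u"
  then have "complex_of_real ((norm2 lborel (u n))\<^sup>2) = 1"
    unfolding inner2_self[symmetric] by (simp add: orthonormal_def l2inner_eq)
  then have "(norm2 lborel (u n))\<^sup>2 = 1" by (simp only: of_real_eq_1_iff)
  then show "norm2 lborel (u n) = 1"
    using norm2_nonneg[of lborel "u n"] by (simp add: power2_eq_1_iff)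
qed

text \<open>One summable decomposition makes the choice in \<open>rho_h\<close> legitimate; the one
  actually chosen may be different.\<close>

lemma rho_h_svd:
  assumes "svd A a u v" "summable a"
  obtains a' u' v' where "svd A a' u' v'" "summable a'"
    "rho_h h A = (\<lambda>x. of_real ((2 * pi * h) ^ 3) * (\<Sum>n. of_real (a' n) * u' n x * cnj (v' n x)))"
proof -
  let ?P = "\<lambda>(a, u, v). svd A a u v \<and> summable a"
  obtain a' u' v' where eq: "(SOME x. ?P x) = (a', u', v')" using prod_cases3 .
  have "?P (SOME x. ?P x)" by (rule someI[of ?P "(a, u, v)"]) (use assms in simp)
  then have "svd A a' u' v' \<and> summable a'" unfolding eq by simp
  then show thesis using that[of a' u' v'] by (simp add: rho_h_def eq)
qed

text \<open>Bookkeeping shared by both estimates: \<open>g\<close> is the integral of the kernel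
  over a fibre, \<open>b\<close> the Jacobian and \<open>c\<close> the bound on the weight integral.
  The exponents of \<open>2 * pi\<close> add up to -3/2 + 3 - 3/2 = 0.\<close>

lemma FL1_norm_le:
  assumes h: "0 < h" and K: "K \<in> borel_measurable lborel2"
    and le: "\<And>\<xi>. ennreal (norm (fourier \<rho> \<xi>)) \<le> ennreal (c\<^sub>F * (2 * pi * h) ^ 3) * g \<xi>"
    and g: "g \<in> borel_measurable lborel"
    and int: "(\<integral>\<^sup>+\<xi>. g \<xi> \<partial>lborel) \<le> ennreal b * (\<integral>\<^sup>+z. K z \<partial>lborel2)"
    and KN: "(\<integral>\<^sup>+z. K z \<partial>lborel2) \<le> ennreal (c * (2 * pi * h) powr (-3/2)) * N"
    and b: "0 \<le> b" and c: "0 \<le> c"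
  shows "FL1_norm \<rho> \<le> ennreal (b * c * h powr (3/2)) * N"
proof -
  have "FL1_norm \<rho> \<le> (\<integral>\<^sup>+\<xi>. ennreal (c\<^sub>F * (2 * pi * h) ^ 3) * g \<xi> \<partial>lborel)"
    unfolding FL1_norm_def by (intro nn_integral_mono le)
  also have "\<dots> = ennreal (c\<^sub>F * (2 * pi * h) ^ 3) * (\<integral>\<^sup>+\<xi>. g \<xi> \<partial>lborel)"
    by (rule nn_integral_cmult[OF g])
  also have "\<dots> \<le> ennreal (c\<^sub>F * (2 * pi * h) ^ 3) * (ennreal b * (ennreal (c * (2 * pi * h) powr (-3/2)) * N))"
    by (intro mult_left_mono order_trans[OF int] KN) auto
  also have "\<dots> = ennreal (c\<^sub>F * (2 * pi * h) ^ 3 * (b * (c * (2 * pi * h) powr (-3/2)))) * N"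
    using h b c by (simp add: ennreal_mult mult.assoc)
  also have "c\<^sub>F * (2 * pi * h) ^ 3 * (b * (c * (2 * pi * h) powr (-3/2))) = b * c * h powr (3/2)"
  proof -
    have "(2 * pi * h) ^ 3 = (2 * pi) powr 3 * h powr 3"
      using h powr_realpow[of "2 * pi * h" 3] by (simp add: powr_mult)
    moreover have "(2 * pi * h) powr (-3/2) = (2 * pi) powr (-3/2) * h powr (-3/2)"
      using h by (simp add: powr_mult)
    ultimately have "c\<^sub>F * (2 * pi * h) ^ 3 * (b * (c * (2 * pi * h) powr (-3/2))) =
        (c\<^sub>F * (2 * pi) powr 3 * (2 * pi) powr (-3/2)) * (b * c * (h powr 3 * h powr (-3/2)))"
      by (simp only: mult_ac)
    moreover have "c\<^sub>F * (2 * pi) powr 3 * (2 * pi) powr (-3/2) = 1"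
      unfolding powr_add[symmetric] by simp
    moreover have "h powr 3 * h powr (-3/2) = h powr (3/2)"
      by (simp add: powr_add[symmetric])
    ultimately show ?thesis by (simp only: mult_1)
  qed
  finally show ?thesis .
qed

theorem lemma3p3:
  fixes \<sigma> :: real
  assumes "3/2 < \<sigma>" and "\<sigma> < 2"
  shows "\<exists>C::real. C > 0 \<and>
    (\<forall>h t :: real. \<forall>\<gamma> :: wave_op. 0 < h \<and> h \<le> 1 \<and> trace_class \<gamma> \<longrightarrow>
       FL1_norm (rho_h h (evolved h t \<gamma>))
         \<le> ennreal (C / h powr (3/2)) * momentum_weighted_norm h \<sigma> \<gamma> \<and>
       (t \<noteq> 0 \<longrightarrow>
         FL1_norm (rho_h h (evolved h t \<gamma>))
           \<le> ennreal (C / (h powr (3/2) * \<bar>t\<bar> ^ 3)) * position_weighted_norm h \<sigma> \<gamma>))"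
proof -
  define Iw where "Iw = (\<integral>x. (1 / bracket x powr \<sigma>)\<^sup>2 \<partial>lborel)"
  \<comment> \<open>One constant for both estimates; the added 1 makes it visibly positive.\<close>
  define C where "C = Iw + 1"
  have "0 \<le> Iw" by (simp add: Iw_def)
  then have C: "0 < C" "Iw \<le> C" by (simp_all add: C_def)
  note Fu = l2_unitary_l2_fourier
  have "FL1_norm (rho_h h (evolved h t \<gamma>)) \<le> ennreal (C / h powr (3/2)) * momentum_weighted_norm h \<sigma> \<gamma> \<and>
     (t \<noteq> 0 \<longrightarrow> FL1_norm (rho_h h (evolved h t \<gamma>)) \<le> ennreal (C / (h powr (3/2) * \<bar>t\<bar> ^ 3)) * position_weighted_norm h \<sigma> \<gamma>)"
    if h: "0 < h" and tc: "trace_class \<gamma>" for h t \<gamma>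
  proof -
    let ?\<rho> = "rho_h h (evolved h t \<gamma>)"
    define U where "U = propagator h t"
    have U: "l2_unitary U" unfolding U_def by (rule l2_unitary_propagator)
    have \<gamma>: "bounded_op \<gamma>" using tc by (simp add: trace_class_def)
    obtain a0 u0 v0 where s0: "svd \<gamma> a0 u0 v0" "summable a0" using tc by (auto simp: trace_class_def)
    have ev: "evolved h t \<gamma> = U \<circ> \<gamma> \<circ> adj_op U" by (simp add: evolved_def U_def)
    obtain a u v where svd: "svd (U \<circ> \<gamma> \<circ> adj_op U) a u v" "summable a"
      and \<rho>: "?\<rho> = (\<lambda>x. of_real ((2 * pi * h) ^ 3) * (\<Sum>n. of_real (a n) * u n x * cnj (v n x)))"
      unfolding ev by (rule rho_h_svd[OF svd_conjugate[OF U s0(1) \<gamma>] s0(2)])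
    have a: "0 \<le> a n" for n using svd(1) by (simp add: svd_def)
    have u: "sq_int lborel (u n)" "norm2 lborel (u n) = 1" and v: "sq_int lborel (v n)" "norm2 lborel (v n) = 1" for n
      using svd(1) norm2_orthonormal[of u] norm2_orthonormal[of v] by (auto simp: svd_def orthonormal_def L2_iff)
    \<comment> \<open>\<open>p\<close> and the analogous \<open>q\<close> are the singular vectors
      of the evolved operator pulled back through \<open>U\<close>; they decompose \<gamma>
      itself.\<close>
    have "\<exists>p. \<forall>n. sq_int lborel (p n) \<and> (AE x in lborel. U (p n) x = u n x)"
      using U u by (intro choice allI) (auto simp: l2_unitary_def)
    then obtain p where p: "\<And>n. sq_int lborel (p n)" "\<And>n. AE x in lborel. U (p n) x = u n x" by blast
    have "\<exists>q. \<forall>n. sq_int lborel (q n) \<and> (AE x in lborel. U (q n) x = v n x)"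
      using U v by (intro choice allI) (auto simp: l2_unitary_def)
    then obtain q where q: "\<And>n. sq_int lborel (q n)" "\<And>n. AE x in lborel. U (q n) x = v n x" by blast
    have np: "norm2 lborel (p n) = 1" for n
    proof -
      have "norm2 lborel (U (p n)) = norm2 lborel (u n)"
        by (rule norm2_cong_AE[OF p(2)]) (intro sq_int_measurable l2_unitaryD(1)[OF U] p u)+
      then show ?thesis by (simp add: l2_unitary_norm[OF U p(1)] u(2))
    qed
    have nq: "norm2 lborel (q n) = 1" for n
    proof -
      have "norm2 lborel (U (q n)) = norm2 lborel (v n)"
        by (rule norm2_cong_AE[OF q(2)]) (intro sq_int_measurable l2_unitaryD(1)[OF U] q v)+
      then show ?thesis by (simp add: l2_unitary_norm[OF U q(1)] v(2))
    qed
    note sums = svd_unconjugate_sums[OF U \<gamma> svd(1) p q]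
    have fr: "fourier (?\<rho>) \<xi> = of_real (c\<^sub>F * (2 * pi * h) ^ 3) *
        (\<Sum>n. of_real (a n) * inner2 lborel (\<lambda>x. cis (x \<bullet> \<xi>) * v n x) (u n))" for \<xi>
      unfolding \<rho> by (rule fourier_density[OF a svd(2) u v])
    have c0: "0 \<le> c\<^sub>F * (2 * pi * h) ^ 3" using h by simp
    \<comment> \<open>Modulus of the integral kernel of \<gamma> conjugated by \<open>V\<close>,
      with \<open>V\<close> the Fourier transform or the identity.\<close>
    define K where "K V z = ennreal (norm (\<Sum>n. of_real (a n) * tens (V (p n)) (V (q n)) z))" for V :: wave_op and z
    have K: "K V \<in> borel_measurable lborel2" if V: "l2_unitary V" for V
    proof -
      have "tens (V (p n)) (V (q n)) \<in> borel_measurable lborel2" for n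
        using sq_int_tens[OF l2_unitaryD(1)[OF V p(1)] l2_unitaryD(1)[OF V q(1)]] by (rule sq_int_measurable)
      then show ?thesis unfolding K_def[abs_def] by measurable
    qed
    \<comment> \<open>The shear preserves volume, hence the Jacobian 1; the weight contributes
      \<open>C / h ^ 3\<close>.\<close>
    have first: "FL1_norm (?\<rho>) \<le> ennreal (1 * (C / h ^ 3) * h powr (3/2)) * momentum_weighted_norm h \<sigma> \<gamma>"
    proof (rule FL1_norm_le[OF h K[OF Fu]])
      have [measurable]: "K l2_fourier \<in> borel_measurable lborel2" by (rule K[OF Fu])
      show "(\<lambda>\<xi>. \<integral>\<^sup>+\<eta>. K l2_fourier (\<eta>, \<eta> - \<xi>) \<partial>lborel) \<in> borel_measurable lborel" by measurable
      show "ennreal (norm (fourier (?\<rho>) \<xi>)) \<le> ennreal (c\<^sub>F * (2 * pi * h) ^ 3) * (\<integral>\<^sup>+\<eta>. K l2_fourier (\<eta>, \<eta> - \<xi>) \<partial>lborel)" for \<xi>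
      proof -
        have "ennreal (norm (\<Sum>n. of_real (a n) * inner2 lborel (\<lambda>x. cis (x \<bullet> \<xi>) * v n x) (u n)))
            \<le> (\<integral>\<^sup>+\<eta>. ennreal (norm (\<Sum>n. of_real (a n) * (l2_fourier (p n) \<eta> * cnj (l2_fourier (q n) (\<eta> - \<xi>))))) \<partial>lborel)"
          unfolding inner2_modulated_fourier[OF p(1) p(2)[unfolded U_def] u(1) q(1) q(2)[unfolded U_def] v(1)]
          by (rule norm_trace_series_le[OF a svd(2)])
             (simp_all add: sq_int_l2_fourier p q norm2_l2_fourier np nq sq_int_shift norm2_shift)
        also have "\<dots> = (\<integral>\<^sup>+\<eta>. K l2_fourier (\<eta>, \<eta> - \<xi>) \<partial>lborel)" by (simp add: K_def tens_def)
        finally have "ennreal (c\<^sub>F * (2 * pi * h) ^ 3) * ennreal (norm (\<Sum>n. of_real (a n) * inner2 lborel (\<lambda>x. cis (x \<bullet> \<xi>) * v n x) (u n)))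
            \<le> ennreal (c\<^sub>F * (2 * pi * h) ^ 3) * (\<integral>\<^sup>+\<eta>. K l2_fourier (\<eta>, \<eta> - \<xi>) \<partial>lborel)" by (rule mult_left_mono) simp
        then show ?thesis
          unfolding fr norm_mult norm_of_real abs_of_nonneg[OF c0] by (simp only: ennreal_mult[OF c0 norm_ge_zero])
      qed
      show "(\<integral>\<^sup>+\<xi>. (\<integral>\<^sup>+\<eta>. K l2_fourier (\<eta>, \<eta> - \<xi>) \<partial>lborel) \<partial>lborel) \<le> ennreal 1 * (\<integral>\<^sup>+z. K l2_fourier z \<partial>lborel2)"
        by (simp add: nn_integral_shear_difference)
      let ?w = "\<lambda>\<xi>. bracket (h *\<^sub>R \<xi>) powr \<sigma>"
      have g: "(\<lambda>x. (1 / bracket x powr \<sigma>)\<^sup>2) \<in> borel_measurable borel" by measurable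
      note scale = lborel_integral_scale_shift[of h "\<lambda>x. (1 / bracket x powr \<sigma>)\<^sup>2" 0, OF _ g]
      show "(\<integral>\<^sup>+z. K l2_fourier z \<partial>lborel2) \<le> ennreal (C / h ^ 3 * (2 * pi * h) powr (-3/2)) * momentum_weighted_norm h \<sigma> \<gamma>"
        unfolding K_def momentum_weighted_norm_def
      proof (rule sandwich_kernel_bound[where w = ?w, OF Fu])
        show "1 \<le> ?w \<xi>" for \<xi> using assms(1) bracket_ge_1 by (intro ge_one_powr_ge_zero) auto
        show "integrable lborel (\<lambda>\<xi>. (1 / ?w \<xi>)\<^sup>2)"
          using scale(1) integrable_bracket[OF assms(1)] h by simp
        \<comment> \<open>Rescaling by \<open>h\<close> reduces the momentum weight to the unscaled
          one, which is the source of \<open>C / h ^ 3\<close>.\<close>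
        have "Iw = h ^ 3 * (\<integral>\<xi>. (1 / ?w \<xi>)\<^sup>2 \<partial>lborel)" using scale(2) h by (simp add: Iw_def)
        then have "(\<integral>\<xi>. (1 / ?w \<xi>)\<^sup>2 \<partial>lborel) = Iw / h ^ 3" using h by simp
        then show "(\<integral>\<xi>. (1 / ?w \<xi>)\<^sup>2 \<partial>lborel) \<le> C / h ^ 3" using C(2) h by (simp add: divide_right_mono)
        show "f \<in> fmult_dom (momentum_weight h \<sigma>) \<longleftrightarrow> sq_int lborel f \<and> sq_int lborel (\<lambda>x. of_real (?w x) * l2_fourier f x)" for f
          by (simp add: fmult_dom_def L2_iff momentum_weight_def)
        show "sq_int lborel (fmult (momentum_weight h \<sigma>) f)"
          "AE x in lborel. l2_fourier (fmult (momentum_weight h \<sigma>) f) x = of_real (?w x) * l2_fourier f x"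
          if "f \<in> fmult_dom (momentum_weight h \<sigma>)" for f
          using fmult_spec[of "momentum_weight h \<sigma>" f] that by (simp_all add: fmult_dom_def L2_iff momentum_weight_def)
      qed (use C h a svd(2) p q np nq \<gamma> sums in simp_all)
    qed (use C h in simp_all)
    \<comment> \<open>Here the weight is unscaled and contributes \<open>C\<close>, while the
      Jacobian of the translation by \<open>(t * h) *\<^sub>R \<xi>\<close> supplies the negative
      powers of \<open>h\<close> and \<open>t\<close>.\<close>
    have second: "FL1_norm (?\<rho>) \<le> ennreal (1 / \<bar>t * h\<bar> ^ 3 * C * h powr (3/2)) * position_weighted_norm h \<sigma> \<gamma>" if t: "t \<noteq> 0"
    proof (rule FL1_norm_le[OF h K[OF l2_unitary_id]])
      let ?id = "\<lambda>f::wave. f"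
      have [measurable]: "K ?id \<in> borel_measurable lborel2" by (rule K[OF l2_unitary_id])
      show "(\<lambda>\<xi>. \<integral>\<^sup>+x. K ?id (x - (t * h) *\<^sub>R \<xi>, x) \<partial>lborel) \<in> borel_measurable lborel" by measurable
      show "ennreal (norm (fourier (?\<rho>) \<xi>)) \<le> ennreal (c\<^sub>F * (2 * pi * h) ^ 3) * (\<integral>\<^sup>+x. K ?id (x - (t * h) *\<^sub>R \<xi>, x) \<partial>lborel)" for \<xi>
      proof -
        have "ennreal (norm (\<Sum>n. of_real (a n) * inner2 lborel (\<lambda>x. cis (x \<bullet> \<xi>) * v n x) (u n)))
            \<le> (\<integral>\<^sup>+x. ennreal (norm (\<Sum>n. of_real (a n) * (p n (x - (t * h) *\<^sub>R \<xi>) * cnj (q n x)))) \<partial>lborel)"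
          unfolding inner2_modulated_position[OF p(1) p(2)[unfolded U_def] u(1) q(1) q(2)[unfolded U_def] v(1)]
          by (rule norm_trace_series_le[OF a svd(2)])
             (simp_all add: p q np nq sq_int_shift norm2_shift)
        also have "\<dots> = (\<integral>\<^sup>+x. K ?id (x - (t * h) *\<^sub>R \<xi>, x) \<partial>lborel)" by (simp add: K_def tens_def)
        finally have "ennreal (c\<^sub>F * (2 * pi * h) ^ 3) * ennreal (norm (\<Sum>n. of_real (a n) * inner2 lborel (\<lambda>x. cis (x \<bullet> \<xi>) * v n x) (u n)))
            \<le> ennreal (c\<^sub>F * (2 * pi * h) ^ 3) * (\<integral>\<^sup>+x. K ?id (x - (t * h) *\<^sub>R \<xi>, x) \<partial>lborel)" by (rule mult_left_mono) simp
        then show ?thesis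
          unfolding fr norm_mult norm_of_real abs_of_nonneg[OF c0] by (simp only: ennreal_mult[OF c0 norm_ge_zero])
      qed
      have th: "t * h \<noteq> 0" using t h by simp
      show "(\<integral>\<^sup>+\<xi>. (\<integral>\<^sup>+x. K ?id (x - (t * h) *\<^sub>R \<xi>, x) \<partial>lborel) \<partial>lborel) \<le> ennreal (1 / \<bar>t * h\<bar> ^ 3) * (\<integral>\<^sup>+z. K ?id z \<partial>lborel2)"
        using nn_integral_shear_translation[OF K[OF l2_unitary_id] th] by simp
      let ?w = "\<lambda>x. bracket x powr \<sigma>"
      show "(\<integral>\<^sup>+z. K ?id z \<partial>lborel2) \<le> ennreal (C * (2 * pi * h) powr (-3/2)) * position_weighted_norm h \<sigma> \<gamma>"
        unfolding K_def position_weighted_norm_def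
      proof (rule sandwich_kernel_bound[where w = ?w, OF l2_unitary_id])
        show "1 \<le> ?w x" for x using assms(1) bracket_ge_1 by (intro ge_one_powr_ge_zero) auto
        show "integrable lborel (\<lambda>x. (1 / ?w x)\<^sup>2)" by (rule integrable_bracket[OF assms(1)])
        show "(\<integral>x. (1 / ?w x)\<^sup>2 \<partial>lborel) \<le> C" using C(2) by (simp add: Iw_def)
        show "f \<in> mult_dom (position_weight \<sigma>) \<longleftrightarrow> sq_int lborel f \<and> sq_int lborel (\<lambda>x. of_real (?w x) * f x)" for f
          by (simp add: mult_dom_def L2_iff position_weight_def)
        show "sq_int lborel (mult_op (position_weight \<sigma>) f)"
          "AE x in lborel. mult_op (position_weight \<sigma>) f x = of_real (?w x) * f x"
          if "f \<in> mult_dom (position_weight \<sigma>)" for f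
          using that by (simp_all add: mult_dom_def mult_op_def L2_iff position_weight_def)
      qed (use C h a svd(2) p q np nq \<gamma> sums in simp_all)
    qed (use C in simp_all)
    \<comment> \<open>Writing \<open>h ^ 3\<close> as \<open>r * r\<close> lets the natural and real
      powers of \<open>h\<close> cancel algebraically.\<close>
    define r where "r = h powr (3/2)"
    have r: "0 < r" using h by (simp add: r_def)
    have "h ^ 3 = h powr 3" using h powr_realpow[of h 3] by simp
    also have "\<dots> = r * r" unfolding r_def powr_add[symmetric] by simp
    finally have h3: "h ^ 3 = r * r" .
    have "1 * (C / h ^ 3) * h powr (3/2) = C / h powr (3/2)"
      unfolding h3 r_def[symmetric] using r by simp
    moreover have "1 / \<bar>t * h\<bar> ^ 3 * C * h powr (3/2) = C / (h powr (3/2) * \<bar>t\<bar> ^ 3)"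
      unfolding abs_mult power_mult_distrib abs_of_pos[OF h] h3 r_def[symmetric] using r by simp
    ultimately show ?thesis using first second by simp
  qed
  with C(1) show ?thesis by blast
qed

end
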